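(* Let $d\ge1$ and let $E_1,E_2\subset[1,2]$ be nonempty with upper Minkowski dimensions $\dim_M(E_i)=\beta_i$, $i=1,2$. Let $m$ be an $a$-admissible bilinear multiplier up to order $2$ on $\mathbb{R}^{2d}$, and assume $2a>d+\beta_1+\beta_2$. Then there exists $\gamma>0$ such that $$\|\mathcal{A}^{(2)}_{m,E_1,E_2}(f-\tau_hf,g)\|_{L^2}+\|\mathcal{A}^{(2)}_{m,E_1,E_2}(f,g-\tau_hg)\|_{L^2}\lesssim|h|^\gamma\|f\|_{L^2}\|g\|_{L^2},\quad\forall\,|h|<1.$$ Moreover, under the same hypothesis there exist $\gamma_1,\gamma_2>0$ such that $$\|\mathcal{A}^{(2)}_{m,E_1,E_2}(f-\tau_{h_1}f,g-\tau_{h_2}g)\|_{L^2}\lesssim|h_1|^{\gamma_1}|h_2|^{\gamma_2}\|f\|_{L^2}\|g\|_{L^2},\quad\forall\,|h_1|<1,\ |h_2|<1.$$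
   Context: All functions are on $\mathbb{R}^d$, $h,h_1,h_2\in\mathbb{R}^d$, and $\tau_hf(x)=f(x-h)$. Operators are initially defined for $f,g\in C_0^\infty(\mathbb{R}^d)$, and $A\lesssim B$ means $A\le CB$ with $C$ independent of $f,g,h,h_1,h_2$. The Fourier transform is $\hat f(\xi)=\int f(x)e^{-2\pi i x\cdot\xi}\,dx$. Admissible multipliers: for $k\ge 0$, a bounded function $m:\mathbb{R}^{2d}\to\mathbb{C}$ is $a$-admissible up to order $k$ if $m\in C^k(\mathbb{R}^{2d})$, $a>\frac d2$, and $|\partial^\alpha m(\xi,\eta)|\lesssim_\alpha (1+|\xi|+|\eta|)^{-a}$ for all multi-indices $\alpha$ with $|\alpha|\le k$ and all $\xi,\eta\in\mathbb{R}^d$. The biparameter operators are $$T_{m_{t_1,t_2}}(f,g)(x)=\int_{\mathbb{R}^{2d}}\hat f(\xi)\hat g(\eta)m(t_1\xi,t_2\eta)e^{2\pi ix\cdot(\xi+\eta)}\,d\xi d\eta,$$ $$\mathcal{A}^{(2)}_{m,E_1,E_2}(f,g)(x)=\sup_{t_1\in E_1,\,t_2\in E_2}|T_{m_{t_1,t_2}}(f,g)(x)|.$$ Upper Minkowski dimension: $\dim_M(E)=\limsup_{\delta\to0}\frac{\log N(E,\delta)}{\log(1/\delta)}$, where $N(E,\delta)$ is the minimal number of closed intervals of length $\delta$ needed to cover $E$. *)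

theory Defs
  imports "HOL-Analysis.Analysis"
begin

definition translate :: "'a::euclidean_space \<Rightarrow> ('a \<Rightarrow> complex) \<Rightarrow> 'a \<Rightarrow> complex" where
  "translate h f x = f (x - h)"

definition partial_deriv :: "'a::euclidean_space \<Rightarrow> ('a \<Rightarrow> complex) \<Rightarrow> 'a \<Rightarrow> complex" where
  "partial_deriv b f x = vector_derivative (\<lambda>t::real. f (x + t *\<^sub>R b)) (at 0)"

text \<open>
  A multi-index of order \<open>j\<close> is encoded as a list of \<open>j\<close> coordinate directions (elements of
  \<open>Basis\<close>, with repetition).  For functions of class \<open>C\<^sup>k\<close> and \<open>j \<le> k\<close> the order of the
  directions does not affect the derivative.
\<close>

definition iter_partial :: "'a::euclidean_space list \<Rightarrow> ('a \<Rightarrow> complex) \<Rightarrow> 'a \<Rightarrow> complex" where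
  "iter_partial bs f = fold partial_deriv bs f"

primrec C_class :: "nat \<Rightarrow> ('a::euclidean_space \<Rightarrow> complex) \<Rightarrow> bool" where
  "C_class 0 f \<longleftrightarrow> continuous_on UNIV f"
| "C_class (Suc k) f \<longleftrightarrow> continuous_on UNIV f \<and>
     (\<forall>b\<in>Basis. (\<forall>x. (\<lambda>t::real. f (x + t *\<^sub>R b)) differentiable (at 0)) \<and>
                C_class k (partial_deriv b f))"

definition test_function :: "('a::euclidean_space \<Rightarrow> complex) \<Rightarrow> bool" where
  "test_function f \<longleftrightarrow> (\<forall>k. C_class k f) \<and> compact (closure {x. f x \<noteq> 0})"

definition fourier :: "('a::euclidean_space \<Rightarrow> complex) \<Rightarrow> 'a \<Rightarrow> complex" where
  "fourier f \<xi> = (LINT x|lborel. f x * exp (- 2 * of_real pi * \<i> * of_real (x \<bullet> \<xi>)))"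

definition admissible ::
  "real \<Rightarrow> nat \<Rightarrow> ('a::euclidean_space \<times> 'a \<Rightarrow> complex) \<Rightarrow> bool" where
  "admissible a k m \<longleftrightarrow>
     bounded (range m) \<and> C_class k m \<and> a > real DIM('a) / 2 \<and>
     (\<forall>bs. set bs \<subseteq> Basis \<and> length bs \<le> k \<longrightarrow>
        (\<exists>C>0. \<forall>\<xi> \<eta>. norm (iter_partial bs m (\<xi>, \<eta>))
                       \<le> C * (1 + norm \<xi> + norm \<eta>) powr (- a)))"

definition bilinear_op ::
  "('a::euclidean_space \<times> 'a \<Rightarrow> complex) \<Rightarrow> real \<Rightarrow> real \<Rightarrow>
   ('a \<Rightarrow> complex) \<Rightarrow> ('a \<Rightarrow> complex) \<Rightarrow> 'a \<Rightarrow> complex" where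
  "bilinear_op m t\<^sub>1 t\<^sub>2 f g x =
     (LINT (\<xi>, \<eta>)|lborel. fourier f \<xi> * fourier g \<eta> * m (t\<^sub>1 *\<^sub>R \<xi>, t\<^sub>2 *\<^sub>R \<eta>) *
        exp (2 * of_real pi * \<i> * of_real (x \<bullet> (\<xi> + \<eta>))))"

text \<open>
  The supremum and the \<open>L\<^sup>2\<close> norm take values in \<open>[0, \<infinity>]\<close>, so that an upper bound by a finite
  quantity includes the assertion that they are finite.
\<close>

definition maximal_op ::
  "('a::euclidean_space \<times> 'a \<Rightarrow> complex) \<Rightarrow> real set \<Rightarrow> real set \<Rightarrow>
   ('a \<Rightarrow> complex) \<Rightarrow> ('a \<Rightarrow> complex) \<Rightarrow> 'a \<Rightarrow> ennreal" where
  "maximal_op m E\<^sub>1 E\<^sub>2 f g x =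
     (SUP (t\<^sub>1, t\<^sub>2) \<in> E\<^sub>1 \<times> E\<^sub>2. ennreal (norm (bilinear_op m t\<^sub>1 t\<^sub>2 f g x)))"

definition L2_norm :: "('a::euclidean_space \<Rightarrow> ennreal) \<Rightarrow> ennreal" where
  "L2_norm F = (let I = (\<integral>\<^sup>+ x. (F x)\<^sup>2 \<partial>lborel)
                in if I = \<infinity> then \<infinity> else ennreal (sqrt (enn2real I)))"

abbreviation L2_norm_fun :: "('a::euclidean_space \<Rightarrow> complex) \<Rightarrow> ennreal" where
  "L2_norm_fun f \<equiv> L2_norm (\<lambda>x. ennreal (norm (f x)))"

text \<open>Meaningful for bounded \<open>E\<close> and \<open>\<delta> > 0\<close>, where a finite cover exists.\<close>

definition covering_number :: "real set \<Rightarrow> real \<Rightarrow> nat" where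
  "covering_number E \<delta> =
     (LEAST n. \<exists>A. finite A \<and> card A = n \<and> E \<subseteq> (\<Union>a\<in>A. {a..a + \<delta>}))"

definition upper_minkowski_dim :: "real set \<Rightarrow> ereal" where
  "upper_minkowski_dim E =
     Limsup (at_right 0) (\<lambda>\<delta>. ereal (ln (real (covering_number E \<delta>)) / ln (1 / \<delta>)))"

end

theory Submission
  imports Defs "HOL-Probability.Probability"
begin

text \<open>
  The gain comes from \<open>L\<^sup>2\<close> orthogonality alone, so sharp dyadic cutoffs in frequency suffice.
  On the shell \<open>1 + |\<xi>| + |\<eta>| \<sim> 2\<^sup>j\<close>, Plancherel and Cauchy--Schwarz on the diagonals
  \<open>\<xi> + \<eta> = \<zeta>\<close> bound a bilinear multiplier by its sup norm times \<open>2\<^bsup>jd/2\<^esup>\<close>.  The sets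
  \<open>E\<^sub>1\<close>, \<open>E\<^sub>2\<close> are covered by intervals of length \<open>2\<^bsup>-j\<^esup>\<close>.  On a product of two such intervals the
  supremum is controlled by the fundamental theorem of calculus in \<open>(t\<^sub>1, t\<^sub>2)\<close>: each dilation
  derivative costs a factor \<open>2\<^sup>j\<close>, which the length of the interval absorbs.  Summing the squares over
  the roughly \<open>2\<^bsup>j(\<beta>\<^sub>1 + \<beta>\<^sub>2)\<^esup>\<close> products gives \<open>2\<^bsup>-j(2a - d - \<beta>\<^sub>1 - \<beta>\<^sub>2)\<^esup>\<close> for the squared norm.
  A difference \<open>f - \<tau>\<^sub>hf\<close> has Fourier transform \<open>O(|h|\<^sup>\<gamma>|\<xi>|\<^sup>\<gamma>)\<close> times that of \<open>f\<close>, and for small \<open>\<gamma>\<close> the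
  loss \<open>|\<xi>|\<^sup>\<gamma>\<close> is absorbed by the strict inequality \<open>2a > d + \<beta>\<^sub>1 + \<beta>\<^sub>2\<close>.
\<close>

section \<open>Gaussian regularisation\<close>

text \<open>The supremum defining \<open>maximal_op\<close> runs over an uncountable set, and its
  measurability is never established. Each shell and each pair of covering intervals therefore
  receives a measurable majorant, and only monotonicity of the integral is applied to the supremum
  itself. The supremum also destroys any orthogonality between shells, so their contributions are
  added by a Cauchy-Schwarz inequality with geometric weights, paid for out of the gap 2a - d -
  \<beta>1 - \<beta>2. All three kinds of terms in the theorem follow from one estimate, for
  functions u, v whose Fourier transforms are at most A (1+|\<xi>|)^\<gamma> times those of f, g. A
  difference satisfies this with A = O(|h|^\<gamma>), an undifferenced function with A = 1. Two
  derivatives of the multiplier are what the calculus on a rectangle in (t1, t2) consumes: its mixed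
  term differentiates once in \<xi> and once in \<eta>. Of Plancherel's identity only the inequality
  with constant 1 enters.\<close>

lemma norm_exp_phase [simp]:
  "norm (exp (- (2 * complex_of_real pi * \<i> * complex_of_real t))) = 1"
  "norm (exp (2 * complex_of_real pi * \<i> * complex_of_real t)) = 1"
  by (simp_all add: norm_exp_eq_Re)

lemma exp_phase_measurable [measurable (raw)]:
  assumes [measurable]: "f \<in> borel_measurable M"
  shows "(\<lambda>x. exp (c * complex_of_real (f x))) \<in> borel_measurable M"
  by measurable

lemma exp_neg_phase_measurable [measurable (raw)]:
  assumes [measurable]: "f \<in> borel_measurable M"
  shows "(\<lambda>x. exp (- (c * complex_of_real (f x)))) \<in> borel_measurable M"
  using exp_phase_measurable[of f M "- c"] by simp

lemma cnj_measurable [measurable (raw)]: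
  assumes "f \<in> borel_measurable M"
  shows "(\<lambda>x. cnj (f x)) \<in> borel_measurable M"
  by (rule measurable_compose[OF assms borel_measurable_continuous_onI]) (intro continuous_intros)

section \<open>Integrals of products of one-variable functions\<close>

lemma integrable_lborel_prod:
  fixes f :: "'a::euclidean_space \<Rightarrow> real \<Rightarrow> 'b::{real_normed_field,banach,second_countable_topology}"
  assumes "\<And>b. b \<in> Basis \<Longrightarrow> integrable lborel (f b)"
  shows "integrable lborel (\<lambda>x. \<Prod>b\<in>Basis. f b (x \<bullet> b))"
proof -
  interpret product_sigma_finite "\<lambda>_::'a. lborel :: real measure" ..
  have [measurable]: "f b \<in> borel_measurable borel" if "b \<in> Basis" for b
    using borel_measurable_integrable[OF assms[OF that]] by simp
  show ?thesis
    by (subst lborel_eq, subst integrable_distr_eq)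
       (auto intro!: product_integrable_prod assms simp: inner_sum_left inner_Basis if_distrib cong: if_cong)
qed

lemma integral_lborel_prod:
  fixes f :: "'a::euclidean_space \<Rightarrow> real \<Rightarrow> 'b::{real_normed_field,banach,second_countable_topology}"
  assumes "\<And>b. b \<in> Basis \<Longrightarrow> integrable lborel (f b)"
  shows "(LINT x|lborel. (\<Prod>b\<in>Basis. f b (x \<bullet> b))) = (\<Prod>b\<in>Basis. (LINT x|lborel. f b x))"
proof -
  interpret product_sigma_finite "\<lambda>_::'a. lborel :: real measure" ..
  have [measurable]: "f b \<in> borel_measurable borel" if "b \<in> Basis" for b
    using borel_measurable_integrable[OF assms[OF that]] by simp
  have "(LINT x|lborel. (\<Prod>b\<in>Basis. f b (x \<bullet> b))) =
      (LINT x|(\<Pi>\<^sub>M b\<in>Basis. lborel). (\<Prod>b\<in>Basis. f b ((\<Sum>b\<in>Basis. x b *\<^sub>R b) \<bullet> b)))"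
    by (subst lborel_eq, subst integral_distr) auto
  also have "\<dots> = (LINT x|(\<Pi>\<^sub>M b\<in>Basis. lborel). (\<Prod>b\<in>Basis. f b (x b)))"
    by simp
  also have "\<dots> = (\<Prod>b\<in>Basis. (LINT x|lborel. f b x))"
    by (rule product_integral_prod) (auto intro: assms)
  finally show ?thesis .
qed

lemma gauss_integrable:
  fixes \<sigma> :: real assumes "\<sigma> > 0"
  shows "integrable lborel (\<lambda>x. exp (- (\<sigma> * x)\<^sup>2 / 2))"
proof -
  have "integrable lborel (\<lambda>x. sqrt (2 * pi) * std_normal_density (0 + \<sigma> * x))"
    using assms by (intro integrable_mult_right lborel_integrable_real_affine) auto
  then show ?thesis by (simp add: std_normal_density_def)
qed

text \<open>The characteristic function of the standard normal law is taken at t = -2 pi z /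
  \<sigma> after substituting \<sigma> x for x. Recognising the result as a normal density of
  standard deviation \<sigma> / (2 pi) makes its total mass 1 immediate.\<close>

lemma gauss_phase_integral:
  fixes \<sigma> z :: real assumes \<sigma>: "\<sigma> > 0"
  shows "(LINT x|lborel. complex_of_real (exp (- (\<sigma> * x)\<^sup>2 / 2)) *
            exp (- (2 * complex_of_real pi * \<i> * complex_of_real (z * x)))) =
         complex_of_real (normal_density 0 (\<sigma> / (2 * pi)) z)"
proof -
  define t where "t = - 2 * pi * z / \<sigma>"
  have "complex_of_real (exp (- (t^2) / 2)) = char std_normal_distribution t"
    by (simp add: char_std_normal_distribution)
  also have "\<dots> = (LINT x|lborel. std_normal_density x *\<^sub>R iexp (t * x))"
    unfolding char_def by (subst integral_density) (auto simp: normal_density_nonneg)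
  also have "\<dots> = \<sigma> *\<^sub>R (LINT x|lborel. std_normal_density (0 + \<sigma> * x) *\<^sub>R iexp (t * (0 + \<sigma> * x)))"
    using \<sigma> by (subst lborel_integral_real_affine[where c=\<sigma> and t=0]) auto
  also have "(LINT x|lborel. std_normal_density (0 + \<sigma> * x) *\<^sub>R iexp (t * (0 + \<sigma> * x))) =
    (LINT x|lborel. complex_of_real (1 / sqrt (2 * pi)) * (complex_of_real (exp (- (\<sigma> * x)\<^sup>2 / 2)) *
            exp (- (2 * complex_of_real pi * \<i> * complex_of_real (z * x)))))"
    using \<sigma> by (intro Bochner_Integration.integral_cong refl)
      (auto simp: std_normal_density_def scaleR_conv_of_real t_def algebra_simps)
  finally have "complex_of_real (exp (- (t^2) / 2)) = complex_of_real (\<sigma> / sqrt (2 * pi)) *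
    (LINT x|lborel. complex_of_real (exp (- (\<sigma> * x)\<^sup>2 / 2)) *
            exp (- (2 * complex_of_real pi * \<i> * complex_of_real (z * x))))"
    by (simp add: scaleR_conv_of_real)
  then have "(LINT x|lborel. complex_of_real (exp (- (\<sigma> * x)\<^sup>2 / 2)) *
            exp (- (2 * complex_of_real pi * \<i> * complex_of_real (z * x)))) =
    complex_of_real (sqrt (2 * pi) / \<sigma> * exp (- (t^2) / 2))"
    using \<sigma> by (simp add: field_simps)
  also have "sqrt (2 * pi) / \<sigma> * exp (- (t^2) / 2) = normal_density 0 (\<sigma> / (2 * pi)) z"
  proof -
    have "sqrt (2 * pi) / \<sigma> = 1 / sqrt (2 * pi * (\<sigma> / (2 * pi))\<^sup>2)"
      using \<sigma> by (simp add: real_sqrt_mult real_sqrt_divide power_divide field_simps)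
    moreover have "t^2 / 2 = z\<^sup>2 / (2 * (\<sigma> / (2 * pi))\<^sup>2)"
      using \<sigma> by (simp add: t_def power2_eq_square field_simps)
    ultimately show ?thesis by (simp add: normal_density_def)
  qed
  finally show ?thesis .
qed

text \<open>This is exp(-\<sigma>^2 |x|^2 / 2); the product form reduces every integral to dimension
  one.\<close>

definition gauss :: "real \<Rightarrow> 'a::euclidean_space \<Rightarrow> real" where
  "gauss \<sigma> x = (\<Prod>b\<in>Basis. exp (- (\<sigma> * (x \<bullet> b))\<^sup>2 / 2))"

text \<open>The Fourier transform of \<open>gauss \<sigma>\<close>, an approximate identity as
  \<sigma> tends to 0.\<close>

definition gauss_hat :: "real \<Rightarrow> 'a::euclidean_space \<Rightarrow> real" where
  "gauss_hat \<sigma> x = (\<Prod>b\<in>Basis. normal_density 0 (\<sigma> / (2 * pi)) (x \<bullet> b))"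

lemma gauss_measurable [measurable]: "gauss \<sigma> \<in> borel_measurable borel"
  unfolding gauss_def by measurable

lemma gauss_hat_measurable [measurable]: "gauss_hat \<sigma> \<in> borel_measurable borel"
  unfolding gauss_hat_def by measurable

lemma gauss_nonneg [simp]: "gauss \<sigma> x \<ge> 0"
  unfolding gauss_def by (intro prod_nonneg) auto

lemma gauss_hat_nonneg [simp]: "gauss_hat \<sigma> x \<ge> 0"
  unfolding gauss_hat_def by (intro prod_nonneg) (auto simp: normal_density_nonneg)

lemma integrable_gauss: "\<sigma> > 0 \<Longrightarrow> integrable lborel (gauss \<sigma>)"
  unfolding gauss_def by (intro integrable_lborel_prod gauss_integrable)

lemma gauss_tendsto: "(\<lambda>n. gauss (inverse (Suc n)) x) \<longlonglongrightarrow> 1"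
proof -
  have "(\<lambda>n. gauss (inverse (Suc n)) x) \<longlonglongrightarrow> (\<Prod>b\<in>Basis. exp (- (0 * (x \<bullet> b))\<^sup>2 / 2))"
    unfolding gauss_def by (intro tendsto_intros LIMSEQ_inverse_real_of_nat) auto
  then show ?thesis by simp
qed

lemma gauss_hat_phase_integral:
  fixes z :: "'a::euclidean_space"
  assumes \<sigma>: "\<sigma> > 0"
  shows "(LINT x|lborel. complex_of_real (gauss \<sigma> x) *
            exp (- (2 * complex_of_real pi * \<i> * complex_of_real (z \<bullet> x)))) =
         complex_of_real (gauss_hat \<sigma> z)"
proof -
  define F where "F b x = complex_of_real (exp (- (\<sigma> * x)\<^sup>2 / 2)) *
            exp (- (2 * complex_of_real pi * \<i> * complex_of_real ((z \<bullet> b) * x)))" for b x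
  have int: "integrable lborel (F b)" for b
  proof (rule Bochner_Integration.integrable_bound[OF gauss_integrable[OF \<sigma>]])
    show "F b \<in> borel_measurable lborel" unfolding F_def by measurable
  qed (auto simp: F_def norm_mult simp del: of_real_mult)
  have "complex_of_real (gauss \<sigma> x) * exp (- (2 * complex_of_real pi * \<i> * complex_of_real (z \<bullet> x)))
     = (\<Prod>b\<in>Basis. F b (x \<bullet> b))" for x
  proof -
    have "(\<Prod>b\<in>Basis. exp (- (2 * complex_of_real pi * \<i> * complex_of_real ((z \<bullet> b) * (x \<bullet> b))))) =
       exp (- (2 * complex_of_real pi * \<i> * complex_of_real (z \<bullet> x)))"
      by (subst euclidean_inner[of z x])
         (simp add: exp_sum[symmetric] sum_distrib_left sum_negf)
    then show ?thesis
      unfolding F_def gauss_def prod.distrib by simp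
  qed
  then show ?thesis
    using integral_lborel_prod[of F, OF int]
    unfolding F_def gauss_phase_integral[OF \<sigma>] gauss_hat_def by simp
qed

text \<open>A product of probability densities. That this kernel has mass one is the reason for the
  constant 1 in the Plancherel inequality.\<close>

lemma nn_integral_gauss_hat:
  assumes \<sigma>: "\<sigma> > 0"
  shows "(\<integral>\<^sup>+x. ennreal (gauss_hat \<sigma> (x :: 'a::euclidean_space)) \<partial>lborel) = 1"
proof -
  have "(\<integral>\<^sup>+x. ennreal (normal_density 0 (\<sigma> / (2 * pi)) x) \<partial>lborel) = 1"
    using \<sigma> by (simp add: nn_integral_eq_integral normal_density_nonneg)
  then show ?thesis unfolding gauss_hat_def
    by (simp add: prod_ennreal[symmetric] normal_density_nonneg
        nn_integral_lborel_prod[of "\<lambda>_ x. ennreal (normal_density 0 (\<sigma> / (2 * pi)) x)"])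
qed

section \<open>Invariance of Lebesgue measure and tensor products\<close>

lemma nn_integral_lborel_translate:
  fixes f :: "'a::euclidean_space \<Rightarrow> ennreal"
  assumes [measurable]: "f \<in> borel_measurable borel"
  shows "(\<integral>\<^sup>+x. f (x - c) \<partial>lborel) = (\<integral>\<^sup>+x. f x \<partial>lborel)"
  by (subst (2) lborel_distr_plus[of "- c", symmetric]) (simp add: nn_integral_distr)

lemma nn_integral_lborel_reflect:
  fixes f :: "'a::euclidean_space \<Rightarrow> ennreal"
  assumes [measurable]: "f \<in> borel_measurable borel"
  shows "(\<integral>\<^sup>+x. f (c - x) \<partial>lborel) = (\<integral>\<^sup>+x. f x \<partial>lborel)"
  by (subst (2) lborel_affine[of "-1" c])
     (simp_all add: nn_integral_distr nn_integral_density)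

lemma integrable_tensor:
  fixes f :: "'a::euclidean_space \<Rightarrow> 'c::{real_normed_field,banach,second_countable_topology}"
    and g :: "'b::euclidean_space \<Rightarrow> 'c"
  assumes f: "integrable lborel f" and g: "integrable lborel g"
  shows "integrable lborel (\<lambda>(x, y). f x * g y)"
proof -
  have [measurable]: "f \<in> borel_measurable borel" "g \<in> borel_measurable borel"
    using f g by (auto dest: borel_measurable_integrable)
  show ?thesis
    unfolding lborel_prod[symmetric]
    by (rule lborel_pair.Fubini_integrable)
       (auto simp: norm_mult case_prod_beta intro!: integrable_mult_left integrable_mult_right f g)
qed

lemma integral_tensor:
  fixes f :: "'a::euclidean_space \<Rightarrow> 'c::{real_normed_field,banach,second_countable_topology}"
    and g :: "'b::euclidean_space \<Rightarrow> 'c"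
  assumes f: "integrable lborel f" and g: "integrable lborel g"
  shows "(LINT (x, y)|lborel. f x * g y) = (LINT x|lborel. f x) * (LINT y|lborel. g y)"
  using lborel_pair.integral_fst[of "\<lambda>x y. f x * g y"] integrable_tensor[OF f g]
  by (simp add: lborel_prod)

section \<open>The Plancherel inequality\<close>

text \<open>A non-integrable function has Bochner integral 0 by convention, so the bound covers that
  case as well.\<close>

lemma norm_integral_le_nn_integral:
  fixes f :: "'a \<Rightarrow> 'b::{banach,second_countable_topology}"
  shows "ennreal (norm (integral\<^sup>L M f)) \<le> (\<integral>\<^sup>+x. ennreal (norm (f x)) \<partial>M)"
  by (cases "integrable M f") (auto simp: integral_norm_bound_ennreal not_integrable_integral_eq)

lemma fourier_measurable [measurable]:
  assumes [measurable]: "u \<in> borel_measurable borel"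
  shows "fourier u \<in> borel_measurable borel"
  unfolding fourier_def by measurable

lemma norm_fourier_le:
  assumes "integrable lborel u"
  shows "norm (fourier u \<xi>) \<le> (LINT x|lborel. norm (u x))"
proof -
  have "norm (fourier u \<xi>) \<le> (LINT x|lborel. norm (u x * exp (- 2 * of_real pi * \<i> * of_real (x \<bullet> \<xi>))))"
    unfolding fourier_def by (rule integral_norm_bound)
  then show ?thesis by (simp add: norm_mult)
qed

lemma integrable_phase:
  fixes u :: "'a::euclidean_space \<Rightarrow> complex"
  assumes u: "integrable lborel u"
  shows "integrable lborel (\<lambda>x. u x * exp (- (2 * complex_of_real pi * \<i> * complex_of_real (x \<bullet> \<xi>))))"
proof -
  have [measurable]: "u \<in> borel_measurable borel" using u by (auto dest: borel_measurable_integrable)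
  show ?thesis by (rule Bochner_Integration.integrable_bound[OF u]) (auto simp: norm_mult)
qed

text \<open>Multiplying by the conjugate gives a double integral in which \<xi> occurs only in a
  phase at x - y. This is the form in which the \<xi>-integral against a Gaussian can be
  evaluated.\<close>

lemma norm_fourier_sq:
  fixes u :: "'a::euclidean_space \<Rightarrow> complex"
  assumes u: "integrable lborel u"
  shows "complex_of_real ((norm (fourier u \<xi>))\<^sup>2) =
    (LINT (x, y)|lborel. u x * cnj (u y) * exp (- (2 * complex_of_real pi * \<i> * complex_of_real ((x - y) \<bullet> \<xi>))))"
proof -
  define U where "U x = u x * exp (- (2 * complex_of_real pi * \<i> * complex_of_real (x \<bullet> \<xi>)))" for x
  have U: "integrable lborel U" unfolding U_def by (rule integrable_phase[OF u])
  have eq: "fourier u \<xi> = (LINT x|lborel. U x)"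
    unfolding fourier_def U_def by simp
  have "complex_of_real ((norm (fourier u \<xi>))\<^sup>2) = fourier u \<xi> * cnj (fourier u \<xi>)"
    by (rule complex_norm_square)
  also have "\<dots> = (LINT x|lborel. U x) * (LINT y|lborel. cnj (U y))"
    by (simp add: eq)
  also have "\<dots> = (LINT (x, y)|lborel. U x * cnj (U y))"
    using U by (intro integral_tensor[symmetric]) auto
  also have "\<dots> = (LINT (x, y)|lborel. u x * cnj (u y) * exp (- (2 * complex_of_real pi * \<i> * complex_of_real ((x - y) \<bullet> \<xi>))))"
  proof (intro Bochner_Integration.integral_cong refl)
    fix p :: "'a \<times> 'a"
    obtain x y where p: "p = (x, y)" by force
    have cnj: "cnj (exp (- (2 * complex_of_real pi * \<i> * complex_of_real (y \<bullet> \<xi>)))) =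
        exp (2 * complex_of_real pi * \<i> * complex_of_real (y \<bullet> \<xi>))"
      by (simp add: exp_cnj)
    have "exp (- (2 * complex_of_real pi * \<i> * complex_of_real ((x - y) \<bullet> \<xi>))) =
       exp (- (2 * complex_of_real pi * \<i> * complex_of_real (x \<bullet> \<xi>))) *
        exp (2 * complex_of_real pi * \<i> * complex_of_real (y \<bullet> \<xi>))"
      unfolding mult_exp_exp by (simp add: inner_diff_left algebra_simps)
    then show "(case p of (x, y) \<Rightarrow> U x * cnj (U y)) = (case p of (x, y) \<Rightarrow> u x * cnj (u y) *
        exp (- (2 * complex_of_real pi * \<i> * complex_of_real ((x - y) \<bullet> \<xi>))))"
      by (simp only: p prod.case U_def complex_cnj_mult cnj) (simp only: mult_ac)
  qed
  finally show ?thesis .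
qed

text \<open>The Gaussian weight makes the integral over (\<xi>, x, y) absolutely convergent, so by
  Fubini the \<xi>-integral may be done first, where it yields \<open>gauss_hat\<close> at x -
  y.\<close>

lemma gauss_norm_fourier_sq:
  fixes u :: "'a::euclidean_space \<Rightarrow> complex"
  assumes u: "integrable lborel u" and \<sigma>: "\<sigma> > 0"
  shows "complex_of_real (LINT \<xi>|lborel. gauss \<sigma> \<xi> * (norm (fourier u \<xi>))\<^sup>2) =
    (LINT (x, y)|lborel. u x * cnj (u y) * complex_of_real (gauss_hat \<sigma> (x - y)))"
proof -
  have [measurable]: "u \<in> borel_measurable borel" using u by (auto dest: borel_measurable_integrable)
  define W where "W \<xi> p = complex_of_real (gauss \<sigma> \<xi>) * (case p of (x, y) \<Rightarrow> u x * cnj (u y) *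
     exp (- (2 * complex_of_real pi * \<i> * complex_of_real ((x - y) \<bullet> \<xi>))))" for \<xi> :: 'a and p :: "'a \<times> 'a"
  have tens: "integrable lborel (\<lambda>(x, y). u x * cnj (u y))"
    using u by (intro integrable_tensor) auto
  \<comment> \<open>\<open>W\<close> differs from this tensor product of integrable functions by a
    unimodular phase.\<close>
  have dom: "integrable lborel (\<lambda>(\<xi>, p). complex_of_real (gauss \<sigma> \<xi>) * (case p of (x, y) \<Rightarrow> u x * cnj (u y)))"
    by (rule integrable_tensor[OF _ tens]) (use integrable_gauss[OF \<sigma>] in auto)
  have Wm: "(\<lambda>(\<xi>, p). W \<xi> p) \<in> borel_measurable borel"
    unfolding W_def split_beta' borel_prod[symmetric] by measurable
  have W: "integrable lborel (\<lambda>(\<xi>, p). W \<xi> p)"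
    by (rule Bochner_Integration.integrable_bound[OF dom])
       (use Wm in \<open>auto simp: W_def norm_mult case_prod_beta\<close>)
  have "complex_of_real (LINT \<xi>|lborel. gauss \<sigma> \<xi> * (norm (fourier u \<xi>))\<^sup>2) =
     (LINT \<xi>|lborel. complex_of_real (gauss \<sigma> \<xi> * (norm (fourier u \<xi>))\<^sup>2))"
    by (rule integral_complex_of_real[symmetric])
  also have "\<dots> = (LINT \<xi>|lborel. (LINT p|lborel. W \<xi> p))"
    unfolding W_def of_real_mult norm_fourier_sq[OF u] by simp
  also have "\<dots> = (LINT p|lborel. (LINT \<xi>|lborel. W \<xi> p))"
    using W by (intro lborel_pair.Fubini_integral[symmetric]) (simp add: lborel_prod)
  also have "\<dots> = (LINT p|lborel. (case p of (x, y) \<Rightarrow> u x * cnj (u y) * complex_of_real (gauss_hat \<sigma> (x - y))))"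
  proof (intro Bochner_Integration.integral_cong refl)
    fix p :: "'a \<times> 'a"
    obtain x y where p: "p = (x, y)" by force
    have "(LINT \<xi>|lborel. W \<xi> p) = (LINT \<xi>|lborel. (u x * cnj (u y)) * (complex_of_real (gauss \<sigma> \<xi>) *
            exp (- (2 * complex_of_real pi * \<i> * complex_of_real ((x - y) \<bullet> \<xi>)))))"
      by (intro Bochner_Integration.integral_cong refl) (simp add: W_def p mult_ac)
    also have "\<dots> = (u x * cnj (u y)) * complex_of_real (gauss_hat \<sigma> (x - y))"
      by (simp only: integral_mult_right_zero gauss_hat_phase_integral[OF \<sigma>])
    finally show "(LINT \<xi>|lborel. W \<xi> p) = (case p of (x, y) \<Rightarrow> u x * cnj (u y) * complex_of_real (gauss_hat \<sigma> (x - y)))"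
      by (simp add: p)
  qed
  finally show ?thesis .
qed

text \<open>A Schur test: 2 |u(x)| |u(y)| is at most |u(x)|^2 + |u(y)|^2, and the kernel
  \<open>gauss_hat\<close> at x - y has mass one in either variable.\<close>

lemma nn_integral_gauss_norm_fourier_sq_le:
  fixes u :: "'a::euclidean_space \<Rightarrow> complex"
  assumes u: "integrable lborel u" and \<sigma>: "\<sigma> > 0"
  shows "(\<integral>\<^sup>+\<xi>. ennreal (gauss \<sigma> \<xi>) * (ennreal (norm (fourier u \<xi>)))\<^sup>2 \<partial>lborel) \<le> (\<integral>\<^sup>+x. (ennreal (norm (u x)))\<^sup>2 \<partial>lborel)"
proof -
  have [measurable]: "u \<in> borel_measurable borel" using u by (auto dest: borel_measurable_integrable)
  define A where "A = (LINT x|lborel. norm (u x))"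
  have int: "integrable lborel (\<lambda>\<xi>. gauss \<sigma> \<xi> * (norm (fourier u \<xi>))\<^sup>2)"
  proof (rule Bochner_Integration.integrable_bound)
    show "integrable lborel (\<lambda>\<xi>::'a. gauss \<sigma> \<xi> * A\<^sup>2)" using integrable_gauss[OF \<sigma>] by auto
    show "AE \<xi> in lborel. norm (gauss \<sigma> \<xi> * (norm (fourier u \<xi>))\<^sup>2) \<le> norm (gauss \<sigma> \<xi> * A\<^sup>2)"
      using norm_fourier_le[OF u] by (auto simp: A_def intro!: mult_left_mono power_mono)
  qed measurable
  have half: "ennreal (1/2) + ennreal (1/2) = 1"
    by (subst ennreal_plus[symmetric]) auto
  let ?k = "\<lambda>x y. ennreal (gauss_hat \<sigma> (x - y :: 'a))"
  have "(\<integral>\<^sup>+\<xi>. ennreal (gauss \<sigma> \<xi>) * (ennreal (norm (fourier u \<xi>)))\<^sup>2 \<partial>lborel)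
      = (\<integral>\<^sup>+\<xi>. ennreal (gauss \<sigma> \<xi> * (norm (fourier u \<xi>))\<^sup>2) \<partial>lborel)"
    by (simp add: ennreal_mult ennreal_power)
  also have "\<dots> = ennreal (LINT \<xi>|lborel. gauss \<sigma> \<xi> * (norm (fourier u \<xi>))\<^sup>2)"
    using int by (intro nn_integral_eq_integral) auto
  also have "\<dots> \<le> ennreal (norm (complex_of_real (LINT \<xi>|lborel. gauss \<sigma> \<xi> * (norm (fourier u \<xi>))\<^sup>2)))"
    by (intro ennreal_leI) (simp del: integral_complex_of_real)
  also have "\<dots> \<le> (\<integral>\<^sup>+p. ennreal (norm (case p of (x, y) \<Rightarrow> u x * cnj (u y) * complex_of_real (gauss_hat \<sigma> (x - y)))) \<partial>lborel)"
    unfolding gauss_norm_fourier_sq[OF assms] by (rule norm_integral_le_nn_integral)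
  also have "\<dots> \<le> (\<integral>\<^sup>+p. (case p of (x, y) \<Rightarrow> ennreal (1/2) * ((ennreal (norm (u x)))\<^sup>2 * ?k x y) + ennreal (1/2) * ((ennreal (norm (u y)))\<^sup>2 * ?k x y)) \<partial>lborel)"
  proof (intro nn_integral_mono)
    fix p :: "'a \<times> 'a"
    obtain x y where p: "p = (x, y)" by force
    have "2 * (norm (u x) * norm (u y)) \<le> (norm (u x))\<^sup>2 + (norm (u y))\<^sup>2"
      using sum_squares_bound[of "norm (u x)" "norm (u y)"] by simp
    then have "norm (u x) * norm (u y) * gauss_hat \<sigma> (x - y) \<le>
      (1/2 * (norm (u x))\<^sup>2 + 1/2 * (norm (u y))\<^sup>2) * gauss_hat \<sigma> (x - y)"
      by (intro mult_right_mono) auto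
    then have "norm (u x) * norm (u y) * gauss_hat \<sigma> (x - y) \<le>
      1/2 * ((norm (u x))\<^sup>2 * gauss_hat \<sigma> (x - y)) + 1/2 * ((norm (u y))\<^sup>2 * gauss_hat \<sigma> (x - y))"
      by (simp add: algebra_simps)
    then have "ennreal (norm (u x) * norm (u y) * gauss_hat \<sigma> (x - y)) \<le>
      ennreal (1/2 * ((norm (u x))\<^sup>2 * gauss_hat \<sigma> (x - y)) + 1/2 * ((norm (u y))\<^sup>2 * gauss_hat \<sigma> (x - y)))"
      by (rule ennreal_leI)
    also have "\<dots> = ennreal (1/2) * ((ennreal (norm (u x)))\<^sup>2 * ?k x y) + ennreal (1/2) * ((ennreal (norm (u y)))\<^sup>2 * ?k x y)"
      by (subst ennreal_plus) (auto simp only: ennreal_mult ennreal_power gauss_hat_nonneg norm_ge_zero zero_le_power mult_nonneg_nonneg zero_le_divide_1_iff zero_le_numeral)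
    finally show "ennreal (norm (case p of (x, y) \<Rightarrow> u x * cnj (u y) * complex_of_real (gauss_hat \<sigma> (x - y)))) \<le>
      (case p of (x, y) \<Rightarrow> ennreal (1/2) * ((ennreal (norm (u x)))\<^sup>2 * ?k x y) + ennreal (1/2) * ((ennreal (norm (u y)))\<^sup>2 * ?k x y))"
      by (simp add: p norm_mult)
  qed
  \<comment> \<open>In each half the variable absent from u is integrated first, so that the kernel
    contributes just its mass.\<close>
  also have "\<dots> = ennreal (1/2) * (\<integral>\<^sup>+x. \<integral>\<^sup>+y. (ennreal (norm (u x)))\<^sup>2 * ?k x y \<partial>lborel \<partial>lborel) +
     ennreal (1/2) * (\<integral>\<^sup>+y. \<integral>\<^sup>+x. (ennreal (norm (u y)))\<^sup>2 * ?k x y \<partial>lborel \<partial>lborel)"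
    unfolding lborel_prod[symmetric] case_prod_beta
    apply (subst nn_integral_add; (measurable)?)
    apply (subst nn_integral_cmult; (measurable)?)
    apply (subst nn_integral_cmult; (measurable)?)
    apply (subst lborel.nn_integral_fst[symmetric]; (measurable)?)
    apply (subst lborel_pair.nn_integral_snd[symmetric]; (measurable)?)
    done
  also have "(\<integral>\<^sup>+x. \<integral>\<^sup>+y. (ennreal (norm (u x)))\<^sup>2 * ?k x y \<partial>lborel \<partial>lborel) = (\<integral>\<^sup>+x. (ennreal (norm (u x)))\<^sup>2 \<partial>lborel)"
    by (simp add: nn_integral_cmult nn_integral_lborel_reflect[of "\<lambda>x. ennreal (gauss_hat \<sigma> x)"] nn_integral_gauss_hat[OF \<sigma>])
  also have "(\<integral>\<^sup>+y. \<integral>\<^sup>+x. (ennreal (norm (u y)))\<^sup>2 * ?k x y \<partial>lborel \<partial>lborel) = (\<integral>\<^sup>+x. (ennreal (norm (u x)))\<^sup>2 \<partial>lborel)"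
    by (simp add: nn_integral_cmult nn_integral_lborel_translate[of "\<lambda>x. ennreal (gauss_hat \<sigma> x)"] nn_integral_gauss_hat[OF \<sigma>])
  also have "ennreal (1/2) * (\<integral>\<^sup>+x. (ennreal (norm (u x)))\<^sup>2 \<partial>lborel) + ennreal (1/2) * (\<integral>\<^sup>+x. (ennreal (norm (u x)))\<^sup>2 \<partial>lborel) =
      (\<integral>\<^sup>+x. (ennreal (norm (u x)))\<^sup>2 \<partial>lborel)"
    unfolding distrib_right[symmetric] half by simp
  finally show ?thesis .
qed

text \<open>The weights \<open>gauss (inverse (Suc n))\<close> tend to 1 pointwise while the
  weighted bound is the same for all n; Fatou's lemma removes the weight.\<close>

lemma nn_integral_norm_fourier_sq_le:
  fixes u :: "'a::euclidean_space \<Rightarrow> complex"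
  assumes u: "integrable lborel u"
  shows "(\<integral>\<^sup>+\<xi>. (ennreal (norm (fourier u \<xi>)))\<^sup>2 \<partial>lborel) \<le> (\<integral>\<^sup>+x. (ennreal (norm (u x)))\<^sup>2 \<partial>lborel)"
proof -
  have [measurable]: "u \<in> borel_measurable borel" using u by (auto dest: borel_measurable_integrable)
  define G where "G n \<xi> = ennreal (gauss (inverse (Suc n)) \<xi>) * (ennreal (norm (fourier u \<xi>)))\<^sup>2" for n \<xi>
  have "(\<lambda>n. G n \<xi>) \<longlonglongrightarrow> ennreal (1 * (norm (fourier u \<xi>))\<^sup>2)" for \<xi>
    unfolding G_def ennreal_power[OF norm_ge_zero] ennreal_mult[OF gauss_nonneg zero_le_power2, symmetric]
    by (intro tendsto_ennrealI tendsto_intros gauss_tendsto)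
  from lim_imp_Liminf[OF sequentially_bot this]
  have "(ennreal (norm (fourier u \<xi>)))\<^sup>2 = liminf (\<lambda>n. G n \<xi>)" for \<xi>
    by (simp add: ennreal_power)
  then have "(\<integral>\<^sup>+\<xi>. (ennreal (norm (fourier u \<xi>)))\<^sup>2 \<partial>lborel) = (\<integral>\<^sup>+\<xi>. liminf (\<lambda>n. G n \<xi>) \<partial>lborel)"
    by simp
  also have "\<dots> \<le> liminf (\<lambda>n. \<integral>\<^sup>+\<xi>. G n \<xi> \<partial>lborel)"
    unfolding G_def by (intro nn_integral_liminf) measurable
  also have "\<dots> \<le> (\<integral>\<^sup>+x. (ennreal (norm (u x)))\<^sup>2 \<partial>lborel)"
    unfolding G_def
    by (intro Liminf_le always_eventually allI nn_integral_gauss_norm_fourier_sq_le u) auto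
  finally show ?thesis .
qed

section \<open>Bilinear multipliers of bounded frequency\<close>

text \<open>Supplies the absolute convergence behind each use of Fubini for symbols cut off to a
  bounded region.\<close>

lemma integrable_bounded_support:
  fixes f :: "'a::euclidean_space \<Rightarrow> 'b::{banach,second_countable_topology}"
  assumes [measurable]: "f \<in> borel_measurable borel"
    and bd: "\<And>x. norm (f x) \<le> K" and supp: "\<And>x. norm x > R \<Longrightarrow> f x = 0"
  shows "integrable lborel f"
proof (rule Bochner_Integration.integrable_bound)
  have "K \<ge> 0" using bd norm_ge_zero order_trans by blast
  then show "AE x in lborel. norm (f x) \<le> norm (indicator (cball 0 R) x * K)"
    using bd supp by (intro AE_I2) (auto simp: indicator_def)
  show "integrable lborel (\<lambda>x. indicator (cball (0::'a) R) x * K)"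
    by (intro integrable_mult_left integrable_real_indicator) (auto simp: emeasure_lborel_cball_finite[unfolded infinity_ennreal_def])
qed auto

lemma integral_lborel_translate:
  fixes f :: "'a::euclidean_space \<Rightarrow> 'b::{banach,second_countable_topology}"
  assumes [measurable]: "f \<in> borel_measurable borel"
  shows "(LINT x|lborel. f (x - c)) = (LINT x|lborel. f x)"
  by (subst (2) lborel_distr_plus[of "- c", symmetric]) (simp add: integral_distr)

text \<open>Conjugation turns the inverse transform of H into the forward transform of the conjugate
  of H, with the same modulus.\<close>

lemma L2_bound_inverse_fourier:
  fixes H :: "'a::euclidean_space \<Rightarrow> complex"
  assumes H: "integrable lborel H"
  shows "(\<integral>\<^sup>+x. (ennreal (norm (LINT \<zeta>|lborel. H \<zeta> * exp (2 * of_real pi * \<i> * of_real (x \<bullet> \<zeta>)))))\<^sup>2 \<partial>lborel)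
    \<le> (\<integral>\<^sup>+\<zeta>. (ennreal (norm (H \<zeta>)))\<^sup>2 \<partial>lborel)"
proof -
  have "norm (LINT \<zeta>|lborel. H \<zeta> * exp (2 * of_real pi * \<i> * of_real (x \<bullet> \<zeta>))) = norm (fourier (\<lambda>\<zeta>. cnj (H \<zeta>)) x)" for x
  proof -
    have "cnj (LINT \<zeta>|lborel. H \<zeta> * exp (2 * of_real pi * \<i> * of_real (x \<bullet> \<zeta>))) = fourier (\<lambda>\<zeta>. cnj (H \<zeta>)) x"
      unfolding fourier_def by (subst Bochner_Integration.integral_cnj[symmetric]) (simp add: exp_cnj inner_commute)
    then show ?thesis by (metis complex_mod_cnj)
  qed
  moreover have "integrable lborel (\<lambda>\<zeta>. cnj (H \<zeta>))" using H by simp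
  ultimately show ?thesis using nn_integral_norm_fourier_sq_le[of "\<lambda>\<zeta>. cnj (H \<zeta>)"] by simp
qed

text \<open>On the diagonals \<open>\<xi> + \<eta> = \<zeta>\<close> Cauchy--Schwarz costs only the volume of the range of \<open>\<xi>\<close>.\<close>

lemma L2_bound_bilinear:
  fixes \<Phi> :: "'a::euclidean_space \<times> 'a \<Rightarrow> complex" and p q :: "'a \<Rightarrow> complex"
  assumes \<Phi>[measurable]: "\<Phi> \<in> borel_measurable borel"
    and [measurable]: "p \<in> borel_measurable borel" "q \<in> borel_measurable borel"
    and bd: "\<And>z. norm (\<Phi> z) \<le> K"
    and supp: "\<And>\<xi> \<eta>. norm \<xi> > R \<or> norm \<eta> > R \<Longrightarrow> \<Phi> (\<xi>, \<eta>) = 0"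
    and dom: "\<And>\<xi> \<eta>. norm (\<Phi> (\<xi>, \<eta>)) \<le> B * norm (p \<xi>) * norm (q \<eta>)"
    and B: "B \<ge> 0"
  shows "(\<integral>\<^sup>+x. (ennreal (norm (LINT (\<xi>, \<eta>)|lborel. \<Phi> (\<xi>, \<eta>) * exp (2 * of_real pi * \<i> * of_real (x \<bullet> (\<xi> + \<eta>))))))\<^sup>2 \<partial>lborel)
    \<le> ennreal (B\<^sup>2) * emeasure lborel (cball (0::'a) R) * (\<integral>\<^sup>+\<xi>. (ennreal (norm (p \<xi>)))\<^sup>2 \<partial>lborel) * (\<integral>\<^sup>+\<eta>. (ennreal (norm (q \<eta>)))\<^sup>2 \<partial>lborel)"
proof -
  have norm_pair: "norm \<xi> > R \<or> norm \<eta> > R'" if "norm (\<xi>, \<eta>) > R + R'" for \<xi> \<eta> :: 'a and R'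
    using that norm_Pair_le[of \<xi> \<eta>] by linarith
  have [measurable]: "\<Phi> \<in> borel_measurable (borel \<Otimes>\<^sub>M borel)"
    using \<Phi> by (simp add: borel_prod)
  define e where "e x y = exp (2 * complex_of_real pi * \<i> * complex_of_real (x \<bullet> y))" for x y :: 'a
  have e1: "norm (e x y) = 1" for x y by (simp add: e_def)
  have e_m [measurable]: "(\<lambda>z. e (f z) (g z)) \<in> borel_measurable M" if [measurable]: "f \<in> borel_measurable M" "g \<in> borel_measurable M" for f g and M :: "'z measure"
    unfolding e_def by measurable
  have e_m' [measurable]: "(\<lambda>y. e x y) \<in> borel_measurable borel" for x
    unfolding e_def by measurable
  \<comment> \<open>\<open>H\<close> is the Fourier-side form of the output: the integral of \<Phi>
    along the diagonal \<xi> + \<eta> = \<zeta>.\<close>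
  define H where "H \<zeta> = (LINT \<xi>|lborel. \<Phi> (\<xi>, \<zeta> - \<xi>))" for \<zeta>
  \<comment> \<open>A nonzero value forces |\<xi>| \<le> R and |\<zeta> - \<xi>| \<le> R, hence
    |\<zeta>| \<le> 2R; this is the origin of the radius R + 2R.\<close>
  have intS: "integrable (lborel \<Otimes>\<^sub>M lborel) (\<lambda>(\<xi>, \<zeta>). \<Phi> (\<xi>, \<zeta> - \<xi>) * e x \<zeta>)" for x
    unfolding lborel_prod
  proof (rule integrable_bounded_support[where K=K and R="R + 2 * R"])
    show "(\<lambda>(\<xi>, \<zeta>). \<Phi> (\<xi>, \<zeta> - \<xi>) * e x \<zeta>) \<in> borel_measurable borel"
      unfolding borel_prod[symmetric] e_def by measurable
    show "norm (case z of (\<xi>, \<zeta>) \<Rightarrow> \<Phi> (\<xi>, \<zeta> - \<xi>) * e x \<zeta>) \<le> K" for z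
      using bd by (cases z) (simp add: norm_mult e1)
    show "(case z of (\<xi>, \<zeta>) \<Rightarrow> \<Phi> (\<xi>, \<zeta> - \<xi>) * e x \<zeta>) = 0" if "R + 2 * R < norm z" for z
    proof -
      obtain \<xi> \<zeta> where z: "z = (\<xi>, \<zeta>)" by force
      have "norm \<xi> > R \<or> norm \<zeta> > 2 * R" using norm_pair that z by blast
      then have "norm \<xi> > R \<or> norm (\<zeta> - \<xi>) > R"
        using norm_triangle_ineq2[of \<zeta> \<xi>] by linarith
      then show ?thesis using supp by (simp add: z)
    qed
  qed
  have int\<Phi>: "integrable (lborel \<Otimes>\<^sub>M lborel) (\<lambda>(\<xi>, \<eta>). \<Phi> (\<xi>, \<eta>) * e x (\<xi> + \<eta>))" for x
    unfolding lborel_prod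
  proof (rule integrable_bounded_support[where K=K and R="R + R"])
    show "(\<lambda>(\<xi>, \<eta>). \<Phi> (\<xi>, \<eta>) * e x (\<xi> + \<eta>)) \<in> borel_measurable borel"
      unfolding borel_prod[symmetric] e_def by measurable
    show "norm (case z of (\<xi>, \<eta>) \<Rightarrow> \<Phi> (\<xi>, \<eta>) * e x (\<xi> + \<eta>)) \<le> K" for z
      using bd by (cases z) (simp add: norm_mult e1)
    show "(case z of (\<xi>, \<eta>) \<Rightarrow> \<Phi> (\<xi>, \<eta>) * e x (\<xi> + \<eta>)) = 0" if "R + R < norm z" for z
    proof -
      obtain \<xi> \<eta> where z: "z = (\<xi>, \<eta>)" by force
      show ?thesis using supp norm_pair[where R'=R] that by (simp add: z)
    qed
  qed
  have H: "integrable lborel H"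
    unfolding H_def using lborel_pair.integrable_snd[OF intS[of 0]] by (simp add: e_def)
  have S: "(LINT (\<xi>, \<eta>)|lborel. \<Phi> (\<xi>, \<eta>) * e x (\<xi> + \<eta>)) = (LINT \<zeta>|lborel. H \<zeta> * e x \<zeta>)" for x
  proof -
    have "(LINT (\<xi>, \<eta>)|lborel. \<Phi> (\<xi>, \<eta>) * e x (\<xi> + \<eta>)) = (LINT \<xi>|lborel. (LINT \<eta>|lborel. \<Phi> (\<xi>, \<eta>) * e x (\<xi> + \<eta>)))"
      using lborel_pair.integral_fst[OF int\<Phi>[of x]] by (simp add: lborel_prod)
    also have "\<dots> = (LINT \<xi>|lborel. (LINT \<zeta>|lborel. \<Phi> (\<xi>, \<zeta> - \<xi>) * e x \<zeta>))"
    proof (rule Bochner_Integration.integral_cong[OF refl])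
      fix \<xi> :: 'a
      show "(LINT \<eta>|lborel. \<Phi> (\<xi>, \<eta>) * e x (\<xi> + \<eta>)) = (LINT \<zeta>|lborel. \<Phi> (\<xi>, \<zeta> - \<xi>) * e x \<zeta>)"
        by (subst integral_lborel_translate[of "\<lambda>\<eta>. \<Phi> (\<xi>, \<eta>) * e x (\<xi> + \<eta>)" \<xi>, symmetric]) simp_all
    qed
    also have "\<dots> = (LINT \<zeta>|lborel. (LINT \<xi>|lborel. \<Phi> (\<xi>, \<zeta> - \<xi>) * e x \<zeta>))"
      by (rule lborel_pair.Fubini_integral[OF intS, symmetric])
    also have "\<dots> = (LINT \<zeta>|lborel. H \<zeta> * e x \<zeta>)"
      by (simp add: H_def)
    finally show ?thesis .
  qed
  define cb where "cb = (indicator (cball (0::'a) R) :: 'a \<Rightarrow> ennreal)"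
  have [measurable]: "cb \<in> borel_measurable borel" unfolding cb_def by (intro borel_measurable_indicator) simp
  have Hsq: "(ennreal (norm (H \<zeta>)))\<^sup>2 \<le> emeasure lborel (cball (0::'a) R) *
     (\<integral>\<^sup>+\<xi>. ennreal (B\<^sup>2) * ((ennreal (norm (p \<xi>)))\<^sup>2 * (ennreal (norm (q (\<zeta> - \<xi>))))\<^sup>2) \<partial>lborel)" for \<zeta>
  proof -
    have "ennreal (norm (H \<zeta>)) \<le> (\<integral>\<^sup>+\<xi>. ennreal (norm (\<Phi> (\<xi>, \<zeta> - \<xi>))) \<partial>lborel)"
      unfolding H_def by (rule norm_integral_le_nn_integral)
    also have "\<dots> \<le> (\<integral>\<^sup>+\<xi>. cb \<xi> * ennreal (B * norm (p \<xi>) * norm (q (\<zeta> - \<xi>))) \<partial>lborel)"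
    proof (intro nn_integral_mono)
      fix \<xi> show "ennreal (norm (\<Phi> (\<xi>, \<zeta> - \<xi>))) \<le> cb \<xi> * ennreal (B * norm (p \<xi>) * norm (q (\<zeta> - \<xi>)))"
        using dom[of \<xi> "\<zeta> - \<xi>"] supp[of \<xi> "\<zeta> - \<xi>"]
        by (cases "norm \<xi> \<le> R") (auto simp: cb_def intro!: ennreal_leI)
    qed
    finally have "(ennreal (norm (H \<zeta>)))\<^sup>2 \<le> (\<integral>\<^sup>+\<xi>. cb \<xi> * ennreal (B * norm (p \<xi>) * norm (q (\<zeta> - \<xi>))) \<partial>lborel)\<^sup>2"
      by (rule power_mono) simp
    also have "\<dots> \<le> (\<integral>\<^sup>+\<xi>. (cb \<xi>)\<^sup>2 \<partial>lborel) * (\<integral>\<^sup>+\<xi>. (ennreal (B * norm (p \<xi>) * norm (q (\<zeta> - \<xi>))))\<^sup>2 \<partial>lborel)"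
      by (rule Cauchy_Schwarz_nn_integral) measurable
    also have "(\<integral>\<^sup>+\<xi>. (cb \<xi>)\<^sup>2 \<partial>lborel) = emeasure lborel (cball (0::'a) R)"
      unfolding cb_def by (simp add: power2_eq_square indicator_times_eq_if flip: indicator_inter_arith)
    also have "(\<integral>\<^sup>+\<xi>. (ennreal (B * norm (p \<xi>) * norm (q (\<zeta> - \<xi>))))\<^sup>2 \<partial>lborel) =
       (\<integral>\<^sup>+\<xi>. ennreal (B\<^sup>2) * ((ennreal (norm (p \<xi>)))\<^sup>2 * (ennreal (norm (q (\<zeta> - \<xi>))))\<^sup>2) \<partial>lborel)"
      using B by (intro nn_integral_cong) (simp add: ennreal_mult ennreal_power power_mult_distrib mult_ac flip: ennreal_mult)
    finally show ?thesis .
  qed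
  have "(\<integral>\<^sup>+x. (ennreal (norm (LINT (\<xi>, \<eta>)|lborel. \<Phi> (\<xi>, \<eta>) * e x (\<xi> + \<eta>))))\<^sup>2 \<partial>lborel)
     \<le> (\<integral>\<^sup>+\<zeta>. (ennreal (norm (H \<zeta>)))\<^sup>2 \<partial>lborel)"
    unfolding S using L2_bound_inverse_fourier[OF H] by (simp add: e_def)
  also have "\<dots> \<le> (\<integral>\<^sup>+\<zeta>. emeasure lborel (cball (0::'a) R) *
     (\<integral>\<^sup>+\<xi>. ennreal (B\<^sup>2) * ((ennreal (norm (p \<xi>)))\<^sup>2 * (ennreal (norm (q (\<zeta> - \<xi>))))\<^sup>2) \<partial>lborel) \<partial>lborel)"
    by (intro nn_integral_mono Hsq)
  also have "\<dots> = emeasure lborel (cball (0::'a) R) * (\<integral>\<^sup>+\<zeta>.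
     (\<integral>\<^sup>+\<xi>. ennreal (B\<^sup>2) * ((ennreal (norm (p \<xi>)))\<^sup>2 * (ennreal (norm (q (\<zeta> - \<xi>))))\<^sup>2) \<partial>lborel) \<partial>lborel)"
    by (rule nn_integral_cmult) measurable
  also have "(\<integral>\<^sup>+\<zeta>.
     (\<integral>\<^sup>+\<xi>. ennreal (B\<^sup>2) * ((ennreal (norm (p \<xi>)))\<^sup>2 * (ennreal (norm (q (\<zeta> - \<xi>))))\<^sup>2) \<partial>lborel) \<partial>lborel) =
     (\<integral>\<^sup>+\<xi>. (\<integral>\<^sup>+\<zeta>.
      ennreal (B\<^sup>2) * ((ennreal (norm (p \<xi>)))\<^sup>2 * (ennreal (norm (q (\<zeta> - \<xi>))))\<^sup>2) \<partial>lborel) \<partial>lborel)"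
    by (rule lborel_pair.Fubini') measurable
  \<comment> \<open>After Tonelli the \<zeta>-integral comes first, and by translation invariance it
    no longer depends on \<xi>, so the double integral factorises.\<close>
  also have "\<dots> = ennreal (B\<^sup>2) * ((\<integral>\<^sup>+\<xi>. (ennreal (norm (p \<xi>)))\<^sup>2 \<partial>lborel) * (\<integral>\<^sup>+\<eta>. (ennreal (norm (q \<eta>)))\<^sup>2 \<partial>lborel))"
    by (simp add: nn_integral_cmult nn_integral_multc nn_integral_lborel_translate[of "\<lambda>\<eta>. (ennreal (norm (q \<eta>)))\<^sup>2"])
  finally show ?thesis by (simp add: e_def mult_ac)
qed

section \<open>Functions with continuous partial derivatives\<close>

text \<open>\<open>partial_deriv\<close> differentiates at parameter 0 only; moving the base point
  to y + t b gives the derivative along the whole line.\<close>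

lemma partial_deriv_along:
  assumes "\<And>x. (\<lambda>t::real. f (x + t *\<^sub>R b)) differentiable (at 0)"
  shows "((\<lambda>t. f (y + t *\<^sub>R b)) has_vector_derivative partial_deriv b f (y + t *\<^sub>R b)) (at t)"
proof -
  have "((\<lambda>s. f ((y + t *\<^sub>R b) + s *\<^sub>R b)) has_vector_derivative partial_deriv b f (y + t *\<^sub>R b)) (at (t - t))"
    using assms[of "y + t *\<^sub>R b"] by (simp add: partial_deriv_def vector_derivative_works[symmetric])
  then have "((\<lambda>s. f ((y + t *\<^sub>R b) + s *\<^sub>R b)) \<circ> (\<lambda>s. s - t) has_vector_derivative
      1 *\<^sub>R partial_deriv b f (y + t *\<^sub>R b)) (at t)"
    by (intro vector_diff_chain_at) (auto intro!: derivative_eq_intros)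
  then show ?thesis by (simp add: o_def algebra_simps)
qed

text \<open>\<open>C_class\<close> speaks of partial derivatives only, whereas the chain rule along
  dilations needs the total derivative. The increment is built up one coordinate at a time, with the
  mean value inequality in each coordinate and continuity of that partial derivative at x.\<close>

lemma has_derivative_continuous_partials:
  fixes f :: "'a::euclidean_space \<Rightarrow> complex"
  assumes diff: "\<And>b x. b \<in> Basis \<Longrightarrow> (\<lambda>t::real. f (x + t *\<^sub>R b)) differentiable (at 0)"
    and cont: "\<And>b. b \<in> Basis \<Longrightarrow> continuous_on UNIV (partial_deriv b f)"
  shows "(f has_derivative (\<lambda>h. \<Sum>b\<in>Basis. (h \<bullet> b) *\<^sub>R partial_deriv b f x)) (at x)"
proof -
  \<comment> \<open>Induction over the set of directions already moved; measuring the error by the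
    sum of |h \<bullet> b| lets each new direction simply add its own term.\<close>
  have claim: "\<exists>d>0. \<forall>h. norm h < d \<longrightarrow>
      norm (f (x + (\<Sum>b\<in>S. (h \<bullet> b) *\<^sub>R b)) - f x - (\<Sum>b\<in>S. (h \<bullet> b) *\<^sub>R partial_deriv b f x)) \<le> e * (\<Sum>b\<in>S. \<bar>h \<bullet> b\<bar>)"
    if "e > 0" "S \<subseteq> Basis" for S :: "'a set" and e :: real
    using finite_subset[OF \<open>S \<subseteq> Basis\<close> finite_Basis] \<open>S \<subseteq> Basis\<close>
  proof (induction S rule: finite_induct)
    case empty
    then show ?case by (auto intro: exI[of _ 1])
  next
    case (insert b S)
    then obtain d where d: "d > 0" and IH: "\<And>h. norm h < d \<Longrightarrow>
      norm (f (x + (\<Sum>b\<in>S. (h \<bullet> b) *\<^sub>R b)) - f x - (\<Sum>b\<in>S. (h \<bullet> b) *\<^sub>R partial_deriv b f x)) \<le> e * (\<Sum>b\<in>S. \<bar>h \<bullet> b\<bar>)"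
      by auto
    have b: "b \<in> Basis" using insert by auto
    have "isCont (partial_deriv b f) x" using cont[OF b] by (simp add: continuous_on_eq_continuous_at)
    then obtain r where r: "r > 0" and close: "\<And>y. dist y x < r \<Longrightarrow> dist (partial_deriv b f y) (partial_deriv b f x) < e"
      using \<open>e > 0\<close> unfolding continuous_at by (metis (no_types) Lim_at dist_self dist_nz)
    \<comment> \<open>Dividing r by the dimension keeps the sum of all coordinates of h below r, so
      every intermediate point lies in the ball where the partial derivative is e-close to its value
      at x.\<close>
    show ?case
    proof (intro exI[of _ "min d (r / DIM('a))"] conjI allI impI)
      show "0 < min d (r / DIM('a))" using d r by simp
      fix h :: 'a assume h: "norm h < min d (r / DIM('a))"
      define y where "y = x + (\<Sum>b\<in>S. (h \<bullet> b) *\<^sub>R b)"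
      \<comment> \<open>Subtracting the linear part leaves a function whose derivative is a
        difference of two values of the partial derivative, hence of norm at most e on the
        segment.\<close>
      define g where "g t = f (y + t *\<^sub>R b) - t *\<^sub>R partial_deriv b f x" for t :: real
      have dist: "dist (y + t *\<^sub>R b) x < r" if "\<bar>t\<bar> \<le> \<bar>h \<bullet> b\<bar>" for t
      proof -
        have "norm (y + t *\<^sub>R b - x) \<le> norm (\<Sum>b\<in>S. (h \<bullet> b) *\<^sub>R b) + norm (t *\<^sub>R b)"
          unfolding y_def by (metis add_diff_cancel_left' add.assoc norm_triangle_ineq)
        also have "\<dots> \<le> (\<Sum>b\<in>S. \<bar>h \<bullet> b\<bar>) + \<bar>h \<bullet> b\<bar>"
          using b insert.prems that by (intro add_mono sum_norm_le) auto
        also have "\<dots> = (\<Sum>b\<in>insert b S. \<bar>h \<bullet> b\<bar>)" using insert.hyps by simp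
        also have "\<dots> \<le> (\<Sum>b\<in>Basis. \<bar>h \<bullet> b\<bar>)" using insert.prems by (intro sum_mono2) auto
        also have "\<dots> \<le> (\<Sum>b\<in>(Basis::'a set). norm h)" by (intro sum_mono Basis_le_norm)
        also have "\<dots> < r" using h by (simp add: field_simps)
        finally show ?thesis by (simp add: dist_norm)
      qed
      have deriv: "(g has_derivative (\<lambda>s. s *\<^sub>R (partial_deriv b f (y + t *\<^sub>R b) - partial_deriv b f x))) (at t within T)" for t T
      proof -
        have "(g has_vector_derivative (partial_deriv b f (y + t *\<^sub>R b) - 1 *\<^sub>R partial_deriv b f x)) (at t)"
          unfolding g_def
          by (intro has_vector_derivative_diff partial_deriv_along diff[OF b])
             (auto intro!: derivative_eq_intros)
        then show ?thesis by (simp add: has_vector_derivative_def has_derivative_at_withinI)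
      qed
      have "norm (g (h \<bullet> b) - g 0) \<le> e * norm ((h \<bullet> b) - 0)"
      proof (rule differentiable_bound[where S="{-\<bar>h \<bullet> b\<bar>..\<bar>h \<bullet> b\<bar>}" and f'="\<lambda>t s. s *\<^sub>R (partial_deriv b f (y + t *\<^sub>R b) - partial_deriv b f x)"])
        fix t assume "t \<in> {-\<bar>h \<bullet> b\<bar>..\<bar>h \<bullet> b\<bar>}"
        then have "norm (partial_deriv b f (y + t *\<^sub>R b) - partial_deriv b f x) \<le> e"
          using close[OF dist, of t] by (simp add: dist_norm abs_le_iff)
        then show "onorm (\<lambda>s. s *\<^sub>R (partial_deriv b f (y + t *\<^sub>R b) - partial_deriv b f x)) \<le> e"
          by (intro onorm_le) (simp add: mult.commute[of e] mult_left_mono)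
      qed (use deriv in auto)
      then have "norm (f (y + (h \<bullet> b) *\<^sub>R b) - f y - (h \<bullet> b) *\<^sub>R partial_deriv b f x) \<le> e * \<bar>h \<bullet> b\<bar>"
        by (simp add: g_def algebra_simps)
      moreover have "norm (f y - f x - (\<Sum>b\<in>S. (h \<bullet> b) *\<^sub>R partial_deriv b f x)) \<le> e * (\<Sum>b\<in>S. \<bar>h \<bullet> b\<bar>)"
        using IH[of h] h by (simp add: y_def)
      ultimately have "norm ((f (y + (h \<bullet> b) *\<^sub>R b) - f y - (h \<bullet> b) *\<^sub>R partial_deriv b f x) +
         (f y - f x - (\<Sum>b\<in>S. (h \<bullet> b) *\<^sub>R partial_deriv b f x))) \<le> e * \<bar>h \<bullet> b\<bar> + e * (\<Sum>b\<in>S. \<bar>h \<bullet> b\<bar>)"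
        by (rule norm_triangle_mono)
      then show "norm (f (x + (\<Sum>b\<in>insert b S. (h \<bullet> b) *\<^sub>R b)) - f x - (\<Sum>b\<in>insert b S. (h \<bullet> b) *\<^sub>R partial_deriv b f x))
           \<le> e * (\<Sum>b\<in>insert b S. \<bar>h \<bullet> b\<bar>)"
        using insert.hyps by (simp add: y_def algebra_simps)
    qed
  qed
  show ?thesis
    unfolding has_derivative_at_alt
  proof (intro conjI allI impI)
    show "bounded_linear (\<lambda>h. \<Sum>b\<in>Basis. (h \<bullet> b) *\<^sub>R partial_deriv b f x)"
      by (intro bounded_linear_sum bounded_linear_scaleR_const bounded_linear_inner_left)
    fix e :: real assume e: "e > 0"
    \<comment> \<open>The sum of the |h \<bullet> b| is at most the dimension times |h|.\<close>
    define e' where "e' = e / DIM('a)"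
    have "e' > 0" using e by (simp add: e'_def)
    from claim[OF this subset_refl] obtain d where d: "d > 0"
      and *: "\<And>h. norm h < d \<Longrightarrow>
      norm (f (x + (\<Sum>b\<in>Basis. (h \<bullet> b) *\<^sub>R b)) - f x - (\<Sum>b\<in>Basis. (h \<bullet> b) *\<^sub>R partial_deriv b f x)) \<le> e' * (\<Sum>b\<in>Basis. \<bar>h \<bullet> b\<bar>)"
      by blast
    show "\<exists>d>0. \<forall>y. norm (y - x) < d \<longrightarrow>
       norm (f y - f x - (\<Sum>b\<in>Basis. ((y - x) \<bullet> b) *\<^sub>R partial_deriv b f x)) \<le> e * norm (y - x)"
    proof (intro exI[of _ d] conjI allI impI d)
      fix y assume y: "norm (y - x) < d"
      have "(\<Sum>b\<in>Basis. \<bar>(y - x) \<bullet> b\<bar>) \<le> (\<Sum>b\<in>(Basis::'a set). norm (y - x))"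
        by (intro sum_mono Basis_le_norm)
      then have "e' * (\<Sum>b\<in>Basis. \<bar>(y - x) \<bullet> b\<bar>) \<le> e' * (DIM('a) * norm (y - x))"
        using \<open>e' > 0\<close> by (intro mult_left_mono) auto
      also have "\<dots> = e * norm (y - x)" by (simp add: e'_def)
      finally show "norm (f y - f x - (\<Sum>b\<in>Basis. ((y - x) \<bullet> b) *\<^sub>R partial_deriv b f x)) \<le> e * norm (y - x)"
        using *[OF y] by (simp add: euclidean_representation)
    qed
  qed
qed

lemma has_derivative_C1:
  fixes f :: "'a::euclidean_space \<Rightarrow> complex"
  assumes "C_class (Suc 0) f"
  shows "(f has_derivative (\<lambda>h. \<Sum>b\<in>Basis. (h \<bullet> b) *\<^sub>R partial_deriv b f x)) (at x)"
  using assms by (intro has_derivative_continuous_partials) auto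

lemma has_vector_derivative_scaleR_const:
  "(f has_vector_derivative f') F \<Longrightarrow> ((\<lambda>x. c *\<^sub>R f x) has_vector_derivative c *\<^sub>R f') F"
  by (rule bounded_linear.has_vector_derivative[OF bounded_linear_scaleR_right])

lemma sum_Basis_Times:
  fixes f :: "'a::euclidean_space \<times> 'b::euclidean_space \<Rightarrow> 'c::comm_monoid_add"
  shows "sum f Basis = (\<Sum>i\<in>Basis. f (i, 0)) + (\<Sum>j\<in>Basis. f (0, j))"
  unfolding Basis_prod_def
  by (subst sum.union_disjoint) (auto simp: sum.reindex inj_on_def o_def)

text \<open>The chain rule along a dilation. The weights \<xi> \<bullet> i cost a factor |\<xi>|,
  which the choice d = 1/r compensates on a shell of size r.\<close>

lemma C1_scale_fst:
  fixes F :: "'a::euclidean_space \<times> 'a \<Rightarrow> complex"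
  assumes "C_class (Suc 0) F"
  shows "((\<lambda>u. F ((c + d * u) *\<^sub>R \<xi>, y)) has_vector_derivative
     d *\<^sub>R (\<Sum>i\<in>Basis. (\<xi> \<bullet> i) *\<^sub>R partial_deriv (i, 0) F ((c + d * u) *\<^sub>R \<xi>, y))) (at u)"
proof -
  have "((\<lambda>u. ((c + d * u) *\<^sub>R \<xi>, y)) has_derivative (\<lambda>s. ((s * d) *\<^sub>R \<xi>, 0))) (at u)"
    by (auto intro!: derivative_eq_intros simp: mult_ac)
  from has_derivative_compose[OF this has_derivative_C1[OF assms]]
  show ?thesis
    unfolding has_vector_derivative_def
    by (simp add: sum_Basis_Times scaleR_sum_right mult_ac)
qed

lemma C1_scale_snd:
  fixes F :: "'a::euclidean_space \<times> 'a \<Rightarrow> complex"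
  assumes "C_class (Suc 0) F"
  shows "((\<lambda>u. F (y, (c + d * u) *\<^sub>R \<eta>)) has_vector_derivative
     d *\<^sub>R (\<Sum>j\<in>Basis. (\<eta> \<bullet> j) *\<^sub>R partial_deriv (0, j) F (y, (c + d * u) *\<^sub>R \<eta>))) (at u)"
proof -
  have "((\<lambda>u. (y, (c + d * u) *\<^sub>R \<eta>)) has_derivative (\<lambda>s. (0, (s * d) *\<^sub>R \<eta>))) (at u)"
    by (auto intro!: derivative_eq_intros simp: mult_ac)
  from has_derivative_compose[OF this has_derivative_C1[OF assms]]
  show ?thesis
    unfolding has_vector_derivative_def
    by (simp add: sum_Basis_Times scaleR_sum_right mult_ac)
qed

section \<open>Dilations of the multiplier\<close>

lemma integral_Times_iterated:
  fixes f :: "real \<times> real \<Rightarrow> complex"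
  assumes "compact A" "compact B" "continuous_on UNIV f"
  shows "(LINT p|lborel. indicator (A \<times> B) p *\<^sub>R f p) =
    (LINT u|lborel. indicator A u *\<^sub>R (LINT v|lborel. indicator B v *\<^sub>R f (u, v)))"
proof -
  have "integrable lborel (\<lambda>p. indicator (A \<times> B) p *\<^sub>R f p)"
    using assms by (intro borel_integrable_compact compact_Times continuous_on_subset[OF assms(3)]) auto
  then have "integrable (lborel \<Otimes>\<^sub>M lborel) (\<lambda>p. indicator (A \<times> B) p *\<^sub>R f p)"
    by (simp add: lborel_prod)
  from lborel_pair.integral_fst'[OF this] show ?thesis
    by (simp add: indicator_times lborel_prod mult_ac flip: scaleR_scaleR)
qed

lemma FTC_unit_interval:
  fixes g :: "real \<Rightarrow> complex"
  assumes "\<And>u. (G has_vector_derivative g u) (at u)" "continuous_on UNIV g" "0 \<le> \<tau>"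
  shows "(LINT u|lborel. indicator {0..\<tau>} u *\<^sub>R g u) = G \<tau> - G 0"
  using assms by (intro integral_FTC_Icc) (auto intro: continuous_on_subset has_vector_derivative_at_within)

text \<open>The corner value, two edge increments and the mixed second difference add up to the
  value at (\<tau>1, \<tau>2). The terms of lower dimension are integrated over an extra unit side,
  which costs nothing and gives all four the same shape: a kernel integrated over a rectangle inside
  the unit square when \<tau>1, \<tau>2 \<le> 1.\<close>

lemma FTC_square:
  fixes G G1 G12 :: "real \<Rightarrow> real \<Rightarrow> complex" and G2 :: "real \<Rightarrow> complex"
  assumes d1: "\<And>u v. ((\<lambda>u. G u v) has_vector_derivative G1 u v) (at u)"
    and d2: "\<And>v. ((\<lambda>v. G 0 v) has_vector_derivative G2 v) (at v)"
    and d12: "\<And>u v. ((\<lambda>v. G1 u v) has_vector_derivative G12 u v) (at v)"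
    and c1: "\<And>v. continuous_on UNIV (\<lambda>u. G1 u v)"
    and c2: "continuous_on UNIV G2"
    and c12: "continuous_on UNIV (\<lambda>p. G12 (fst p) (snd p))"
    and \<tau>: "0 \<le> \<tau>1" "0 \<le> \<tau>2"
  shows "G \<tau>1 \<tau>2 =
      (LINT p|lborel. indicator ({0..1::real} \<times> {0..1::real}) p *\<^sub>R G 0 0) +
      (LINT p|lborel. indicator ({0..\<tau>1} \<times> {0..1::real}) p *\<^sub>R G1 (fst p) 0) +
      (LINT p|lborel. indicator ({0..1::real} \<times> {0..\<tau>2}) p *\<^sub>R G2 (snd p)) +
      (LINT p|lborel. indicator ({0..\<tau>1} \<times> {0..\<tau>2}) p *\<^sub>R G12 (fst p) (snd p))"
proof -
  have c1': "continuous_on UNIV (\<lambda>p::real \<times> real. G1 (fst p) 0)"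
    by (rule continuous_on_compose2[OF c1[of 0]]) (auto intro!: continuous_intros)
  have c2': "continuous_on UNIV (\<lambda>p::real \<times> real. G2 (snd p))"
    by (rule continuous_on_compose2[OF c2]) (auto intro!: continuous_intros)
  have c12': "continuous_on UNIV (G12 u)" for u
  proof -
    have "continuous_on UNIV (\<lambda>v. G12 (fst (u, v)) (snd (u, v)))"
      by (rule continuous_on_compose2[OF c12]) (auto intro!: continuous_intros)
    then show ?thesis by simp
  qed
  have "(LINT p|lborel. indicator ({0..1::real} \<times> {0..1::real}) p *\<^sub>R G 0 0) = G 0 0"
    by (subst integral_Times_iterated) auto
  moreover have "(LINT p|lborel. indicator ({0..\<tau>1} \<times> {0..1::real}) p *\<^sub>R G1 (fst p) 0) = G \<tau>1 0 - G 0 0"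
    by (subst integral_Times_iterated[OF _ _ c1']) (auto simp: FTC_unit_interval[OF d1 c1 \<tau>(1)])
  moreover have "(LINT p|lborel. indicator ({0..1::real} \<times> {0..\<tau>2}) p *\<^sub>R G2 (snd p)) = G 0 \<tau>2 - G 0 0"
    by (subst integral_Times_iterated[OF _ _ c2']) (auto simp: FTC_unit_interval[OF d2 c2 \<tau>(2)])
  moreover have "(LINT p|lborel. indicator ({0..\<tau>1} \<times> {0..\<tau>2}) p *\<^sub>R G12 (fst p) (snd p)) =
      (LINT u|lborel. indicator {0..\<tau>1} u *\<^sub>R (G1 u \<tau>2 - G1 u 0))"
    by (subst integral_Times_iterated[OF _ _ c12]) (auto simp: FTC_unit_interval[OF d12 c12' \<tau>(2)])
  moreover have "(LINT u|lborel. indicator {0..\<tau>1} u *\<^sub>R (G1 u \<tau>2 - G1 u 0)) = (G \<tau>1 \<tau>2 - G \<tau>1 0) - (G 0 \<tau>2 - G 0 0)"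
  proof -
    have "(LINT u|lborel. indicator {0..\<tau>1} u *\<^sub>R (G1 u \<tau>2 - G1 u 0)) = (\<lambda>u. G u \<tau>2 - G u 0) \<tau>1 - (\<lambda>u. G u \<tau>2 - G u 0) 0"
      by (rule FTC_unit_interval[OF _ _ \<tau>(1)]) (intro has_vector_derivative_diff d1 continuous_intros c1)+
    then show ?thesis by simp
  qed
  ultimately show ?thesis by simp
qed

text \<open>Admissibility provides one constant per list of directions; there are finitely many
  lists of length at most k, and the sum of their constants dominates each of them.\<close>

lemma admissible_uniform_bound:
  fixes m :: "'a::euclidean_space \<times> 'a \<Rightarrow> complex"
  assumes "admissible a k m"
  obtains C where "C > 0"
    and "\<And>bs \<xi> \<eta>. set bs \<subseteq> Basis \<Longrightarrow> length bs \<le> k \<Longrightarrow>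
      norm (iter_partial bs m (\<xi>, \<eta>)) \<le> C * (1 + norm \<xi> + norm \<eta>) powr (- a)"
proof -
  define L where "L = {bs :: ('a \<times> 'a) list. set bs \<subseteq> Basis \<and> length bs \<le> k}"
  have fin: "finite L" unfolding L_def by (rule finite_lists_length_le) simp
  have "\<forall>bs\<in>L. \<exists>C>0. \<forall>\<xi> \<eta>. norm (iter_partial bs m (\<xi>, \<eta>)) \<le> C * (1 + norm \<xi> + norm \<eta>) powr (- a)"
    using assms by (auto simp: admissible_def L_def)
  then obtain C where C: "\<And>bs. bs \<in> L \<Longrightarrow> C bs > 0"
    "\<And>bs \<xi> \<eta>. bs \<in> L \<Longrightarrow> norm (iter_partial bs m (\<xi>, \<eta>)) \<le> C bs * (1 + norm \<xi> + norm \<eta>) powr (- a)"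
    by metis
  have le: "C bs \<le> 1 + sum C L" if "bs \<in> L" for bs
    using member_le_sum[OF that, of C] C fin by (force intro: less_imp_le)
  show ?thesis
  proof
    show "1 + sum C L > 0" using C by (intro add_pos_nonneg sum_nonneg) (auto intro: less_imp_le)
    fix bs :: "('a \<times> 'a) list" and \<xi> \<eta> assume "set bs \<subseteq> Basis" "length bs \<le> k"
    then have bs: "bs \<in> L" by (simp add: L_def)
    show "norm (iter_partial bs m (\<xi>, \<eta>)) \<le> (1 + sum C L) * (1 + norm \<xi> + norm \<eta>) powr (- a)"
      by (rule order_trans[OF C(2)[OF bs]]) (intro mult_right_mono le[OF bs], auto)
  qed
qed

text \<open>
  The four kernels are \<open>m\<close> at the corner \<open>(c1, c2)\<close> and its \<open>t1\<close>-, \<open>t2\<close>- and mixed derivatives in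
  \<open>m(t1 \<xi>, t2 \<eta>)\<close>, rescaled to the unit square; they do not depend on \<open>(\<tau>1, \<tau>2)\<close>, which enters
  only through the rectangles \<open>X k\<close>.
\<close>

lemma kernel_representation:
  fixes m :: "'a::euclidean_space \<times> 'a \<Rightarrow> complex"
  assumes adm: "admissible a 2 m"
  obtains C where "C > 0" and
    "\<And>c1 c2 r. c1 \<ge> 1 \<Longrightarrow> c2 \<ge> 1 \<Longrightarrow> r \<ge> 1 \<Longrightarrow>
      \<exists>K :: nat \<Rightarrow> real \<times> real \<Rightarrow> 'a \<times> 'a \<Rightarrow> complex.
        (\<forall>k<4. continuous_on UNIV (\<lambda>q. K k (fst q) (snd q))) \<and>
        (\<forall>k<4. \<forall>p\<in>{0..1} \<times> {0..1}. \<forall>\<xi> \<eta>. r \<le> 1 + norm \<xi> + norm \<eta> \<longrightarrow> 1 + norm \<xi> + norm \<eta> \<le> 2 * r \<longrightarrow>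
            norm (K k p (\<xi>, \<eta>)) \<le> C * r powr (- a)) \<and>
        (\<forall>\<tau>1\<in>{0..1}. \<forall>\<tau>2\<in>{0..1}. \<exists>X. (\<forall>k<4. compact (X k) \<and> X k \<subseteq> {0..1} \<times> {0..1}) \<and>
            (\<forall>\<xi> \<eta>. m ((c1 + \<tau>1 / r) *\<^sub>R \<xi>, (c2 + \<tau>2 / r) *\<^sub>R \<eta>) =
               (\<Sum>k<4. (LINT p|lborel. indicator (X k) p *\<^sub>R K k p (\<xi>, \<eta>)))))"
proof -
  obtain C where C: "C > 0"
    "\<And>bs \<xi> \<eta>. set bs \<subseteq> Basis \<Longrightarrow> length bs \<le> 2 \<Longrightarrow>
      norm (iter_partial bs m (\<xi>, \<eta>)) \<le> C * (1 + norm \<xi> + norm \<eta>) powr (- a)"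
    using admissible_uniform_bound[OF adm] by metis
  have a: "a \<ge> 0" using adm by (auto simp: admissible_def intro: order_trans[of _ "DIM('a) / 2"])
  have CC: "C_class (Suc (Suc 0)) m" using adm by (simp add: admissible_def numeral_2_eq_2)
  have Cm: "C_class (Suc 0) m" using CC by auto
  have Cm0: "continuous_on UNIV m" using CC by auto
  have C1: "C_class (Suc 0) (partial_deriv b m)" if "b \<in> Basis" for b using CC that by auto
  have C10: "continuous_on UNIV (partial_deriv b m)" if "b \<in> Basis" for b using CC that by auto
  have C2: "continuous_on UNIV (partial_deriv b' (partial_deriv b m))" if "b \<in> Basis" "b' \<in> Basis" for b b' using CC that by auto
  have inB: "(i, 0) \<in> Basis" "(0, i) \<in> Basis" if "i \<in> Basis" for i :: 'a
    using that by (auto simp: Basis_prod_def)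
  let ?D = "real DIM('a)"
  have D1: "?D \<ge> 1" using DIM_positive[where 'a='a] by linarith
  \<comment> \<open>The mixed kernel determines the constant: it contains two dilation derivatives,
    each costing a factor 2D on the shell.\<close>
  show thesis
  proof (rule that[of "4 * ?D\<^sup>2 * C"])
    show "4 * ?D\<^sup>2 * C > 0" using C D1 by simp
    fix c1 c2 r :: real assume c: "c1 \<ge> 1" "c2 \<ge> 1" and r: "r \<ge> 1"
    define P1 where "P1 = (\<lambda>p z. (inverse r) *\<^sub>R (\<Sum>i\<in>Basis. (fst z \<bullet> i) *\<^sub>R partial_deriv (i, 0) m ((c1 + inverse r * fst p) *\<^sub>R fst z, (c2 + inverse r * snd p) *\<^sub>R snd z)))"
    define P2 where "P2 = (\<lambda>p z. (inverse r) *\<^sub>R (\<Sum>j\<in>Basis. (snd z \<bullet> j) *\<^sub>R partial_deriv (0, j) m ((c1 + inverse r * fst p) *\<^sub>R fst z, (c2 + inverse r * snd p) *\<^sub>R snd z)))"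
    define P3 where "P3 = (\<lambda>p z. (inverse r) *\<^sub>R (\<Sum>i\<in>Basis. (fst z \<bullet> i) *\<^sub>R ((inverse r) *\<^sub>R (\<Sum>j\<in>Basis. (snd z \<bullet> j) *\<^sub>R
        partial_deriv (0, j) (partial_deriv (i, 0) m) ((c1 + inverse r * fst p) *\<^sub>R fst z, (c2 + inverse r * snd p) *\<^sub>R snd z)))))"
    define P0 where "P0 = (\<lambda>p z. m ((c1 + inverse r * fst p) *\<^sub>R fst z, (c2 + inverse r * snd p) *\<^sub>R snd z))"
    \<comment> \<open>The first-order kernels are frozen at 0 in the other variable, since they
      arise from the two edges through the corner.\<close>
    define K where "K k p z = (if k = 0 then P0 (0, 0) z else if k = 1 then P1 (fst p, 0) z else if k = 2 then P2 (0, snd p) z else P3 p z)"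
      for k :: nat and p :: "real \<times> real" and z :: "'a \<times> 'a"
    have cont_arg: "continuous_on UNIV (\<lambda>q. ((c1 + inverse r * fst (f q)) *\<^sub>R fst (g q), (c2 + inverse r * snd (f q)) *\<^sub>R snd (g q)))"
      if "continuous_on UNIV f" "continuous_on UNIV g" for f :: "'z::topological_space \<Rightarrow> real \<times> real" and g :: "'z \<Rightarrow> 'a \<times> 'a"
      by (intro continuous_intros that)
    have cont_P0: "continuous_on UNIV (\<lambda>q. P0 (f q) (g q))"
      if "continuous_on UNIV f" "continuous_on UNIV g" for f :: "'z::topological_space \<Rightarrow> real \<times> real" and g :: "'z \<Rightarrow> 'a \<times> 'a"
      unfolding P0_def by (rule continuous_on_compose2[OF Cm0 cont_arg[OF that]]) simp
    have cont_P1: "continuous_on UNIV (\<lambda>q. P1 (f q) (g q))"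
      if "continuous_on UNIV f" "continuous_on UNIV g" for f :: "'z::topological_space \<Rightarrow> real \<times> real" and g :: "'z \<Rightarrow> 'a \<times> 'a"
      unfolding P1_def
      by (intro continuous_on_scaleR continuous_on_const continuous_on_sum continuous_on_inner continuous_on_fst
          that continuous_on_compose2[OF C10 cont_arg[OF that]] inB subset_UNIV)
    have cont_P2: "continuous_on UNIV (\<lambda>q. P2 (f q) (g q))"
      if "continuous_on UNIV f" "continuous_on UNIV g" for f :: "'z::topological_space \<Rightarrow> real \<times> real" and g :: "'z \<Rightarrow> 'a \<times> 'a"
      unfolding P2_def
      by (intro continuous_on_scaleR continuous_on_const continuous_on_sum continuous_on_inner continuous_on_snd
          that continuous_on_compose2[OF C10 cont_arg[OF that]] inB subset_UNIV)
    have cont_P3: "continuous_on UNIV (\<lambda>q. P3 (f q) (g q))"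
      if "continuous_on UNIV f" "continuous_on UNIV g" for f :: "'z::topological_space \<Rightarrow> real \<times> real" and g :: "'z \<Rightarrow> 'a \<times> 'a"
      unfolding P3_def
      by (intro continuous_on_scaleR continuous_on_const continuous_on_sum continuous_on_inner continuous_on_fst continuous_on_snd
          that continuous_on_compose2[OF C2 cont_arg[OF that]] inB subset_UNIV)
    have cont: "continuous_on UNIV (\<lambda>q. K k (fst q) (snd q))" for k
    proof -
      have "continuous_on UNIV (\<lambda>q. P0 (0, 0) (snd q))" "continuous_on UNIV (\<lambda>q. P1 (fst (fst q), 0) (snd q))"
        "continuous_on UNIV (\<lambda>q. P2 (0, snd (fst q)) (snd q))" "continuous_on UNIV (\<lambda>q. P3 (fst q) (snd q))"
        by (intro cont_P0 cont_P1 cont_P2 cont_P3 continuous_intros)+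
      then show ?thesis unfolding K_def by (cases "k = 0"; cases "k = 1"; cases "k = 2"; simp)
    qed
    have bound: "norm (K k p (\<xi>, \<eta>)) \<le> 4 * ?D\<^sup>2 * C * r powr (- a)"
      if p: "p \<in> {0..1} \<times> {0..1}" and lo: "r \<le> 1 + norm \<xi> + norm \<eta>" and hi: "1 + norm \<xi> + norm \<eta> \<le> 2 * r" for k p \<xi> \<eta>
    proof -
      define Q where "Q = C * r powr (- a)"
      have Q: "Q \<ge> 0" using C by (simp add: Q_def)
      \<comment> \<open>Dilation by factors at least 1 only enlarges the frequency, and a \<ge> 0,
        so the decay is at least that at the inner edge of the shell.\<close>
      have it: "norm (iter_partial bs m (s *\<^sub>R \<xi>, t *\<^sub>R \<eta>)) \<le> Q"
        if "s \<ge> 1" "t \<ge> 1" "set bs \<subseteq> Basis" "length bs \<le> 2" for bs s t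
      proof -
        have "norm \<xi> \<le> \<bar>s\<bar> * norm \<xi>" "norm \<eta> \<le> \<bar>t\<bar> * norm \<eta>"
          using that by (simp_all add: mult_le_cancel_right1)
        then have "r \<le> 1 + norm (s *\<^sub>R \<xi>) + norm (t *\<^sub>R \<eta>)" using lo by simp
        then have "(1 + norm (s *\<^sub>R \<xi>) + norm (t *\<^sub>R \<eta>)) powr (- a) \<le> r powr (- a)"
          using r a by (intro powr_mono2') auto
        then show ?thesis unfolding Q_def
          using C(2)[OF that(3,4), of "s *\<^sub>R \<xi>" "t *\<^sub>R \<eta>"] C(1) by (meson mult_left_mono less_imp_le order_trans)
      qed
      have xi: "inverse r * norm \<xi> \<le> 2" "inverse r * norm \<eta> \<le> 2"
      proof -
        have "norm \<xi> \<le> 2 * r" "norm \<eta> \<le> 2 * r"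
          using hi norm_ge_zero[of \<xi>] norm_ge_zero[of \<eta>] by linarith+
        then show "inverse r * norm \<xi> \<le> 2" "inverse r * norm \<eta> \<le> 2"
          using r by (auto simp: field_simps)
      qed
      \<comment> \<open>One dilation derivative: D directions with weights at most |y|, where |y| /
        r \<le> 2.\<close>
      have lin: "norm ((inverse r) *\<^sub>R (\<Sum>i\<in>Basis. (y \<bullet> i) *\<^sub>R w i)) \<le> 2 * ?D * Q'"
        if "inverse r * norm y \<le> 2" "\<And>i. i \<in> Basis \<Longrightarrow> norm (w i) \<le> Q'" "Q' \<ge> 0" for y :: 'a and w :: "'a \<Rightarrow> complex" and Q'
      proof -
        have "norm (\<Sum>i\<in>Basis. (y \<bullet> i) *\<^sub>R w i) \<le> (\<Sum>i\<in>(Basis::'a set). norm y * Q')"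
          using that by (intro sum_norm_le) (auto intro!: mult_mono Basis_le_norm)
        then have "inverse r * norm (\<Sum>i\<in>Basis. (y \<bullet> i) *\<^sub>R w i) \<le> inverse r * (?D * (norm y * Q'))"
          using r by (intro mult_left_mono) auto
        also have "\<dots> = (inverse r * norm y) * (?D * Q')" by simp
        also have "\<dots> \<le> 2 * (?D * Q')" using that by (intro mult_right_mono) auto
        finally show ?thesis using r by simp
      qed
      have ge: "c1 + inverse r * u \<ge> 1" "c2 + inverse r * u \<ge> 1" if "u \<ge> 0" for u
        using c r that by (auto simp: add_increasing2)
      have pp: "fst p \<ge> 0" "snd p \<ge> 0" using p by auto
      have pd: "norm (partial_deriv b m (s *\<^sub>R \<xi>, t *\<^sub>R \<eta>)) \<le> Q" if "s \<ge> 1" "t \<ge> 1" "b \<in> Basis" for s t b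
        using it[OF that(1,2), of "[b]"] that by (simp add: iter_partial_def)
      have pd2: "norm (partial_deriv b' (partial_deriv b m) (s *\<^sub>R \<xi>, t *\<^sub>R \<eta>)) \<le> Q" if "s \<ge> 1" "t \<ge> 1" "b \<in> Basis" "b' \<in> Basis" for s t b b'
        using it[OF that(1,2), of "[b, b']"] that by (simp add: iter_partial_def)
      have k0: "norm (P0 (0, 0) (\<xi>, \<eta>)) \<le> Q"
        using it[of c1 c2 "[]"] c by (simp add: P0_def iter_partial_def)
      have k1: "norm (P1 (fst p, 0) (\<xi>, \<eta>)) \<le> 2 * ?D * Q"
        unfolding P1_def fst_conv snd_conv by (intro lin xi pd ge inB pp Q) auto
      have k2: "norm (P2 (0, snd p) (\<xi>, \<eta>)) \<le> 2 * ?D * Q"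
        unfolding P2_def fst_conv snd_conv by (intro lin xi pd ge inB pp Q) auto
      have k3: "norm (P3 p (\<xi>, \<eta>)) \<le> 2 * ?D * (2 * ?D * Q)"
        unfolding P3_def fst_conv snd_conv by (intro lin xi pd2 ge inB pp Q mult_nonneg_nonneg) auto
      have "1 * Q \<le> 4 * ?D\<^sup>2 * Q" using Q D1 by (intro mult_right_mono) (auto intro: order_trans[of _ "4 * 1"] simp: one_le_power)
      moreover have "2 * ?D * Q \<le> 4 * ?D\<^sup>2 * Q"
      proof -
        have "2 * ?D * 1 \<le> 2 * ?D * (2 * ?D)"
          using D1 by (intro mult_left_mono) linarith+
        then have "2 * ?D \<le> 4 * ?D\<^sup>2" by (simp add: power2_eq_square)
        then show ?thesis using Q by (rule mult_right_mono)
      qed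
      moreover have "2 * ?D * (2 * ?D * Q) = 4 * ?D\<^sup>2 * Q" by (simp add: power2_eq_square)
      ultimately have "norm (P0 (0, 0) (\<xi>, \<eta>)) \<le> 4 * ?D\<^sup>2 * Q" "norm (P1 (fst p, 0) (\<xi>, \<eta>)) \<le> 4 * ?D\<^sup>2 * Q"
        "norm (P2 (0, snd p) (\<xi>, \<eta>)) \<le> 4 * ?D\<^sup>2 * Q" "norm (P3 p (\<xi>, \<eta>)) \<le> 4 * ?D\<^sup>2 * Q"
        using k0 k1 k2 k3 by linarith+
      then have "norm (K k p (\<xi>, \<eta>)) \<le> 4 * ?D\<^sup>2 * Q"
        unfolding K_def by presburger
      then show ?thesis by (simp add: Q_def mult_ac)
    qed
    have rep: "\<exists>X. (\<forall>k<4. compact (X k) \<and> X k \<subseteq> {0..1} \<times> {0..1}) \<and>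
            (\<forall>\<xi> \<eta>. m ((c1 + \<tau>1 / r) *\<^sub>R \<xi>, (c2 + \<tau>2 / r) *\<^sub>R \<eta>) =
               (\<Sum>k<4. (LINT p|lborel. indicator (X k) p *\<^sub>R K k p (\<xi>, \<eta>))))"
      if \<tau>: "\<tau>1 \<in> {0..1}" "\<tau>2 \<in> {0..1}" for \<tau>1 \<tau>2
    proof -
      define X where "X k = (if k = 0 then {0..1} \<times> {0..1} else if k = 1 then {0..\<tau>1} \<times> {0..1} else if k = 2 then {0..1} \<times> {0..\<tau>2} else {0..\<tau>1} \<times> {0..\<tau>2})" for k :: nat
      have "m ((c1 + \<tau>1 / r) *\<^sub>R \<xi>, (c2 + \<tau>2 / r) *\<^sub>R \<eta>) =
               (\<Sum>k<4. (LINT p|lborel. indicator (X k) p *\<^sub>R K k p (\<xi>, \<eta>)))" for \<xi> \<eta>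
      proof -
        let ?z = "(\<xi>, \<eta>)"
        have "P0 (\<tau>1, \<tau>2) ?z =
          (LINT p|lborel. indicator ({0..1::real} \<times> {0..1::real}) p *\<^sub>R P0 (0, 0) ?z) +
          (LINT p|lborel. indicator ({0..\<tau>1} \<times> {0..1::real}) p *\<^sub>R P1 (fst p, 0) ?z) +
          (LINT p|lborel. indicator ({0..1::real} \<times> {0..\<tau>2}) p *\<^sub>R P2 (0, snd p) ?z) +
          (LINT p|lborel. indicator ({0..\<tau>1} \<times> {0..\<tau>2}) p *\<^sub>R P3 (fst p, snd p) ?z)"
        proof (rule FTC_square)
          show "((\<lambda>u. P0 (u, v) ?z) has_vector_derivative P1 (u, v) ?z) (at u)" for u v
            unfolding P0_def P1_def fst_conv snd_conv by (rule C1_scale_fst[OF Cm])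
          show "((\<lambda>v. P0 (0, v) ?z) has_vector_derivative P2 (0, v) ?z) (at v)" for v
            unfolding P0_def P2_def fst_conv snd_conv by (rule C1_scale_snd[OF Cm])
          show "((\<lambda>v. P1 (u, v) ?z) has_vector_derivative P3 (u, v) ?z) (at v)" for u v
            unfolding P1_def P3_def fst_conv snd_conv
            by (intro has_vector_derivative_scaleR_const has_vector_derivative_sum C1_scale_snd C1 inB)
          show "continuous_on UNIV (\<lambda>u. P1 (u, v) ?z)" for v
            by (intro cont_P1 continuous_intros)
          show "continuous_on UNIV (\<lambda>v. P2 (0, v) ?z)"
            by (intro cont_P2 continuous_intros)
          show "continuous_on UNIV (\<lambda>p. P3 (fst p, snd p) ?z)"
            by (intro cont_P3 continuous_intros)
        qed (use \<tau> in auto)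
        moreover have "m ((c1 + \<tau>1 / r) *\<^sub>R \<xi>, (c2 + \<tau>2 / r) *\<^sub>R \<eta>) = P0 (\<tau>1, \<tau>2) ?z"
          by (simp add: P0_def field_simps)
        ultimately show ?thesis
          by (simp add: X_def K_def eval_nat_numeral)
      qed
      moreover have "\<forall>k<4. compact (X k) \<and> X k \<subseteq> {0..1} \<times> {0..1}"
        using \<tau> by (auto simp: X_def intro!: compact_Times)
      ultimately show ?thesis by blast
    qed
    show "\<exists>K :: nat \<Rightarrow> real \<times> real \<Rightarrow> 'a \<times> 'a \<Rightarrow> complex.
        (\<forall>k<4. continuous_on UNIV (\<lambda>q. K k (fst q) (snd q))) \<and>
        (\<forall>k<4. \<forall>p\<in>{0..1} \<times> {0..1}. \<forall>\<xi> \<eta>. r \<le> 1 + norm \<xi> + norm \<eta> \<longrightarrow> 1 + norm \<xi> + norm \<eta> \<le> 2 * r \<longrightarrow>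
            norm (K k p (\<xi>, \<eta>)) \<le> 4 * ?D\<^sup>2 * C * r powr (- a)) \<and>
        (\<forall>\<tau>1\<in>{0..1}. \<forall>\<tau>2\<in>{0..1}. \<exists>X. (\<forall>k<4. compact (X k) \<and> X k \<subseteq> {0..1} \<times> {0..1}) \<and>
            (\<forall>\<xi> \<eta>. m ((c1 + \<tau>1 / r) *\<^sub>R \<xi>, (c2 + \<tau>2 / r) *\<^sub>R \<eta>) =
               (\<Sum>k<4. (LINT p|lborel. indicator (X k) p *\<^sub>R K k p (\<xi>, \<eta>)))))"
      by (rule exI[of _ K]) (use cont bound rep in blast)
  qed
qed

section \<open>The maximal function on a frequency shell\<close>

lemma ennreal_sum_power2_le:
  fixes a :: "'i \<Rightarrow> ennreal"
  assumes "finite I"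
  shows "(\<Sum>i\<in>I. a i)\<^sup>2 \<le> of_nat (card I) * (\<Sum>i\<in>I. (a i)\<^sup>2)"
  using Cauchy_Schwarz_nn_integral[of "\<lambda>_. 1" "count_space I" a] assms
  by (simp add: nn_integral_count_space_finite)

text \<open>Cauchy-Schwarz on a set of measure at most one: the squared integral is at most the
  integral of the square, and Tonelli then exposes the L^2 bound for each fixed p.\<close>

lemma nn_integral_average_power2_le:
  fixes F :: "'b::euclidean_space \<Rightarrow> 'a::euclidean_space \<Rightarrow> ennreal"
  assumes [measurable]: "(\<lambda>(p, x). F p x) \<in> borel_measurable (borel \<Otimes>\<^sub>M borel)" "X \<in> sets borel"
    and X: "emeasure lborel X \<le> 1"
    and bd: "\<And>p. p \<in> X \<Longrightarrow> (\<integral>\<^sup>+x. (F p x)\<^sup>2 \<partial>lborel) \<le> V"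
  shows "(\<integral>\<^sup>+x. (\<integral>\<^sup>+p. indicator X p * F p x \<partial>lborel)\<^sup>2 \<partial>lborel) \<le> V"
proof -
  have ind: "(indicator X p :: ennreal)\<^sup>2 = indicator X p" for p by (auto simp: indicator_def)
  have "(\<integral>\<^sup>+x. (\<integral>\<^sup>+p. indicator X p * F p x \<partial>lborel)\<^sup>2 \<partial>lborel) \<le> (\<integral>\<^sup>+x. (\<integral>\<^sup>+p. indicator X p * (F p x)\<^sup>2 \<partial>lborel) \<partial>lborel)"
  proof (rule nn_integral_mono)
    fix x
    have "(\<integral>\<^sup>+p. indicator X p * F p x \<partial>lborel)\<^sup>2 = (\<integral>\<^sup>+p. indicator X p * (indicator X p * F p x) \<partial>lborel)\<^sup>2"
      by (simp add: ind power2_eq_square[symmetric] flip: mult.assoc)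
    also have "\<dots> \<le> (\<integral>\<^sup>+p. (indicator X p)\<^sup>2 \<partial>lborel) * (\<integral>\<^sup>+p. (indicator X p * F p x)\<^sup>2 \<partial>lborel)"
      by (rule Cauchy_Schwarz_nn_integral) measurable
    also have "\<dots> \<le> 1 * (\<integral>\<^sup>+p. indicator X p * (F p x)\<^sup>2 \<partial>lborel)"
      using X by (intro mult_mono) (auto simp: ind power_mult_distrib)
    finally show "(\<integral>\<^sup>+p. indicator X p * F p x \<partial>lborel)\<^sup>2 \<le> (\<integral>\<^sup>+p. indicator X p * (F p x)\<^sup>2 \<partial>lborel)" by simp
  qed
  also have "\<dots> = (\<integral>\<^sup>+p. (\<integral>\<^sup>+x. indicator X p * (F p x)\<^sup>2 \<partial>lborel) \<partial>lborel)"
    by (rule lborel_pair.Fubini') measurable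
  also have "\<dots> = (\<integral>\<^sup>+p. indicator X p * (\<integral>\<^sup>+x. (F p x)\<^sup>2 \<partial>lborel) \<partial>lborel)"
    by (simp add: nn_integral_cmult)
  also have "\<dots> \<le> (\<integral>\<^sup>+p. V * indicator X p \<partial>lborel)"
    using bd by (intro nn_integral_mono) (auto simp: indicator_def)
  also have "\<dots> = V * emeasure lborel X"
    by (simp add: nn_integral_cmult)
  also have "\<dots> \<le> V * 1" using X by (rule mult_left_mono) simp
  finally show ?thesis by simp
qed

text \<open>The size function is the one in the admissibility bound. The half-open condition makes
  the shells with r = 2^j a partition of the whole space.\<close>

definition shell :: "real \<Rightarrow> ('a::euclidean_space \<times> 'a) set" where
  "shell r = {z. r \<le> 1 + norm (fst z) + norm (snd z) \<and> 1 + norm (fst z) + norm (snd z) < 2 * r}"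

lemma shell_measurable [measurable]: "shell r \<in> sets borel"
proof -
  have "closed {z :: 'a \<times> 'a. r \<le> 1 + norm (fst z) + norm (snd z)}"
    "open {z :: 'a \<times> 'a. 1 + norm (fst z) + norm (snd z) < 2 * r}"
    by (intro closed_Collect_le open_Collect_less continuous_intros)+
  then show ?thesis
    unfolding shell_def Collect_conj_eq by (intro sets.Int borel_closed borel_open)
qed

text \<open>The supremum over (\<tau>1, \<tau>2) disappears when absolute values are put inside the
  representation of m and the rectangles are enlarged to the unit square; the majorant
  \<open>Q\<close> is then an integral, hence measurable. In the application \<phi>, \<psi> are the
  Fourier transforms of u, v, and p, q those of f, g. The bounds L, L' justify Fubini, while
  \<alpha>, \<alpha>' carry the sizes that are tracked.\<close>

lemma shell_piece_maximal:
  fixes m :: "'a::euclidean_space \<times> 'a \<Rightarrow> complex"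
  assumes adm: "admissible a 2 m"
  obtains C where "C > 0" and
    "\<And>c1 c2 r \<alpha> \<alpha>' L L' \<phi> \<psi> p q. \<lbrakk>c1 \<ge> 1; c2 \<ge> 1; r \<ge> 1; \<alpha> \<ge> 0; \<alpha>' \<ge> 0;
       \<phi> \<in> borel_measurable borel; \<psi> \<in> borel_measurable borel; p \<in> borel_measurable borel; q \<in> borel_measurable borel;
       \<And>\<xi>. norm (\<phi> \<xi>) \<le> L; \<And>\<eta>. norm (\<psi> \<eta>) \<le> L';
       \<And>\<xi>. 1 + norm \<xi> \<le> 2 * r \<Longrightarrow> norm (\<phi> \<xi>) \<le> \<alpha> * norm (p \<xi> :: complex);
       \<And>\<eta>. 1 + norm \<eta> \<le> 2 * r \<Longrightarrow> norm (\<psi> \<eta>) \<le> \<alpha>' * norm (q \<eta> :: complex)\<rbrakk> \<Longrightarrow>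
      \<exists>Q :: 'a \<Rightarrow> ennreal. Q \<in> borel_measurable borel \<and>
        (\<forall>\<tau>1\<in>{0..1}. \<forall>\<tau>2\<in>{0..1}. \<forall>x.
          ennreal (norm (LINT z|lborel. indicator (shell r) z *\<^sub>R (\<phi> (fst z) * \<psi> (snd z) *
             m ((c1 + \<tau>1 / r) *\<^sub>R fst z, (c2 + \<tau>2 / r) *\<^sub>R snd z) *
             exp (2 * of_real pi * \<i> * of_real (x \<bullet> (fst z + snd z)))))) \<le> Q x) \<and>
        (\<integral>\<^sup>+x. (Q x)\<^sup>2 \<partial>lborel) \<le> 16 * (ennreal ((\<alpha> * \<alpha>' * (C * r powr (- a)))\<^sup>2) * emeasure lborel (cball (0::'a) (2 * r)) *
           (\<integral>\<^sup>+\<xi>. (ennreal (norm (p \<xi>)))\<^sup>2 \<partial>lborel) * (\<integral>\<^sup>+\<eta>. (ennreal (norm (q \<eta>)))\<^sup>2 \<partial>lborel))"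
proof -
  obtain C where C: "C > 0" and rep:
    "\<And>c1 c2 r. c1 \<ge> 1 \<Longrightarrow> c2 \<ge> 1 \<Longrightarrow> r \<ge> 1 \<Longrightarrow>
      \<exists>K :: nat \<Rightarrow> real \<times> real \<Rightarrow> 'a \<times> 'a \<Rightarrow> complex.
        (\<forall>k<4. continuous_on UNIV (\<lambda>q. K k (fst q) (snd q))) \<and>
        (\<forall>k<4. \<forall>p\<in>{0..1} \<times> {0..1}. \<forall>\<xi> \<eta>. r \<le> 1 + norm \<xi> + norm \<eta> \<longrightarrow> 1 + norm \<xi> + norm \<eta> \<le> 2 * r \<longrightarrow>
            norm (K k p (\<xi>, \<eta>)) \<le> C * r powr (- a)) \<and>
        (\<forall>\<tau>1\<in>{0..1}. \<forall>\<tau>2\<in>{0..1}. \<exists>X. (\<forall>k<4. compact (X k) \<and> X k \<subseteq> {0..1} \<times> {0..1}) \<and>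
            (\<forall>\<xi> \<eta>. m ((c1 + \<tau>1 / r) *\<^sub>R \<xi>, (c2 + \<tau>2 / r) *\<^sub>R \<eta>) =
               (\<Sum>k<4. (LINT p|lborel. indicator (X k) p *\<^sub>R K k p (\<xi>, \<eta>)))))"
    by (rule kernel_representation[OF adm]) blast
  show thesis
  proof (rule that[OF C])
    fix c1 c2 r \<alpha> \<alpha>' L L' :: real and \<phi> \<psi> p q :: "'a \<Rightarrow> complex"
    assume c: "c1 \<ge> 1" "c2 \<ge> 1" and r: "r \<ge> 1" and \<alpha>: "\<alpha> \<ge> 0" "\<alpha>' \<ge> 0"
      and meas[measurable]: "\<phi> \<in> borel_measurable borel" "\<psi> \<in> borel_measurable borel" "p \<in> borel_measurable borel" "q \<in> borel_measurable borel"
      and L: "\<And>\<xi>. norm (\<phi> \<xi>) \<le> L" "\<And>\<eta>. norm (\<psi> \<eta>) \<le> L'"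
      and dom: "\<And>\<xi>. 1 + norm \<xi> \<le> 2 * r \<Longrightarrow> norm (\<phi> \<xi>) \<le> \<alpha> * norm (p \<xi>)"
       "\<And>\<eta>. 1 + norm \<eta> \<le> 2 * r \<Longrightarrow> norm (\<psi> \<eta>) \<le> \<alpha>' * norm (q \<eta>)"
    define B where "B = C * r powr (- a)"
    have B: "B \<ge> 0" using C by (simp add: B_def)
    have L0: "L \<ge> 0" "L' \<ge> 0" using L norm_ge_zero order_trans by blast+
    define sq where "sq = {0..1::real} \<times> {0..1::real}"
    have sq_m [measurable]: "sq \<in> sets borel"
      unfolding sq_def by (intro borel_closed closed_Times) auto
    have sq1: "emeasure lborel sq = 1"
      unfolding sq_def lborel_prod[symmetric] by (subst lborel.emeasure_pair_measure_Times) auto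
    obtain K :: "nat \<Rightarrow> real \<times> real \<Rightarrow> 'a \<times> 'a \<Rightarrow> complex" where K:
        "(\<forall>k<4. continuous_on UNIV (\<lambda>q. K k (fst q) (snd q))) \<and>
        (\<forall>k<4. \<forall>p\<in>sq. \<forall>\<xi> \<eta>. r \<le> 1 + norm \<xi> + norm \<eta> \<longrightarrow> 1 + norm \<xi> + norm \<eta> \<le> 2 * r \<longrightarrow>
            norm (K k p (\<xi>, \<eta>)) \<le> B) \<and>
        (\<forall>\<tau>1\<in>{0..1}. \<forall>\<tau>2\<in>{0..1}. \<exists>X. (\<forall>k<4. compact (X k) \<and> X k \<subseteq> sq) \<and>
            (\<forall>\<xi> \<eta>. m ((c1 + \<tau>1 / r) *\<^sub>R \<xi>, (c2 + \<tau>2 / r) *\<^sub>R \<eta>) =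
               (\<Sum>k<4. (LINT p|lborel. indicator (X k) p *\<^sub>R K k p (\<xi>, \<eta>)))))"
      using rep[OF c r] unfolding B_def sq_def by (rule exE)
    have Kc: "\<And>k. k < 4 \<Longrightarrow> continuous_on UNIV (\<lambda>q. K k (fst q) (snd q))" using K by simp
    have Kb: "\<And>k p \<xi> \<eta>. k < 4 \<Longrightarrow> p \<in> sq \<Longrightarrow> r \<le> 1 + norm \<xi> + norm \<eta> \<Longrightarrow> 1 + norm \<xi> + norm \<eta> \<le> 2 * r \<Longrightarrow>
          norm (K k p (\<xi>, \<eta>)) \<le> B" using K by simp
    have Kr: "\<exists>X. (\<forall>k<4. compact (X k) \<and> X k \<subseteq> sq) \<and>
            (\<forall>\<xi> \<eta>. m ((c1 + \<tau>1 / r) *\<^sub>R \<xi>, (c2 + \<tau>2 / r) *\<^sub>R \<eta>) =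
               (\<Sum>k<4. (LINT p|lborel. indicator (X k) p *\<^sub>R K k p (\<xi>, \<eta>))))"
       if "\<tau>1 \<in> {0..1}" "\<tau>2 \<in> {0..1}" for \<tau>1 \<tau>2 using K[THEN conjunct2, THEN conjunct2] that by blast
    define \<Phi> where "\<Phi> k pp z = indicator (shell r) z *\<^sub>R (\<phi> (fst z) * \<psi> (snd z) * K k pp z)" for k pp z
    define e where "e x z = exp (2 * complex_of_real pi * \<i> * complex_of_real (x \<bullet> (fst z + snd z)))" for x :: 'a and z :: "'a \<times> 'a"
    have e1: "norm (e x z) = 1" for x z by (simp add: e_def)
    have e_m [measurable]: "(\<lambda>w. e (fst w) (snd w)) \<in> borel_measurable (borel \<Otimes>\<^sub>M borel)"
      unfolding e_def borel_prod[symmetric] by measurable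
    have [measurable]: "e x \<in> borel_measurable borel" for x
      unfolding e_def borel_prod[symmetric] by measurable
    have K_m: "(\<lambda>w. K k (fst w) (snd w)) \<in> borel_measurable (borel \<Otimes>\<^sub>M borel)" if "k < 4" for k
      unfolding borel_prod by (rule borel_measurable_continuous_onI[OF Kc[OF that]])
    have fs_m [measurable]: "(\<lambda>z. \<phi> (fst z) * \<psi> (snd z)) \<in> borel_measurable (borel :: ('a \<times> 'a) measure)"
      unfolding borel_prod[symmetric] by measurable
    have \<Phi>_m: "(\<lambda>w. \<Phi> k (fst w) (snd w)) \<in> borel_measurable (borel \<Otimes>\<^sub>M borel)" if "k < 4" for k
      unfolding \<Phi>_def using K_m[OF that, measurable] by measurable
    have \<Phi>_m1 [measurable]: "\<Phi> k pp \<in> borel_measurable borel" if "k < 4" for k pp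
      using measurable_Pair2[OF \<Phi>_m[OF that], of pp] by simp
    have \<Phi>_supp: "\<Phi> k pp (\<xi>, \<eta>) = 0" if "norm \<xi> > 2 * r \<or> norm \<eta> > 2 * r" for k pp \<xi> \<eta>
      using that norm_ge_zero[of \<xi>] norm_ge_zero[of \<eta>] by (auto simp: \<Phi>_def shell_def simp del: norm_ge_zero)
    have \<Phi>_bd: "norm (\<Phi> k pp z) \<le> L * L' * B" if "k < 4" "pp \<in> sq" for k pp z
    proof (cases "z \<in> shell r")
      case True
      then have "norm (K k pp z) \<le> B" using Kb[OF that, of "fst z" "snd z"] by (simp add: shell_def)
      then show ?thesis using True L L0 by (auto simp: \<Phi>_def norm_mult intro!: mult_mono)
    qed (use L0 B in \<open>auto simp: \<Phi>_def\<close>)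
    have \<Phi>_dom: "norm (\<Phi> k pp (\<xi>, \<eta>)) \<le> (\<alpha> * \<alpha>' * B) * norm (p \<xi>) * norm (q \<eta>)" if "k < 4" "pp \<in> sq" for k pp \<xi> \<eta>
    proof (cases "(\<xi>, \<eta>) \<in> shell r")
      case True
      then have "norm (K k pp (\<xi>, \<eta>)) \<le> B" using Kb[OF that, of \<xi> \<eta>] by (simp add: shell_def)
      moreover have "norm (\<phi> \<xi>) \<le> \<alpha> * norm (p \<xi>)" "norm (\<psi> \<eta>) \<le> \<alpha>' * norm (q \<eta>)"
        using True norm_ge_zero[of \<xi>] norm_ge_zero[of \<eta>] unfolding shell_def by (auto intro!: dom simp del: norm_ge_zero)
      ultimately have "norm (\<phi> \<xi>) * norm (\<psi> \<eta>) * norm (K k pp (\<xi>, \<eta>)) \<le> (\<alpha> * norm (p \<xi>)) * (\<alpha>' * norm (q \<eta>)) * B"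
        using \<alpha> by (intro mult_mono) auto
      then show ?thesis using True by (simp add: \<Phi>_def norm_mult mult_ac)
    qed (use \<alpha> B in \<open>auto simp: \<Phi>_def\<close>)
    define S where "S k pp x = (LINT z|lborel. \<Phi> k pp z * e x z)" for k pp x
    have S_m: "(\<lambda>(pp, x). S k pp x) \<in> borel_measurable (borel \<Otimes>\<^sub>M borel)" if "k < 4" for k
    proof -
      have "(\<lambda>w. S k (fst w) (snd w)) \<in> borel_measurable (borel \<Otimes>\<^sub>M borel)"
        unfolding S_def
      proof (rule lborel.borel_measurable_lebesgue_integral)
        have 1: "(\<lambda>y. (\<lambda>w. \<Phi> k (fst w) (snd w)) (fst (fst y), snd y)) \<in> borel_measurable ((borel \<Otimes>\<^sub>M borel) \<Otimes>\<^sub>M lborel)"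
          by (rule measurable_compose[OF _ \<Phi>_m[OF that]]) measurable
        have 2: "(\<lambda>y. (\<lambda>w. e (fst w) (snd w)) (snd (fst y), snd y)) \<in> borel_measurable ((borel \<Otimes>\<^sub>M borel) \<Otimes>\<^sub>M lborel)"
          by (rule measurable_compose[OF _ e_m]) measurable
        show "(\<lambda>(w, z). \<Phi> k (fst w) z * e (snd w) z) \<in> borel_measurable ((borel \<Otimes>\<^sub>M borel) \<Otimes>\<^sub>M lborel)"
          using borel_measurable_times[OF 1 2] by (simp add: split_beta')
      qed
      then show ?thesis by (simp add: split_beta')
    qed
    define V where "V = ennreal ((\<alpha> * \<alpha>' * B)\<^sup>2) * emeasure lborel (cball (0::'a) (2 * r)) *
           (\<integral>\<^sup>+\<xi>. (ennreal (norm (p \<xi>)))\<^sup>2 \<partial>lborel) * (\<integral>\<^sup>+\<eta>. (ennreal (norm (q \<eta>)))\<^sup>2 \<partial>lborel)"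
    have S_L2: "(\<integral>\<^sup>+x. (ennreal (norm (S k pp x)))\<^sup>2 \<partial>lborel) \<le> V" if "k < 4" "pp \<in> sq" for k pp
    proof -
      have "S k pp x = (LINT (\<xi>, \<eta>)|lborel. \<Phi> k pp (\<xi>, \<eta>) * exp (2 * of_real pi * \<i> * of_real (x \<bullet> (\<xi> + \<eta>))))" for x
        unfolding S_def e_def by (simp add: split_beta')
      then show ?thesis unfolding V_def
        using L2_bound_bilinear[OF \<Phi>_m1[OF that(1)] meas(3,4) \<Phi>_bd[OF that] \<Phi>_supp \<Phi>_dom[OF that]] \<alpha> B by simp
    qed
    \<comment> \<open>Integration over all of \<open>sq\<close> instead of \<open>X k\<close>
      removes the dependence on \<tau>1 and \<tau>2.\<close>
    define Q where "Q x = (\<Sum>k<4::nat. \<integral>\<^sup>+pp. indicator sq pp * ennreal (norm (S k pp x)) \<partial>lborel)" for x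
    have Sn_m: "(\<lambda>(pp, x). ennreal (norm (S k pp x))) \<in> borel_measurable (borel \<Otimes>\<^sub>M borel)" if "k < 4" for k
      using S_m[OF that] unfolding split_beta' by measurable
    have avg_m: "(\<lambda>x. \<integral>\<^sup>+pp. indicator sq pp * ennreal (norm (S k pp x)) \<partial>lborel) \<in> borel_measurable borel" if "k < 4" for k
    proof (rule lborel.borel_measurable_nn_integral)
      have "(\<lambda>y. (\<lambda>(pp, x). ennreal (norm (S k pp x))) (snd y, fst y)) \<in> borel_measurable (borel \<Otimes>\<^sub>M lborel)"
        by (rule measurable_compose[OF _ Sn_m[OF that]]) measurable
      then have [measurable]: "(\<lambda>y. ennreal (norm (S k (snd y) (fst y)))) \<in> borel_measurable (borel \<Otimes>\<^sub>M lborel)"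
        by simp
      show "(\<lambda>(x, pp). indicator sq pp * ennreal (norm (S k pp x))) \<in> borel_measurable (borel \<Otimes>\<^sub>M lborel)"
        unfolding split_beta' by measurable
    qed
    have Q_m: "Q \<in> borel_measurable borel"
      unfolding Q_def by (rule borel_measurable_sum) (use avg_m in auto)
    \<comment> \<open>One factor 4 is Cauchy-Schwarz over the four kernels, the other their number;
      together they give the 16.\<close>
    have QL2: "(\<integral>\<^sup>+x. (Q x)\<^sup>2 \<partial>lborel) \<le> 16 * V"
    proof -
      have "(\<integral>\<^sup>+x. (Q x)\<^sup>2 \<partial>lborel) \<le> (\<integral>\<^sup>+x. 4 * (\<Sum>k<4::nat. (\<integral>\<^sup>+pp. indicator sq pp * ennreal (norm (S k pp x)) \<partial>lborel)\<^sup>2) \<partial>lborel)"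
        unfolding Q_def using ennreal_sum_power2_le[of "{..<4::nat}"] by (intro nn_integral_mono) simp
      also have "\<dots> = 4 * (\<Sum>k<4::nat. (\<integral>\<^sup>+x. (\<integral>\<^sup>+pp. indicator sq pp * ennreal (norm (S k pp x)) \<partial>lborel)\<^sup>2 \<partial>lborel))"
        using avg_m by (subst nn_integral_cmult, (subst nn_integral_sum)?)
          (auto intro!: borel_measurable_sum borel_measurable_power_ennreal nn_integral_sum arg_cong[where f="(*) 4"])
      also have "\<dots> \<le> 4 * (\<Sum>k<4::nat. V)"
        by (intro mult_left_mono sum_mono nn_integral_average_power2_le Sn_m S_L2) (auto simp: sq1)
      also have "\<dots> = 16 * V" by (simp flip: mult.assoc)
      finally show ?thesis .
    qed
    have Qsup: "ennreal (norm (LINT z|lborel. indicator (shell r) z *\<^sub>R (\<phi> (fst z) * \<psi> (snd z) *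
             m ((c1 + \<tau>1 / r) *\<^sub>R fst z, (c2 + \<tau>2 / r) *\<^sub>R snd z) *
             exp (2 * of_real pi * \<i> * of_real (x \<bullet> (fst z + snd z)))))) \<le> Q x"
      if \<tau>: "\<tau>1 \<in> {0..1}" "\<tau>2 \<in> {0..1}" for \<tau>1 \<tau>2 x
    proof -
      obtain X where X: "\<And>k. k < 4 \<Longrightarrow> compact (X k)" "\<And>k. k < 4 \<Longrightarrow> X k \<subseteq> sq"
        and m_eq: "\<And>\<xi> \<eta>. m ((c1 + \<tau>1 / r) *\<^sub>R \<xi>, (c2 + \<tau>2 / r) *\<^sub>R \<eta>) =
               (\<Sum>k<4. (LINT p|lborel. indicator (X k) p *\<^sub>R K k p (\<xi>, \<eta>)))"
        using Kr[OF \<tau>] by blast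
      have X_m: "X k \<in> sets borel" if "k < 4" for k
        using X(1)[OF that] by (simp add: borel_closed compact_imp_closed)
      \<comment> \<open>The radius 4r + 2 combines |\<xi>|, |\<eta>| \<le> 2r on the shell with norm
        at most 2 on the unit square.\<close>
      have int: "integrable (lborel \<Otimes>\<^sub>M lborel) (\<lambda>(z, pp). indicator (X k) pp *\<^sub>R (\<Phi> k pp z * e x z))" if k: "k < 4" for k
        unfolding lborel_prod
      proof (rule integrable_bounded_support[where K="L * L' * B" and R="4 * r + 2"])
        have "(\<lambda>y. (\<lambda>w. \<Phi> k (fst w) (snd w)) (snd y, fst y)) \<in> borel_measurable (borel \<Otimes>\<^sub>M borel)"
          by (rule measurable_compose[OF _ \<Phi>_m[OF k]]) measurable
        moreover have "(\<lambda>y. e x (fst y)) \<in> borel_measurable (borel \<Otimes>\<^sub>M borel)"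
          by (rule measurable_compose[OF measurable_fst]) measurable
        moreover have "(\<lambda>y. indicator (X k) (snd y) :: real) \<in> borel_measurable (borel \<Otimes>\<^sub>M borel)"
          by (rule measurable_compose[OF measurable_snd]) (use X_m[OF k] in simp)
        ultimately have "(\<lambda>y. indicator (X k) (snd y) *\<^sub>R (\<Phi> k (snd y) (fst y) * e x (fst y))) \<in> borel_measurable (borel \<Otimes>\<^sub>M borel)"
          by (intro borel_measurable_scaleR borel_measurable_times) (simp_all only: fst_conv snd_conv)
        then show "(\<lambda>(z, pp). indicator (X k) pp *\<^sub>R (\<Phi> k pp z * e x z)) \<in> borel_measurable borel"
          unfolding split_beta' borel_prod .
        show "norm (case w of (z, pp) \<Rightarrow> indicator (X k) pp *\<^sub>R (\<Phi> k pp z * e x z)) \<le> L * L' * B" for w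
          using X(2)[OF k] \<Phi>_bd[OF k] L0 B by (cases w) (auto simp: norm_mult e1 indicator_def)
        show "(case w of (z, pp) \<Rightarrow> indicator (X k) pp *\<^sub>R (\<Phi> k pp z * e x z)) = 0" if w: "4 * r + 2 < norm w" for w
        proof -
          obtain \<xi> \<eta> u v where w': "w = ((\<xi>, \<eta>), (u, v))" by (metis surj_pair)
          show ?thesis
          proof (cases "(u, v) \<in> X k")
            case True
            then have "(u, v) \<in> sq" using X(2)[OF k] by blast
            then have "norm u + norm v \<le> 2" by (auto simp: sq_def)
            then have "norm (u, v) \<le> 2" using norm_Pair_le[of u v] by linarith
            then have "norm (\<xi>, \<eta>) > 4 * r" using w norm_Pair_le[of "(\<xi>, \<eta>)" "(u, v)"] unfolding w' by linarith
            then have "norm \<xi> > 2 * r \<or> norm \<eta> > 2 * r" using norm_Pair_le[of \<xi> \<eta>] by linarith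
            then show ?thesis using \<Phi>_supp by (simp add: w')
          qed (simp add: w')
        qed
      qed
      \<comment> \<open>With m replaced by its representation, Fubini moves the frequency integral
        inside and produces \<open>S k pp x\<close>, to which the fixed-multiplier bound
        applies.\<close>
      have "(LINT z|lborel. indicator (shell r) z *\<^sub>R (\<phi> (fst z) * \<psi> (snd z) *
             m ((c1 + \<tau>1 / r) *\<^sub>R fst z, (c2 + \<tau>2 / r) *\<^sub>R snd z) *
             exp (2 * of_real pi * \<i> * of_real (x \<bullet> (fst z + snd z))))) =
          (LINT z|lborel. (\<Sum>k<4::nat. (LINT pp|lborel. indicator (X k) pp *\<^sub>R (\<Phi> k pp z * e x z))))"
      proof (rule Bochner_Integration.integral_cong[OF refl])
        fix z :: "'a \<times> 'a"
        have "(LINT pp|lborel. indicator (X k) pp *\<^sub>R (\<Phi> k pp z * e x z)) =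
          indicator (shell r) z *\<^sub>R (\<phi> (fst z) * \<psi> (snd z) * e x z) * (LINT pp|lborel. indicator (X k) pp *\<^sub>R K k pp z)" for k
          unfolding integral_mult_right_zero[symmetric]
          by (rule Bochner_Integration.integral_cong[OF refl]) (simp add: \<Phi>_def scaleR_conv_of_real mult_ac)
        then have eq: "(\<Sum>k<4::nat. (LINT pp|lborel. indicator (X k) pp *\<^sub>R (\<Phi> k pp z * e x z))) =
            indicator (shell r) z *\<^sub>R (\<phi> (fst z) * \<psi> (snd z) * e x z) * (\<Sum>k<4::nat. (LINT pp|lborel. indicator (X k) pp *\<^sub>R K k pp z))"
          by (simp only: sum_distrib_left)
        have m_eq': "m ((c1 + \<tau>1 / r) *\<^sub>R fst z, (c2 + \<tau>2 / r) *\<^sub>R snd z) = (\<Sum>k<4::nat. (LINT pp|lborel. indicator (X k) pp *\<^sub>R K k pp z))"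
          using m_eq[of "fst z" "snd z"] by simp
        show "indicator (shell r) z *\<^sub>R (\<phi> (fst z) * \<psi> (snd z) *
             m ((c1 + \<tau>1 / r) *\<^sub>R fst z, (c2 + \<tau>2 / r) *\<^sub>R snd z) *
             exp (2 * of_real pi * \<i> * of_real (x \<bullet> (fst z + snd z)))) = (\<Sum>k<4::nat. (LINT pp|lborel. indicator (X k) pp *\<^sub>R (\<Phi> k pp z * e x z)))"
          unfolding eq m_eq' by (simp only: e_def scaleR_conv_of_real mult_ac)
      qed
      also have "\<dots> = (\<Sum>k<4::nat. (LINT z|lborel. (LINT pp|lborel. indicator (X k) pp *\<^sub>R (\<Phi> k pp z * e x z))))"
        by (rule Bochner_Integration.integral_sum) (use lborel_pair.integrable_fst[OF int] in auto)
      also have "\<dots> = (\<Sum>k<4::nat. (LINT pp|lborel. indicator (X k) pp *\<^sub>R S k pp x))"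
        unfolding S_def integral_scaleR_right[symmetric]
        by (intro sum.cong refl lborel_pair.Fubini_integral[symmetric] int) auto
      finally have "ennreal (norm (LINT z|lborel. indicator (shell r) z *\<^sub>R (\<phi> (fst z) * \<psi> (snd z) *
             m ((c1 + \<tau>1 / r) *\<^sub>R fst z, (c2 + \<tau>2 / r) *\<^sub>R snd z) *
             exp (2 * of_real pi * \<i> * of_real (x \<bullet> (fst z + snd z)))))) =
          ennreal (norm (\<Sum>k<4::nat. (LINT pp|lborel. indicator (X k) pp *\<^sub>R S k pp x)))" by simp
      also have "\<dots> \<le> ennreal (\<Sum>k<4::nat. norm (LINT pp|lborel. indicator (X k) pp *\<^sub>R S k pp x))"
        by (intro ennreal_leI norm_sum)
      also have "\<dots> = (\<Sum>k<4::nat. ennreal (norm (LINT pp|lborel. indicator (X k) pp *\<^sub>R S k pp x)))"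
        by (simp add: sum_ennreal)
      also have "\<dots> \<le> Q x"
        unfolding Q_def
      proof (rule sum_mono)
        fix k :: nat assume "k \<in> {..<4}"
        then have k: "k < 4" by simp
        have "ennreal (norm (LINT pp|lborel. indicator (X k) pp *\<^sub>R S k pp x)) \<le> (\<integral>\<^sup>+pp. ennreal (norm (indicator (X k) pp *\<^sub>R S k pp x)) \<partial>lborel)"
          by (rule norm_integral_le_nn_integral)
        also have "\<dots> \<le> (\<integral>\<^sup>+pp. indicator sq pp * ennreal (norm (S k pp x)) \<partial>lborel)"
          using X(2)[OF k] by (intro nn_integral_mono) (auto simp: indicator_def)
        finally show "ennreal (norm (LINT pp|lborel. indicator (X k) pp *\<^sub>R S k pp x)) \<le> (\<integral>\<^sup>+pp. indicator sq pp * ennreal (norm (S k pp x)) \<partial>lborel)" .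
      qed
      finally show ?thesis .
    qed
    show "\<exists>Q :: 'a \<Rightarrow> ennreal. Q \<in> borel_measurable borel \<and>
        (\<forall>\<tau>1\<in>{0..1}. \<forall>\<tau>2\<in>{0..1}. \<forall>x.
          ennreal (norm (LINT z|lborel. indicator (shell r) z *\<^sub>R (\<phi> (fst z) * \<psi> (snd z) *
             m ((c1 + \<tau>1 / r) *\<^sub>R fst z, (c2 + \<tau>2 / r) *\<^sub>R snd z) *
             exp (2 * of_real pi * \<i> * of_real (x \<bullet> (fst z + snd z)))))) \<le> Q x) \<and>
        (\<integral>\<^sup>+x. (Q x)\<^sup>2 \<partial>lborel) \<le> 16 * (ennreal ((\<alpha> * \<alpha>' * (C * r powr (- a)))\<^sup>2) * emeasure lborel (cball (0::'a) (2 * r)) *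
           (\<integral>\<^sup>+\<xi>. (ennreal (norm (p \<xi>)))\<^sup>2 \<partial>lborel) * (\<integral>\<^sup>+\<eta>. (ennreal (norm (q \<eta>)))\<^sup>2 \<partial>lborel))"
      by (rule exI[of _ Q]) (use Q_m QL2 Qsup in \<open>auto simp: V_def B_def\<close>)
  qed
qed

section \<open>Test functions and their differences\<close>

lemma test_function_continuous: "test_function f \<Longrightarrow> continuous_on UNIV f"
  unfolding test_function_def by (metis C_class.simps(1))

lemma test_function_bounded_support:
  fixes f :: "'a::euclidean_space \<Rightarrow> complex"
  assumes "test_function f"
  obtains K R where "\<And>x. norm (f x) \<le> K" and "\<And>x. norm x > R \<Longrightarrow> f x = 0"
proof -
  define S where "S = closure {x. f x \<noteq> 0}"
  have S: "compact S" using assms by (simp add: S_def test_function_def)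
  have "bounded (f ` S)"
    by (intro compact_imp_bounded compact_continuous_image continuous_on_subset[OF test_function_continuous[OF assms]] S) simp
  then obtain K where K: "\<And>x. x \<in> S \<Longrightarrow> norm (f x) \<le> K" unfolding bounded_iff by auto
  obtain R where R: "\<And>x. x \<in> S \<Longrightarrow> norm x \<le> R" using compact_imp_bounded[OF S] unfolding bounded_iff by auto
  have out: "f x = 0" if "x \<notin> S" for x
    using that closure_subset[of "{x. f x \<noteq> 0}"] by (auto simp: S_def)
  show ?thesis
  proof
    show "norm (f x) \<le> max K 0" for x using K[of x] out[of x] by (cases "x \<in> S") auto
    show "f x = 0" if "norm x > R" for x using R[of x] out[of x] that by (cases "x \<in> S") auto
  qed
qed

lemma test_function_integrable:
  fixes f :: "'a::euclidean_space \<Rightarrow> complex"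
  assumes f: "test_function f"
  shows "integrable lborel f"
proof -
  obtain K R where "\<And>x. norm (f x) \<le> K" "\<And>x. norm x > R \<Longrightarrow> f x = 0"
    using test_function_bounded_support[OF f] by metis
  then show ?thesis
    by (intro integrable_bounded_support borel_measurable_continuous_onI test_function_continuous f)
qed

lemma test_function_L2_finite:
  fixes f :: "'a::euclidean_space \<Rightarrow> complex"
  assumes f: "test_function f"
  shows "(\<integral>\<^sup>+x. (ennreal (norm (f x)))\<^sup>2 \<partial>lborel) < \<infinity>"
proof -
  obtain K R where K: "\<And>x. norm (f x) \<le> K" "\<And>x. norm x > R \<Longrightarrow> f x = 0"
    using test_function_bounded_support[OF f] by metis
  have [measurable]: "f \<in> borel_measurable borel"
    by (intro borel_measurable_continuous_onI test_function_continuous f)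
  have "integrable lborel (\<lambda>x. (norm (f x))\<^sup>2)"
  proof (rule integrable_bounded_support)
    show "norm ((norm (f x))\<^sup>2) \<le> K\<^sup>2" for x using K(1)[of x] by (simp add: power_mono)
    show "(norm (f x))\<^sup>2 = 0" if "norm x > R" for x using K(2)[OF that] by simp
  qed measurable
  then have "(\<integral>\<^sup>+x. ennreal ((norm (f x))\<^sup>2) \<partial>lborel) < \<infinity>"
    by (simp add: nn_integral_eq_integral)
  then show ?thesis by (simp add: ennreal_power)
qed

lemma integrable_translate:
  fixes f :: "'a::euclidean_space \<Rightarrow> complex"
  assumes f: "integrable lborel f"
  shows "integrable lborel (translate h f)"
proof -
  have [measurable]: "f \<in> borel_measurable borel" using f by (auto dest: borel_measurable_integrable)
  have "integrable (distr lborel borel ((+) (- h))) f" using f by (simp add: lborel_distr_plus)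
  then show ?thesis by (simp add: integrable_distr_eq translate_def[abs_def])
qed

section \<open>Translation as modulation on the Fourier side\<close>

lemma fourier_diff_translate:
  fixes f :: "'a::euclidean_space \<Rightarrow> complex"
  assumes f: "integrable lborel f"
  shows "fourier (\<lambda>x. f x - translate h f x) \<xi> =
    (1 - exp (- (2 * complex_of_real pi * \<i> * complex_of_real (h \<bullet> \<xi>)))) * fourier f \<xi>"
proof -
  have [measurable]: "f \<in> borel_measurable borel" using f by (auto dest: borel_measurable_integrable)
  let ?e = "\<lambda>x. exp (- (2 * complex_of_real pi * \<i> * complex_of_real (x \<bullet> \<xi>)))"
  have "(LINT x|lborel. translate h f x * ?e x) = (LINT x|lborel. (\<lambda>y. f y * (?e h * ?e y)) (x - h))"
    by (intro Bochner_Integration.integral_cong refl)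
       (simp add: translate_def mult_exp_exp inner_diff_left algebra_simps)
  also have "\<dots> = (LINT y|lborel. f y * (?e h * ?e y))"
    by (rule integral_lborel_translate) measurable
  also have "\<dots> = (LINT y|lborel. ?e h * (f y * ?e y))" by (simp add: mult_ac)
  finally have "(LINT x|lborel. translate h f x * ?e x) = ?e h * (LINT y|lborel. f y * ?e y)"
    by simp
  moreover have "(LINT x|lborel. (f x - translate h f x) * ?e x) =
      (LINT x|lborel. f x * ?e x) - (LINT x|lborel. translate h f x * ?e x)"
    unfolding left_diff_distrib
    by (intro Bochner_Integration.integral_diff integrable_phase f integrable_translate)
  ultimately show ?thesis by (simp add: fourier_def left_diff_distrib)
qed

text \<open>Interpolates between the bounds |\<theta>| and 2 for |exp(i \<theta>) - 1|: for
  |\<theta>| \<le> 1 the first is at most |\<theta>|^\<gamma> because \<gamma> \<le> 1, otherwise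
  |\<theta>|^\<gamma> \<ge> 1 and the second suffices. The constant is 2 times 2 pi, with (2
  pi)^\<gamma> \<le> 2 pi.\<close>

lemma norm_one_minus_phase_le:
  fixes t :: real
  assumes \<gamma>: "0 < \<gamma>" "\<gamma> \<le> 1"
  shows "norm (1 - exp (- (2 * complex_of_real pi * \<i> * complex_of_real t))) \<le> 4 * pi * \<bar>t\<bar> powr \<gamma>"
proof -
  define \<theta> where "\<theta> = - (2 * pi * t)"
  have "norm (1 - exp (- (2 * complex_of_real pi * \<i> * complex_of_real t))) = norm (exp (\<i> * complex_of_real \<theta>) - 1)"
    by (subst norm_minus_commute) (simp add: \<theta>_def mult_ac)
  also have "\<dots> \<le> 2 * \<bar>\<theta>\<bar> powr \<gamma>"
  proof (cases "\<bar>\<theta>\<bar> \<le> 1")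
    case True
    have "2 * \<bar>sin (\<theta> / 2)\<bar> \<le> \<bar>\<theta>\<bar>" using abs_sin_x_le_abs_x[of "\<theta> / 2"] by simp
    also have "\<bar>\<theta>\<bar> = \<bar>\<theta>\<bar> powr 1" by simp
    also have "\<dots> \<le> \<bar>\<theta>\<bar> powr \<gamma>" using True \<gamma> by (intro powr_mono') auto
    also have "\<dots> \<le> 2 * \<bar>\<theta>\<bar> powr \<gamma>" by simp
    finally show ?thesis by (simp only: dist_exp_i_1)
  next
    case False
    then have "1 \<le> \<bar>\<theta>\<bar> powr \<gamma>" using \<gamma> by (intro ge_one_powr_ge_zero) auto
    moreover have "2 * \<bar>sin (\<theta> / 2)\<bar> \<le> 2" by simp
    ultimately show ?thesis unfolding dist_exp_i_1 by linarith
  qed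
  also have "\<bar>\<theta>\<bar> powr \<gamma> = (2 * pi) powr \<gamma> * \<bar>t\<bar> powr \<gamma>"
    by (simp add: \<theta>_def abs_mult powr_mult)
  also have "(2 * pi) powr \<gamma> \<le> (2 * pi) powr 1"
    using \<gamma> pi_gt3 by (intro powr_mono) auto
  finally show ?thesis
    by (simp add: mult_right_mono)
qed

text \<open>The weight uses 1 + |\<xi>| in place of |\<xi>|: being at least 1, it also dominates the
  undifferenced function, so both kinds of input have the same form.\<close>

lemma norm_fourier_diff_translate_le:
  fixes f :: "'a::euclidean_space \<Rightarrow> complex"
  assumes f: "integrable lborel f" and \<gamma>: "0 < \<gamma>" "\<gamma> \<le> 1"
  shows "norm (fourier (\<lambda>x. f x - translate h f x) \<xi>) \<le>
    (4 * pi * norm h powr \<gamma>) * (1 + norm \<xi>) powr \<gamma> * norm (fourier f \<xi>)"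
proof -
  have "\<bar>h \<bullet> \<xi>\<bar> powr \<gamma> \<le> (norm h * (1 + norm \<xi>)) powr \<gamma>"
    using \<gamma> Cauchy_Schwarz_ineq2[of h \<xi>] by (intro powr_mono2) (auto simp: algebra_simps intro: order_trans)
  also have "\<dots> = norm h powr \<gamma> * (1 + norm \<xi>) powr \<gamma>" by (simp add: powr_mult)
  finally have "norm (1 - exp (- (2 * complex_of_real pi * \<i> * complex_of_real (h \<bullet> \<xi>)))) \<le>
      (4 * pi * norm h powr \<gamma>) * (1 + norm \<xi>) powr \<gamma>"
    using norm_one_minus_phase_le[OF \<gamma>, of "h \<bullet> \<xi>"] by (auto simp: mult.assoc intro: order_trans)
  then show ?thesis
    unfolding fourier_diff_translate[OF f] norm_mult by (rule mult_right_mono) simp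
qed

section \<open>Minkowski dimension\<close>

text \<open>A \<open>LEAST\<close> carries information only if some witness exists; the grid of step
  \<delta> starting at 1 is a finite cover of the interval [1,2].\<close>

lemma covering_number_witness:
  assumes E: "E \<subseteq> {1..2}" and \<delta>: "\<delta> > 0"
  obtains A where "finite A" "card A = covering_number E \<delta>" "E \<subseteq> (\<Union>a\<in>A. {a..a + \<delta>})"
proof -
  define A where "A = (\<lambda>k. 1 + real k * \<delta>) ` {..nat \<lfloor>1 / \<delta>\<rfloor>}"
  have "t \<in> (\<Union>a\<in>A. {a..a + \<delta>})" if "t \<in> E" for t
  proof -
    have t: "1 \<le> t" "t \<le> 2" using that E by auto
    define k where "k = nat \<lfloor>(t - 1) / \<delta>\<rfloor>"
    have "(t - 1) / \<delta> \<le> 1 / \<delta>" using t \<delta> by (intro divide_right_mono) auto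
    then have "k \<in> {..nat \<lfloor>1 / \<delta>\<rfloor>}" unfolding k_def by (auto intro!: nat_mono floor_mono)
    moreover have k: "real k = of_int \<lfloor>(t - 1) / \<delta>\<rfloor>" using t \<delta> by (simp add: k_def)
    have "real k \<le> (t - 1) / \<delta>" "(t - 1) / \<delta> \<le> real k + 1" unfolding k by linarith+
    then have "1 + real k * \<delta> \<le> t" "t \<le> 1 + real k * \<delta> + \<delta>" using \<delta> by (auto simp: field_simps)
    ultimately show ?thesis unfolding A_def by auto
  qed
  then have "\<exists>n A. finite A \<and> card A = n \<and> E \<subseteq> (\<Union>a\<in>A. {a..a + \<delta>})"
    by (intro exI[of _ "card A"] exI[of _ A]) (auto simp: A_def)
  from LeastI_ex[OF this] show ?thesis
    using that unfolding covering_number_def[symmetric] by blast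
qed

text \<open>The limsup, read along the scales 2^-j, gives the power bound for all large j; the
  finitely many remaining scales are absorbed into N.\<close>

lemma minkowski_dim_covering_bound:
  assumes dim: "upper_minkowski_dim E = ereal \<beta>" and s: "\<beta> < s"
  obtains N where "N > 0" "\<And>j::nat. real (covering_number E (1 / 2 ^ j)) \<le> N * 2 powr (real j * s)"
proof -
  let ?c = "\<lambda>j::nat. real (covering_number E (1 / 2 ^ j))"
  have "eventually (\<lambda>\<delta>. ereal (ln (real (covering_number E \<delta>)) / ln (1 / \<delta>)) < ereal s) (at_right 0)"
    using dim s unfolding upper_minkowski_dim_def by (intro Limsup_lessD) simp
  moreover have "filterlim (\<lambda>j::nat. 1 / 2 ^ j :: real) (at_right 0) sequentially"
    by real_asymp
  ultimately have "eventually (\<lambda>j::nat. ln (?c j) / ln (1 / (1 / 2 ^ j)) < s) sequentially"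
    unfolding filterlim_iff by auto
  then obtain j0 where j0: "\<And>j. j \<ge> j0 \<Longrightarrow> ln (?c j) / ln (1 / (1 / 2 ^ j)) < s"
    unfolding eventually_sequentially by auto
  \<comment> \<open>Starting at \<open>Suc j0\<close> keeps j positive, so that ln(2^j) > 0 and the
    quotient can be cleared.\<close>
  have big: "?c j \<le> 2 powr (real j * s)" if "j \<ge> Suc j0" for j
  proof (cases "?c j > 0")
    case True
    have "ln (1 / (1 / 2 ^ j) :: real) = real j * ln 2" by (simp add: ln_realpow)
    then have "ln (?c j) < s * (real j * ln 2)"
      using j0[of j] that by (simp add: pos_divide_less_eq)
    then have "exp (ln (?c j)) \<le> exp (s * (real j * ln 2))" by simp
    then show ?thesis using True by (simp add: powr_def mult_ac)
  qed simp
  \<comment> \<open>The sum handles every scale up to \<open>j0\<close>; the summand 1 makes N \<ge>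
    1, as the large scales require.\<close>
  define N where "N = 1 + (\<Sum>j<Suc j0. ?c j / 2 powr (real j * s))"
  show ?thesis
  proof
    show "N > 0" unfolding N_def by (intro add_pos_nonneg sum_nonneg) auto
    fix j :: nat
    show "?c j \<le> N * 2 powr (real j * s)"
    proof (cases "j < Suc j0")
      case True
      have "?c j / 2 powr (real j * s) \<le> (\<Sum>j<Suc j0. ?c j / 2 powr (real j * s))"
        using True by (intro member_le_sum) auto
      also have "\<dots> \<le> N" by (simp add: N_def)
      finally show ?thesis by (simp add: pos_divide_le_eq)
    next
      case False
      have "(\<Sum>j<Suc j0. ?c j / 2 powr (real j * s)) \<ge> 0" by (intro sum_nonneg) auto
      then have "N \<ge> 1" unfolding N_def by linarith
      then have "1 * 2 powr (real j * s) \<le> N * 2 powr (real j * s)" by (rule mult_right_mono) simp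
      then show ?thesis using big[of j] False by linarith
    qed
  qed
qed

text \<open>The shell estimate wants base points c \<ge> 1. Left endpoints below 1 are therefore
  moved to 1: no point of E is lost, intervals only shrink, and merging endpoints can only lower the
  count.\<close>

lemma minkowski_dim_grid:
  assumes E: "E \<subseteq> {1..2}" and dim: "upper_minkowski_dim E = ereal \<beta>" and s: "\<beta> < s"
  obtains N A where "N > 0" "\<And>j::nat. finite (A j)" "\<And>j. A j \<subseteq> {1..}"
    "\<And>j. real (card (A j)) \<le> N * 2 powr (real j * s)"
    "\<And>j t. t \<in> E \<Longrightarrow> \<exists>c\<in>A j. \<exists>\<tau>\<in>{0..1}. t = c + \<tau> / 2 ^ j"
proof -
  obtain N where N: "N > 0" "\<And>j::nat. real (covering_number E (1 / 2 ^ j)) \<le> N * 2 powr (real j * s)"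
    using minkowski_dim_covering_bound[OF dim s] by metis
  have "\<exists>A. finite A \<and> A \<subseteq> {1..} \<and> real (card A) \<le> N * 2 powr (real j * s) \<and> (\<forall>t\<in>E. \<exists>c\<in>A. \<exists>\<tau>\<in>{0..1}. t = c + \<tau> / 2 ^ j)" for j :: nat
  proof -
    have "(0::real) < 1 / 2 ^ j" by simp
    from covering_number_witness[OF E this] obtain A where A: "finite A" "card A = covering_number E (1 / 2 ^ j)"
      "E \<subseteq> (\<Union>a\<in>A. {a..a + 1 / 2 ^ j})" by metis
    have "\<exists>c\<in>max 1 ` A. \<exists>\<tau>\<in>{0..1}. t = c + \<tau> / 2 ^ j" if t: "t \<in> E" for t
    proof -
      obtain a where a: "a \<in> A" "a \<le> t" "t \<le> a + 1 / 2 ^ j" using A(3) t by force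
      have "1 \<le> t" using t E by auto
      then have "0 \<le> t - max 1 a" "t - max 1 a \<le> 1 / 2 ^ j" using a by (auto simp: max_def)
      then have "(t - max 1 a) * 2 ^ j \<in> {0..1}" by (simp add: pos_le_divide_eq)
      moreover have "t = max 1 a + ((t - max 1 a) * 2 ^ j) / 2 ^ j" by simp
      ultimately show ?thesis using a(1) by blast
    qed
    moreover have "real (card (max 1 ` A)) \<le> real (card A)" using A(1) by (simp add: card_image_le)
    ultimately show ?thesis
      using A N(2)[of j] by (intro exI[of _ "max 1 ` A"]) auto
  qed
  then obtain A where "\<And>j. finite (A j) \<and> A j \<subseteq> {1..} \<and> real (card (A j)) \<le> N * 2 powr (real j * s) \<and> (\<forall>t\<in>E. \<exists>c\<in>A j. \<exists>\<tau>\<in>{0..1}. t = c + \<tau> / 2 ^ j)"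
    by metis
  then show ?thesis using that[of N A] N(1) by blast
qed

section \<open>Summation over the shells\<close>

text \<open>\<open>L2_norm\<close> passes through \<open>enn2real\<close> and a real square root.
  Finiteness for f and g makes every quantity an honest real, the left side included, before roots
  are taken.\<close>

lemma L2_norm_le:
  fixes F :: "'a::euclidean_space \<Rightarrow> ennreal" and f g :: "'a \<Rightarrow> complex"
  assumes f: "(\<integral>\<^sup>+x. (ennreal (norm (f x)))\<^sup>2 \<partial>lborel) < \<infinity>" and g: "(\<integral>\<^sup>+x. (ennreal (norm (g x)))\<^sup>2 \<partial>lborel) < \<infinity>"
    and c: "c \<ge> 0"
    and le: "(\<integral>\<^sup>+x. (F x)\<^sup>2 \<partial>lborel) \<le> ennreal (c\<^sup>2) * (\<integral>\<^sup>+x. (ennreal (norm (f x)))\<^sup>2 \<partial>lborel) * (\<integral>\<^sup>+x. (ennreal (norm (g x)))\<^sup>2 \<partial>lborel)"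
  shows "L2_norm F \<le> ennreal c * L2_norm_fun f * L2_norm_fun g"
proof -
  obtain If where If: "If \<ge> 0" "(\<integral>\<^sup>+x. (ennreal (norm (f x)))\<^sup>2 \<partial>lborel) = ennreal If"
    using f by (auto simp: less_top_ennreal)
  obtain Ig where Ig: "Ig \<ge> 0" "(\<integral>\<^sup>+x. (ennreal (norm (g x)))\<^sup>2 \<partial>lborel) = ennreal Ig"
    using g by (auto simp: less_top_ennreal)
  have le': "(\<integral>\<^sup>+x. (F x)\<^sup>2 \<partial>lborel) \<le> ennreal (c\<^sup>2 * If * Ig)"
    using le If Ig by (simp add: ennreal_mult)
  then obtain I where I: "I \<ge> 0" "(\<integral>\<^sup>+x. (F x)\<^sup>2 \<partial>lborel) = ennreal I"
    by (metis ennreal_less_top le_less_trans less_top_ennreal)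
  have "I \<le> c\<^sup>2 * If * Ig" using le' I If Ig by (simp add: ennreal_le_iff)
  then have "sqrt I \<le> sqrt (c\<^sup>2 * If * Ig)" by simp
  also have "\<dots> = c * sqrt If * sqrt Ig" using c by (simp add: real_sqrt_mult)
  finally show ?thesis
    using I If Ig c by (simp add: L2_norm_def ennreal_mult[symmetric] ennreal_leI)
qed

lemma disjoint_shells: "i \<noteq> j \<Longrightarrow> shell (2 ^ i) \<inter> shell (2 ^ j) = {}"
proof (induction i j rule: linorder_wlog)
  case (le i j)
  then have "2 * 2 ^ i \<le> (2 ^ j :: real)"
    using power_increasing[of "Suc i" j "2::real"] by simp
  then show ?case unfolding shell_def by auto
qed (simp add: Int_commute)

lemma UN_shells: "(\<Union>j::nat. shell (2 ^ j)) = UNIV"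
proof -
  have "\<exists>j::nat. z \<in> shell (2 ^ j)" for z :: "'a::euclidean_space \<times> 'a"
  proof -
    define f where "f = 1 + norm (fst z) + norm (snd z)"
    have "\<exists>n::nat. f < 2 ^ n" by (rule real_arch_pow) simp
    then obtain n :: nat where n: "f < 2 ^ n" "\<And>k. k < n \<Longrightarrow> \<not> f < 2 ^ k"
      by (meson LeastI not_less_Least)
    \<comment> \<open>The least n with f < 2^n is not 0, so n = Suc j, and minimality gives 2^j
      \<le> f.\<close>
    have "f \<ge> 1" by (simp add: f_def)
    with n(1) have "n \<noteq> 0" by (auto intro: ccontr)
    then obtain j where "n = Suc j" by (metis not0_implies_Suc)
    then show ?thesis using n(1) n(2)[of j] by (intro exI[of _ j]) (simp add: shell_def f_def[symmetric])
  qed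
  then show ?thesis by auto
qed

lemma norm_suminf_le_ennreal:
  fixes f :: "nat \<Rightarrow> 'b::banach"
  shows "ennreal (norm (suminf f)) \<le> (\<Sum>j. ennreal (norm (f j)))"
proof (cases "(\<Sum>j. ennreal (norm (f j))) = top")
  case False
  then have s: "summable (\<lambda>j. norm (f j))" by (intro summable_suminf_not_top) auto
  then have "norm (suminf f) \<le> (\<Sum>j. norm (f j))" by (rule summable_norm)
  then show ?thesis using s by (simp add: suminf_ennreal2 ennreal_leI)
qed simp

text \<open>If \<open>F\<close> is not integrable, its integral is \<open>0\<close> by convention and the bound is trivial, so
  that no integrability of the symbols has to be established.\<close>

lemma norm_integral_le_shells:
  fixes F :: "'a::euclidean_space \<times> 'a \<Rightarrow> complex"
  shows "ennreal (norm (LINT z|lborel. F z)) \<le> (\<Sum>j::nat. ennreal (norm (LINT z|lborel. indicator (shell (2 ^ j)) z *\<^sub>R F z)))"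
proof (cases "integrable lborel F")
  case True
  have "(LINT z:(\<Union>j::nat. shell (2 ^ j))|lborel. F z) = (\<Sum>j::nat. (LINT z:shell (2 ^ j)|lborel. F z))"
    by (rule lebesgue_integral_countable_add) (use True in \<open>auto simp: disjoint_shells UN_shells set_integrable_def\<close>)
  then have "(LINT z|lborel. F z) = (\<Sum>j::nat. (LINT z|lborel. indicator (shell (2 ^ j)) z *\<^sub>R F z))"
    by (simp add: UN_shells set_lebesgue_integral_def)
  then show ?thesis using norm_suminf_le_ennreal by simp
qed (simp add: not_integrable_integral_eq)

text \<open>The grid points are summed at the level of squares, so a square must be moved inside the
  sum over shells. Splitting off 2^(-\<rho> j / 2) costs 2^(\<rho> j) per squared term, affordable
  because those terms decay exponentially.\<close>

lemma suminf_power2_le_weighted: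
  fixes b :: "nat \<Rightarrow> ennreal"
  assumes \<rho>: "\<rho> > 0"
  shows "(\<Sum>j. b j)\<^sup>2 \<le> (\<Sum>j. ennreal (2 powr (- (\<rho> * real j)))) * (\<Sum>j. ennreal (2 powr (\<rho> * real j)) * (b j)\<^sup>2)"
proof -
  let ?s = "\<lambda>j. 2 powr (\<rho> * real j / 2) :: real"
  have "(\<Sum>j. b j) = (\<Sum>j. ennreal (inverse (?s j)) * (ennreal (?s j) * b j))"
    by (intro arg_cong[where f=suminf] ext) (simp add: mult.assoc[symmetric] ennreal_mult[symmetric])
  also have "\<dots>\<^sup>2 \<le> (\<Sum>j. (ennreal (inverse (?s j)))\<^sup>2) * (\<Sum>j. (ennreal (?s j) * b j)\<^sup>2)"
    using Cauchy_Schwarz_nn_integral[of "\<lambda>j. ennreal (inverse (?s j))" "count_space (UNIV :: nat set)" "\<lambda>j. ennreal (?s j) * b j"]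
    by (simp add: nn_integral_count_space_nat)
  also have "(\<lambda>j. (ennreal (inverse (?s j)))\<^sup>2) = (\<lambda>j. ennreal (2 powr (- (\<rho> * real j))))"
    by (intro ext) (simp add: ennreal_power powr_minus[symmetric] powr_power)
  also have "(\<lambda>j. (ennreal (?s j) * b j)\<^sup>2) = (\<lambda>j. ennreal (2 powr (\<rho> * real j)) * (b j)\<^sup>2)"
    by (intro ext) (simp add: power_mult_distrib ennreal_power powr_power)
  finally show ?thesis .
qed

lemma summable_powr_neg:
  assumes \<rho>: "\<rho> > 0"
  shows "summable (\<lambda>j. 2 powr (- (\<rho> * real j)) :: real)"
proof -
  have "(2::real) powr (- \<rho>) < 2 powr 0" using \<rho> by (intro powr_less_mono) auto
  then have "summable (\<lambda>j. (2 powr (- \<rho>)) ^ j :: real)" by (intro summable_geometric) auto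
  then show ?thesis by (simp add: powr_power mult.commute)
qed

text \<open>For finite Z the comparison is made with the square root of Z, which bounds each b i and
  hence the supremum; for infinite Z it is trivial.\<close>

lemma SUP_power2_le:
  fixes b :: "'i \<Rightarrow> ennreal"
  assumes "\<And>i. i \<in> I \<Longrightarrow> (b i)\<^sup>2 \<le> Z"
  shows "(SUP i\<in>I. b i)\<^sup>2 \<le> Z"
proof (cases Z)
  case (real z)
  have "b i \<le> ennreal (sqrt z)" if "i \<in> I" for i
  proof -
    have le: "(b i)\<^sup>2 \<le> ennreal z" using assms[OF that] real by simp
    show ?thesis
    proof (cases "b i")
      case (real y)
      then have "y\<^sup>2 \<le> z" using le \<open>z \<ge> 0\<close> by (simp add: ennreal_power)
      then show ?thesis using real by (simp add: ennreal_leI real_le_rsqrt)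
    next
      case top
      then show ?thesis using le by (simp add: ennreal_top_eq_mult_iff power2_eq_square top_unique)
    qed
  qed
  then have "(SUP i\<in>I. b i) \<le> ennreal (sqrt z)" by (intro SUP_least)
  then have "(SUP i\<in>I. b i)\<^sup>2 \<le> (ennreal (sqrt z))\<^sup>2" by (rule power_mono) simp
  then show ?thesis using real by (simp add: ennreal_power)
qed simp

text \<open>The common source of all estimates: u and v enter only through the domination of their
  Fourier transforms, so each may be a difference or the function itself, and the factors A, A'
  carry the powers of |h|.\<close>

lemma maximal_op_L2_bound:
  fixes m :: "'a::euclidean_space \<times> 'a \<Rightarrow> complex" and a \<beta>1 \<beta>2 :: real
  assumes adm: "admissible a 2 m"
    and E: "E1 \<subseteq> {1..2}" "E2 \<subseteq> {1..2}"
    and dim: "upper_minkowski_dim E1 = ereal \<beta>1" "upper_minkowski_dim E2 = ereal \<beta>2"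
    and gap: "2 * a > real DIM('a) + \<beta>1 + \<beta>2"
  obtains D \<gamma> where "D > 0" "0 < \<gamma>" "\<gamma> \<le> 1"
    "\<And>u v f g A A'. \<lbrakk>integrable lborel u; integrable lborel v; integrable lborel f; integrable lborel g;
       A \<ge> 0; A' \<ge> 0;
       \<And>\<xi>. norm (fourier u \<xi>) \<le> A * (1 + norm \<xi>) powr \<gamma> * norm (fourier f \<xi>);
       \<And>\<eta>. norm (fourier v \<eta>) \<le> A' * (1 + norm \<eta>) powr \<gamma> * norm (fourier g \<eta>)\<rbrakk> \<Longrightarrow>
      (\<integral>\<^sup>+x. (maximal_op m E1 E2 u v x)\<^sup>2 \<partial>lborel) \<le>
        ennreal (D * (A * A')\<^sup>2) * (\<integral>\<^sup>+x. (ennreal (norm (f x)))\<^sup>2 \<partial>lborel) * (\<integral>\<^sup>+x. (ennreal (norm (g x)))\<^sup>2 \<partial>lborel)"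
proof -
  let ?d = "real DIM('a)"
  \<comment> \<open>The gap \<kappa> is spent in quarters: one on the covering exponents (\<kappa>/8
    each), one on the frequency loss 4 \<gamma>, one on the Cauchy-Schwarz weight \<rho>; the last
    remains as decay in j. The 4 in 4 \<gamma> comes from squaring a product of two losses, and
    \<gamma> \<le> 1 is required by the phase bound.\<close>
  define \<kappa> where "\<kappa> = 2 * a - ?d - \<beta>1 - \<beta>2"
  have \<kappa>: "\<kappa> > 0" using gap by (simp add: \<kappa>_def)
  define \<gamma> where "\<gamma> = min 1 (\<kappa> / 16)"
  have \<gamma>: "0 < \<gamma>" "\<gamma> \<le> 1" "4 * \<gamma> \<le> \<kappa> / 4" using \<kappa> by (auto simp: \<gamma>_def)
  define \<rho> where "\<rho> = \<kappa> / 4"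
  have \<rho>: "\<rho> > 0" using \<kappa> by (simp add: \<rho>_def)
  define s1 where "s1 = \<beta>1 + \<kappa> / 8"
  define s2 where "s2 = \<beta>2 + \<kappa> / 8"
  have s: "\<beta>1 < s1" "\<beta>2 < s2" using \<kappa> by (auto simp: s1_def s2_def)
  obtain N1 A1 where N1: "N1 > 0" and A1: "\<And>j::nat. finite (A1 j)" "\<And>j. A1 j \<subseteq> {1..}"
    "\<And>j. real (card (A1 j)) \<le> N1 * 2 powr (real j * s1)"
    "\<And>j t. t \<in> E1 \<Longrightarrow> \<exists>c\<in>A1 j. \<exists>\<tau>\<in>{0..1}. t = c + \<tau> / 2 ^ j"
    by (rule minkowski_dim_grid[OF E(1) dim(1) s(1)]) blast
  obtain N2 A2 where N2: "N2 > 0" and A2: "\<And>j::nat. finite (A2 j)" "\<And>j. A2 j \<subseteq> {1..}"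
    "\<And>j. real (card (A2 j)) \<le> N2 * 2 powr (real j * s2)"
    "\<And>j t. t \<in> E2 \<Longrightarrow> \<exists>c\<in>A2 j. \<exists>\<tau>\<in>{0..1}. t = c + \<tau> / 2 ^ j"
    by (rule minkowski_dim_grid[OF E(2) dim(2) s(2)]) blast
  obtain C where C: "C > 0" and piece:
    "\<And>c1 c2 r \<alpha> \<alpha>' L L' \<phi> \<psi> p q. \<lbrakk>c1 \<ge> 1; c2 \<ge> 1; r \<ge> 1; \<alpha> \<ge> 0; \<alpha>' \<ge> 0;
       \<phi> \<in> borel_measurable borel; \<psi> \<in> borel_measurable borel; p \<in> borel_measurable borel; q \<in> borel_measurable borel;
       \<And>\<xi>. norm (\<phi> \<xi>) \<le> L; \<And>\<eta>. norm (\<psi> \<eta>) \<le> L';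
       \<And>\<xi>. 1 + norm \<xi> \<le> 2 * r \<Longrightarrow> norm (\<phi> \<xi>) \<le> \<alpha> * norm (p \<xi> :: complex);
       \<And>\<eta>. 1 + norm \<eta> \<le> 2 * r \<Longrightarrow> norm (\<psi> \<eta>) \<le> \<alpha>' * norm (q \<eta> :: complex)\<rbrakk> \<Longrightarrow>
      \<exists>Q :: 'a \<Rightarrow> ennreal. Q \<in> borel_measurable borel \<and>
        (\<forall>\<tau>1\<in>{0..1}. \<forall>\<tau>2\<in>{0..1}. \<forall>x.
          ennreal (norm (LINT z|lborel. indicator (shell r) z *\<^sub>R (\<phi> (fst z) * \<psi> (snd z) *
             m ((c1 + \<tau>1 / r) *\<^sub>R fst z, (c2 + \<tau>2 / r) *\<^sub>R snd z) *
             exp (2 * of_real pi * \<i> * of_real (x \<bullet> (fst z + snd z)))))) \<le> Q x) \<and>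
        (\<integral>\<^sup>+x. (Q x)\<^sup>2 \<partial>lborel) \<le> 16 * (ennreal ((\<alpha> * \<alpha>' * (C * r powr (- a)))\<^sup>2) * emeasure lborel (cball (0::'a) (2 * r)) *
           (\<integral>\<^sup>+\<xi>. (ennreal (norm (p \<xi>)))\<^sup>2 \<partial>lborel) * (\<integral>\<^sup>+\<eta>. (ennreal (norm (q \<eta>)))\<^sup>2 \<partial>lborel))"
    by (rule shell_piece_maximal[OF adm]) blast
  define M where "M = (\<Sum>j. 2 powr (- (\<rho> * real j)) :: real)"
  have M: "M \<ge> 0" "(\<Sum>j. ennreal (2 powr (- (\<rho> * real j)))) = ennreal M"
    unfolding M_def using summable_powr_neg[OF \<rho>] by (auto intro!: suminf_nonneg simp: suminf_ennreal2)
  define \<omega> where "\<omega> = unit_ball_vol ?d"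
  have \<omega>: "\<omega> \<ge> 0" by (simp add: \<omega>_def)
  \<comment> \<open>16 C^2 comes from the shell estimate, N1 N2 from the covering counts, \<omega>
    2^d from a ball of radius 2 * 2^j, and 2^(4 \<gamma>) from the losses (2 *
    2^j)^\<gamma>.\<close>
  define D0 where "D0 = 16 * N1 * N2 * C\<^sup>2 * \<omega> * 2 powr ?d * 2 powr (4 * \<gamma>)"
  have D0: "D0 \<ge> 0" using N1 N2 \<omega> by (simp add: D0_def)
  \<comment> \<open>The summand 1 makes the constant strictly positive even if D0 or M were
    0.\<close>
  show thesis
  proof (rule that[of "1 + D0 * M\<^sup>2" \<gamma>])
    show "1 + D0 * M\<^sup>2 > 0" using D0 by (simp add: add_pos_nonneg)
    fix u v f g :: "'a \<Rightarrow> complex" and A A' :: real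
    assume int: "integrable lborel u" "integrable lborel v" "integrable lborel f" "integrable lborel g"
      and A: "A \<ge> 0" "A' \<ge> 0"
      and dom: "\<And>\<xi>. norm (fourier u \<xi>) \<le> A * (1 + norm \<xi>) powr \<gamma> * norm (fourier f \<xi>)"
       "\<And>\<eta>. norm (fourier v \<eta>) \<le> A' * (1 + norm \<eta>) powr \<gamma> * norm (fourier g \<eta>)"
    have [measurable]: "u \<in> borel_measurable borel" "v \<in> borel_measurable borel" "f \<in> borel_measurable borel" "g \<in> borel_measurable borel"
      using int by (auto dest: borel_measurable_integrable)
    let ?r = "\<lambda>j::nat. 2 ^ j :: real"
    let ?w = "\<lambda>j::nat. (2 * ?r j) powr \<gamma>"
    let ?P = "\<integral>\<^sup>+\<xi>. (ennreal (norm (fourier f \<xi>)))\<^sup>2 \<partial>lborel"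
    let ?P' = "\<integral>\<^sup>+\<eta>. (ennreal (norm (fourier g \<eta>)))\<^sup>2 \<partial>lborel"
    define F where "F t1 t2 x z = fourier u (fst z) * fourier v (snd z) * m (t1 *\<^sub>R fst z, t2 *\<^sub>R snd z) *
             exp (2 * of_real pi * \<i> * of_real (x \<bullet> (fst z + snd z)))" for t1 t2 x z
    \<comment> \<open>The conclusion of \<open>piece\<close> as a predicate, so that one majorant
      can be chosen for every shell and every pair of grid points.\<close>
    define good where "good j c1 c2 Q \<longleftrightarrow> Q \<in> borel_measurable borel \<and>
        (\<forall>\<tau>1\<in>{0..1}. \<forall>\<tau>2\<in>{0..1}. \<forall>x.
          ennreal (norm (LINT z|lborel. indicator (shell (?r j)) z *\<^sub>R F (c1 + \<tau>1 / ?r j) (c2 + \<tau>2 / ?r j) x z)) \<le> Q x) \<and>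
        (\<integral>\<^sup>+x. (Q x)\<^sup>2 \<partial>lborel) \<le> 16 * (ennreal (((A * ?w j) * (A' * ?w j) * (C * ?r j powr (- a)))\<^sup>2) * emeasure lborel (cball (0::'a) (2 * ?r j)) * ?P * ?P')"
      for j c1 c2 and Q :: "'a \<Rightarrow> ennreal"
    have "\<exists>Q. good j c1 c2 Q" if "c1 \<in> A1 j" "c2 \<in> A2 j" for j c1 c2
      unfolding good_def F_def
    proof (rule piece)
      show "norm (fourier u \<xi>) \<le> (A * ?w j) * norm (fourier f \<xi>)" if "1 + norm \<xi> \<le> 2 * ?r j" for \<xi>
        by (rule order_trans[OF dom(1)]) (use A \<gamma> that in \<open>intro mult_right_mono mult_left_mono powr_mono2\<close>, auto)
      show "norm (fourier v \<xi>) \<le> (A' * ?w j) * norm (fourier g \<xi>)" if "1 + norm \<xi> \<le> 2 * ?r j" for \<xi>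
        by (rule order_trans[OF dom(2)]) (use A \<gamma> that in \<open>intro mult_right_mono mult_left_mono powr_mono2\<close>, auto)
    qed (use that A1(2)[of j] A2(2)[of j] A in \<open>auto intro: norm_fourier_le int\<close>)
    then have ex: "\<And>j c1 c2. c1 \<in> A1 j \<Longrightarrow> c2 \<in> A2 j \<Longrightarrow> \<exists>Q. good j c1 c2 Q" .
    define Q where "Q j c1 c2 = (SOME Q. good j c1 c2 Q)" for j c1 c2
    have Q: "good j c1 c2 (Q j c1 c2)" if "c1 \<in> A1 j" "c2 \<in> A2 j" for j c1 c2
      unfolding Q_def by (rule someI_ex[OF ex[OF that]])
    have Q_m: "Q j c1 c2 \<in> borel_measurable borel" if "c1 \<in> A1 j" "c2 \<in> A2 j" for j c1 c2
      using Q[OF that] by (simp add: good_def)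
    \<comment> \<open>At each x a given (t1, t2) needs one grid cell per shell; summing squares over
      all cells bounds it uniformly in (t1, t2) and costs only the number of cells.\<close>
    define Z where "Z j x = (\<Sum>c1\<in>A1 j. \<Sum>c2\<in>A2 j. (Q j c1 c2 x)\<^sup>2)" for j x
    have Z_m [measurable]: "Z j \<in> borel_measurable borel" for j
      unfolding Z_def by (intro borel_measurable_sum borel_measurable_power_ennreal Q_m)
    have pointwise: "(maximal_op m E1 E2 u v x)\<^sup>2 \<le> ennreal M * (\<Sum>j. ennreal (2 powr (\<rho> * real j)) * Z j x)" for x
      unfolding maximal_op_def
    proof (rule SUP_power2_le, clarify)
      fix t1 t2 assume t: "t1 \<in> E1" "t2 \<in> E2"
      define b where "b j = ennreal (norm (LINT z|lborel. indicator (shell (?r j)) z *\<^sub>R F t1 t2 x z))" for j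
      have b: "(b j)\<^sup>2 \<le> Z j x" for j
      proof -
        obtain c1 \<tau>1 where c1: "c1 \<in> A1 j" "\<tau>1 \<in> {0..1}" "t1 = c1 + \<tau>1 / 2 ^ j" using A1(4)[OF t(1)] by blast
        obtain c2 \<tau>2 where c2: "c2 \<in> A2 j" "\<tau>2 \<in> {0..1}" "t2 = c2 + \<tau>2 / 2 ^ j" using A2(4)[OF t(2)] by blast
        have "b j \<le> Q j c1 c2 x" using Q[OF c1(1) c2(1)] c1 c2 by (simp add: good_def b_def)
        then have "(b j)\<^sup>2 \<le> (Q j c1 c2 x)\<^sup>2" by (rule power_mono) simp
        also have "\<dots> \<le> (\<Sum>c2\<in>A2 j. (Q j c1 c2 x)\<^sup>2)"
          using c2 A2(1) by (intro member_le_sum) auto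
        also have "\<dots> \<le> Z j x" unfolding Z_def
          using c1 A1(1) by (intro member_le_sum[where f="\<lambda>c1. \<Sum>c2\<in>A2 j. (Q j c1 c2 x)\<^sup>2"]) auto
        finally show ?thesis .
      qed
      have "bilinear_op m t1 t2 u v x = (LINT z|lborel. F t1 t2 x z)"
        unfolding bilinear_op_def F_def by (simp add: split_beta')
      then have "ennreal (norm (bilinear_op m t1 t2 u v x)) \<le> (\<Sum>j. b j)"
        unfolding b_def using norm_integral_le_shells by simp
      then have "(ennreal (norm (bilinear_op m t1 t2 u v x)))\<^sup>2 \<le> (\<Sum>j. b j)\<^sup>2" by (rule power_mono) simp
      also have "\<dots> \<le> ennreal M * (\<Sum>j. ennreal (2 powr (\<rho> * real j)) * (b j)\<^sup>2)"
        using suminf_power2_le_weighted[OF \<rho>, of b] by (simp add: M)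
      also have "\<dots> \<le> ennreal M * (\<Sum>j. ennreal (2 powr (\<rho> * real j)) * Z j x)"
        by (intro mult_left_mono suminf_le summableI b) auto
      finally show "(ennreal (norm (bilinear_op m t1 t2 u v x)))\<^sup>2 \<le> ennreal M * (\<Sum>j. ennreal (2 powr (\<rho> * real j)) * Z j x)" .
    qed
    have scale: "ennreal (2 powr (\<rho> * real j)) * (\<integral>\<^sup>+x. Z j x \<partial>lborel) \<le> ennreal (D0 * (A * A')\<^sup>2) * ennreal (2 powr (- (\<rho> * real j))) * (?P * ?P')" for j
    proof -
      define q where "q = 16 * (((A * ?w j) * (A' * ?w j) * (C * ?r j powr (- a)))\<^sup>2 * (\<omega> * (2 * ?r j) ^ DIM('a)))"
      have q: "q \<ge> 0" using \<omega> by (simp add: q_def)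
      have "(\<integral>\<^sup>+x. Z j x \<partial>lborel) = (\<Sum>c1\<in>A1 j. \<Sum>c2\<in>A2 j. (\<integral>\<^sup>+x. (Q j c1 c2 x)\<^sup>2 \<partial>lborel))"
        unfolding Z_def
        by (subst nn_integral_sum)
           (auto intro!: sum.cong nn_integral_sum borel_measurable_sum borel_measurable_power_ennreal Q_m)
      also have "\<dots> \<le> (\<Sum>c1\<in>A1 j. \<Sum>c2\<in>A2 j. ennreal q * (?P * ?P'))"
      proof (intro sum_mono)
        fix c1 c2 assume "c1 \<in> A1 j" "c2 \<in> A2 j"
        then have "(\<integral>\<^sup>+x. (Q j c1 c2 x)\<^sup>2 \<partial>lborel) \<le> 16 * (ennreal (((A * ?w j) * (A' * ?w j) * (C * ?r j powr (- a)))\<^sup>2) * emeasure lborel (cball (0::'a) (2 * ?r j)) * ?P * ?P')"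
          using Q by (simp add: good_def)
        also have "emeasure lborel (cball (0::'a) (2 * ?r j)) = ennreal (\<omega> * (2 * ?r j) ^ DIM('a))"
          by (subst emeasure_cball) (simp_all add: \<omega>_def)
        also have "16 * (ennreal (((A * ?w j) * (A' * ?w j) * (C * ?r j powr (- a)))\<^sup>2) * ennreal (\<omega> * (2 * ?r j) ^ DIM('a)) * ?P * ?P') = ennreal q * (?P * ?P')"
          unfolding q_def using \<omega> by (simp add: ennreal_mult mult.assoc)
        finally show "(\<integral>\<^sup>+x. (Q j c1 c2 x)\<^sup>2 \<partial>lborel) \<le> ennreal q * (?P * ?P')" .
      qed
      also have "\<dots> = ennreal (real (card (A1 j)) * real (card (A2 j)) * q) * (?P * ?P')"
        using q by (simp add: ennreal_mult ennreal_of_nat_eq_real_of_nat mult.assoc)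
      finally have "ennreal (2 powr (\<rho> * real j)) * (\<integral>\<^sup>+x. Z j x \<partial>lborel) \<le>
          ennreal (2 powr (\<rho> * real j)) * (ennreal (real (card (A1 j)) * real (card (A2 j)) * q) * (?P * ?P'))"
        by (rule mult_left_mono) simp
      also have "\<dots> = ennreal (2 powr (\<rho> * real j) * (real (card (A1 j)) * real (card (A2 j)) * q)) * (?P * ?P')"
        using q by (simp add: ennreal_mult mult.assoc)
      also have "\<dots> \<le> ennreal (D0 * (A * A')\<^sup>2 * 2 powr (- (\<rho> * real j))) * (?P * ?P')"
      proof (intro mult_right_mono ennreal_leI)
        let ?J = "real j"
        have rj: "?r j = 2 powr ?J" by (simp add: powr_realpow)
        have w: "?w j = 2 powr (\<gamma> * (1 + ?J))"
        proof -
          have "2 * ?r j = 2 powr (1 + ?J)" by (simp add: rj powr_add)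
          then show ?thesis by (simp add: powr_powr mult.commute)
        qed
        have ra: "?r j powr (- a) = 2 powr (- (a * ?J))"
          by (simp add: rj powr_powr mult.commute)
        have rd: "(2 * ?r j) ^ DIM('a) = 2 powr ?d * 2 powr (?d * ?J)"
          by (simp only: power_mult_distrib rj powr_power) (simp add: powr_realpow mult.commute)
        have q_eq: "q = (16 * C\<^sup>2 * \<omega> * 2 powr ?d) * (A * A')\<^sup>2 * (2 powr (4 * (\<gamma> * (1 + ?J))) * 2 powr (- (2 * a * ?J)) * 2 powr (?d * ?J))"
        proof -
          have aux: "16 * (((A * w) * (A' * w) * (C * y))\<^sup>2 * (\<omega> * (X * Y))) =
              (16 * C\<^sup>2 * \<omega> * X) * (A * A')\<^sup>2 * ((w\<^sup>2 * w\<^sup>2) * y\<^sup>2 * Y)" for w y X Y :: real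
            by (simp add: power2_eq_square)
          have "(2 powr (\<gamma> * (1 + ?J)))\<^sup>2 * (2 powr (\<gamma> * (1 + ?J)))\<^sup>2 = (2::real) powr (4 * (\<gamma> * (1 + ?J)))"
            by (simp add: powr_power flip: powr_add)
          moreover have "(2 powr (- (a * ?J)))\<^sup>2 = (2::real) powr (- (2 * a * ?J))"
            by (simp add: powr_power mult.assoc)
          ultimately show ?thesis
            unfolding q_def w ra rd by (simp only: aux)
        qed
        have "2 powr (\<rho> * ?J) * (real (card (A1 j)) * real (card (A2 j)) * q) \<le>
          2 powr (\<rho> * ?J) * ((N1 * 2 powr (?J * s1)) * (N2 * 2 powr (?J * s2)) * q)"
          using A1(3)[of j] A2(3)[of j] q N1 N2 by (intro mult_left_mono mult_right_mono mult_mono) auto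
        also have "\<dots> = (16 * N1 * N2 * C\<^sup>2 * \<omega> * 2 powr ?d) * (A * A')\<^sup>2 *
           2 powr (\<rho> * ?J + ?J * s1 + ?J * s2 + 4 * (\<gamma> * (1 + ?J)) + (- (2 * a * ?J)) + ?d * ?J)"
          unfolding q_eq powr_add by (simp only: mult_ac)
        \<comment> \<open>The coefficient of j is \<rho> + s1 + s2 + 4 \<gamma> - 2a + d = \<rho> +
          \<kappa>/4 + 4 \<gamma> - \<kappa>, which is at most -\<kappa>/4 = -\<rho>.\<close>
        also have "\<dots> \<le> (16 * N1 * N2 * C\<^sup>2 * \<omega> * 2 powr ?d) * (A * A')\<^sup>2 * 2 powr (4 * \<gamma> + - (\<rho> * ?J))"
        proof (intro mult_left_mono powr_mono)
          have "4 * \<gamma> * ?J \<le> \<kappa> / 4 * ?J" using \<gamma>(3) by (intro mult_right_mono) auto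
          then show "\<rho> * ?J + ?J * s1 + ?J * s2 + 4 * (\<gamma> * (1 + ?J)) + (- (2 * a * ?J)) + ?d * ?J \<le> 4 * \<gamma> + - (\<rho> * ?J)"
            unfolding \<rho>_def s1_def s2_def \<kappa>_def by (simp add: algebra_simps)
        qed (use N1 N2 \<omega> in auto)
        also have "\<dots> = D0 * (A * A')\<^sup>2 * 2 powr (- (\<rho> * ?J))"
          unfolding D0_def powr_add by (simp only: mult_ac)
        finally show "2 powr (\<rho> * ?J) * (real (card (A1 j)) * real (card (A2 j)) * q) \<le> D0 * (A * A')\<^sup>2 * 2 powr (- (\<rho> * ?J))" .
      qed simp
      also have "\<dots> = ennreal (D0 * (A * A')\<^sup>2) * ennreal (2 powr (- (\<rho> * real j))) * (?P * ?P')"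
        using D0 by (simp add: ennreal_mult)
      finally show ?thesis .
    qed
    have "(\<integral>\<^sup>+x. (maximal_op m E1 E2 u v x)\<^sup>2 \<partial>lborel) \<le> (\<integral>\<^sup>+x. ennreal M * (\<Sum>j. ennreal (2 powr (\<rho> * real j)) * Z j x) \<partial>lborel)"
      by (intro nn_integral_mono pointwise)
    also have "\<dots> = ennreal M * (\<Sum>j. ennreal (2 powr (\<rho> * real j)) * (\<integral>\<^sup>+x. Z j x \<partial>lborel))"
      by (simp add: nn_integral_cmult nn_integral_suminf)
    \<comment> \<open>\<open>M\<close> appears twice: from the Cauchy-Schwarz weights, and from
      summing the decay left over in \<open>scale\<close>.\<close>
    also have "\<dots> \<le> ennreal M * (\<Sum>j. ennreal (D0 * (A * A')\<^sup>2) * ennreal (2 powr (- (\<rho> * real j))) * (?P * ?P'))"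
      by (intro mult_left_mono suminf_le summableI scale) auto
    also have "\<dots> = ennreal M * (ennreal (D0 * (A * A')\<^sup>2) * ennreal M * (?P * ?P'))"
      by (simp only: ennreal_suminf_multc ennreal_suminf_cmult M(2))
    also have "\<dots> = ennreal (D0 * M\<^sup>2 * (A * A')\<^sup>2) * (?P * ?P')"

    proof -
      have X: "D0 * (A * A')\<^sup>2 \<ge> 0" using D0 by simp
      have e: "D0 * M\<^sup>2 * (A * A')\<^sup>2 = M * (D0 * (A * A')\<^sup>2 * M)" by (simp add: power2_eq_square)
      show ?thesis
        unfolding e ennreal_mult[OF M(1) mult_nonneg_nonneg[OF X M(1)]] ennreal_mult[OF X M(1)]
        by (simp only: mult.assoc)
    qed
    \<comment> \<open>Only here does the bound return from the Fourier transforms of f and g to f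
      and g themselves.\<close>
    also have "\<dots> \<le> ennreal ((1 + D0 * M\<^sup>2) * (A * A')\<^sup>2) * ((\<integral>\<^sup>+x. (ennreal (norm (f x)))\<^sup>2 \<partial>lborel) * (\<integral>\<^sup>+x. (ennreal (norm (g x)))\<^sup>2 \<partial>lborel))"
      by (intro mult_mono ennreal_leI nn_integral_norm_fourier_sq_le int mult_right_mono) auto
    finally show "(\<integral>\<^sup>+x. (maximal_op m E1 E2 u v x)\<^sup>2 \<partial>lborel) \<le>
        ennreal ((1 + D0 * M\<^sup>2) * (A * A')\<^sup>2) * (\<integral>\<^sup>+x. (ennreal (norm (f x)))\<^sup>2 \<partial>lborel) * (\<integral>\<^sup>+x. (ennreal (norm (g x)))\<^sup>2 \<partial>lborel)"
      by (simp add: mult.assoc)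
  qed (use \<gamma> in auto)
qed

section \<open>Deduction of the two difference estimates\<close>

theorem corollary4p3:
  fixes E\<^sub>1 E\<^sub>2 :: "real set"
    and \<beta>\<^sub>1 \<beta>\<^sub>2 a :: real
    and m :: "(real ^ 'd) \<times> (real ^ 'd) \<Rightarrow> complex"
  assumes "E\<^sub>1 \<noteq> {}" "E\<^sub>1 \<subseteq> {1..2}"
    and "E\<^sub>2 \<noteq> {}" "E\<^sub>2 \<subseteq> {1..2}"
    and "upper_minkowski_dim E\<^sub>1 = ereal \<beta>\<^sub>1"
    and "upper_minkowski_dim E\<^sub>2 = ereal \<beta>\<^sub>2"
    and "admissible a 2 m"
    and "2 * a > real CARD('d) + \<beta>\<^sub>1 + \<beta>\<^sub>2"
  shows
    "(\<exists>\<gamma>>0. \<exists>C>0. \<forall>f g :: real ^ 'd \<Rightarrow> complex. \<forall>h :: real ^ 'd.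
        test_function f \<longrightarrow> test_function g \<longrightarrow> norm h < 1 \<longrightarrow>
        L2_norm (maximal_op m E\<^sub>1 E\<^sub>2 (\<lambda>x. f x - translate h f x) g)
          + L2_norm (maximal_op m E\<^sub>1 E\<^sub>2 f (\<lambda>x. g x - translate h g x))
        \<le> ennreal (C * norm h powr \<gamma>) * L2_norm_fun f * L2_norm_fun g)
     \<and>
     (\<exists>\<gamma>\<^sub>1>0. \<exists>\<gamma>\<^sub>2>0. \<exists>C>0. \<forall>f g :: real ^ 'd \<Rightarrow> complex. \<forall>h\<^sub>1 h\<^sub>2 :: real ^ 'd.
        test_function f \<longrightarrow> test_function g \<longrightarrow> norm h\<^sub>1 < 1 \<longrightarrow> norm h\<^sub>2 < 1 \<longrightarrow>
        L2_norm (maximal_op m E\<^sub>1 E\<^sub>2 (\<lambda>x. f x - translate h\<^sub>1 f x) (\<lambda>x. g x - translate h\<^sub>2 g x))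
        \<le> ennreal (C * norm h\<^sub>1 powr \<gamma>\<^sub>1 * norm h\<^sub>2 powr \<gamma>\<^sub>2) * L2_norm_fun f * L2_norm_fun g)"
proof -
  have gap: "2 * a > real DIM(real ^ 'd) + \<beta>\<^sub>1 + \<beta>\<^sub>2" using assms(8) by simp
  obtain D \<gamma> where D: "D > 0" and \<gamma>: "0 < \<gamma>" "\<gamma> \<le> 1" and main:
    "\<And>u v f g A A'. \<lbrakk>integrable lborel u; integrable lborel v; integrable lborel f; integrable lborel g;
       A \<ge> 0; A' \<ge> 0;
       \<And>\<xi>. norm (fourier u \<xi>) \<le> A * (1 + norm \<xi>) powr \<gamma> * norm (fourier f \<xi>);
       \<And>\<eta>. norm (fourier v \<eta>) \<le> A' * (1 + norm \<eta>) powr \<gamma> * norm (fourier g \<eta>)\<rbrakk> \<Longrightarrow>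
      (\<integral>\<^sup>+x. (maximal_op m E\<^sub>1 E\<^sub>2 u v x)\<^sup>2 \<partial>lborel) \<le>
        ennreal (D * (A * A')\<^sup>2) * (\<integral>\<^sup>+x. (ennreal (norm (f x)))\<^sup>2 \<partial>lborel) * (\<integral>\<^sup>+x. (ennreal (norm (g x)))\<^sup>2 \<partial>lborel)"
    by (rule maximal_op_L2_bound[OF assms(7,2,4,5,6) gap]) blast
  define c where "c = sqrt D"
  have c: "c > 0" "c\<^sup>2 = D" using D by (simp_all add: c_def)
  define bounded_by where "bounded_by u A f \<longleftrightarrow> integrable lborel u \<and> A \<ge> 0 \<and>
      (\<forall>\<xi>. norm (fourier u \<xi>) \<le> A * (1 + norm \<xi>) powr \<gamma> * norm (fourier f \<xi>))" for u f :: "real ^ 'd \<Rightarrow> complex" and A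
  have L2: "L2_norm (maximal_op m E\<^sub>1 E\<^sub>2 u v) \<le> ennreal (c * (A * A')) * L2_norm_fun f * L2_norm_fun g"
    if "test_function f" "test_function g" "bounded_by u A f" "bounded_by v A' g" for u v f g A A'
  proof (rule L2_norm_le)
    show "c * (A * A') \<ge> 0" using that c by (simp add: bounded_by_def)
    have "(c * (A * A'))\<^sup>2 = D * (A * A')\<^sup>2" by (simp add: power_mult_distrib c)
    then show "(\<integral>\<^sup>+x. (maximal_op m E\<^sub>1 E\<^sub>2 u v x)\<^sup>2 \<partial>lborel) \<le>
        ennreal ((c * (A * A'))\<^sup>2) * (\<integral>\<^sup>+x. (ennreal (norm (f x)))\<^sup>2 \<partial>lborel) * (\<integral>\<^sup>+x. (ennreal (norm (g x)))\<^sup>2 \<partial>lborel)"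
      using main[of u v f g A A'] that by (simp add: bounded_by_def test_function_integrable)
  qed (use that test_function_L2_finite in auto)
  \<comment> \<open>The weight (1 + |\<xi>|)^\<gamma> is at least 1, so a function dominates its own
    transform with A = 1.\<close>
  have self: "bounded_by f 1 f" if "test_function f" for f
  proof -
    have "1 \<le> (1 + norm \<xi>) powr \<gamma>" for \<xi> :: "real ^ 'd" using \<gamma> by (intro ge_one_powr_ge_zero) auto
    then have "norm (fourier f \<xi>) \<le> (1 + norm \<xi>) powr \<gamma> * norm (fourier f \<xi>)" for \<xi>
      using mult_right_mono[of 1 "(1 + norm \<xi>) powr \<gamma>" "norm (fourier f \<xi>)"] by simp
    then show ?thesis using test_function_integrable[OF that] by (simp add: bounded_by_def)
  qed
  have diff: "bounded_by (\<lambda>x. f x - translate h f x) (4 * pi * norm h powr \<gamma>) f" if "test_function f" for f h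
    using norm_fourier_diff_translate_le[OF test_function_integrable[OF that] \<gamma>]
      test_function_integrable[OF that] by (simp add: bounded_by_def integrable_translate)
  show ?thesis
  proof (intro conjI)
    show "\<exists>\<gamma>>0. \<exists>C>0. \<forall>f g :: real ^ 'd \<Rightarrow> complex. \<forall>h :: real ^ 'd.
        test_function f \<longrightarrow> test_function g \<longrightarrow> norm h < 1 \<longrightarrow>
        L2_norm (maximal_op m E\<^sub>1 E\<^sub>2 (\<lambda>x. f x - translate h f x) g)
          + L2_norm (maximal_op m E\<^sub>1 E\<^sub>2 f (\<lambda>x. g x - translate h g x))
        \<le> ennreal (C * norm h powr \<gamma>) * L2_norm_fun f * L2_norm_fun g"
    proof (intro exI conjI allI impI)
      show "\<gamma> > 0" by (rule \<gamma>)
      \<comment> \<open>Twice 4 pi c, one share for each of the two summands; 4 pi is the constant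
        of the phase bound.\<close>
      show "8 * pi * c > 0" using c by simp
      fix f g :: "real ^ 'd \<Rightarrow> complex" and h :: "real ^ 'd"
      assume fg: "test_function f" "test_function g"
      let ?N = "L2_norm_fun f * L2_norm_fun g" and ?q = "4 * pi * c * norm h powr \<gamma>"
      have "L2_norm (maximal_op m E\<^sub>1 E\<^sub>2 (\<lambda>x. f x - translate h f x) g) \<le> ennreal ?q * ?N"
        using L2[OF fg diff[OF fg(1)] self[OF fg(2)], of h] by (simp add: mult_ac)
      moreover have "L2_norm (maximal_op m E\<^sub>1 E\<^sub>2 f (\<lambda>x. g x - translate h g x)) \<le> ennreal ?q * ?N"
        using L2[OF fg self[OF fg(1)] diff[OF fg(2)], of h] by (simp add: mult_ac)
      ultimately have "L2_norm (maximal_op m E\<^sub>1 E\<^sub>2 (\<lambda>x. f x - translate h f x) g)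
          + L2_norm (maximal_op m E\<^sub>1 E\<^sub>2 f (\<lambda>x. g x - translate h g x)) \<le> ennreal ?q * ?N + ennreal ?q * ?N"
        by (rule add_mono)
      also have "\<dots> = ennreal (?q + ?q) * ?N"
        using c by (subst ennreal_plus) (auto simp: distrib_right)
      also have "?q + ?q = 8 * pi * c * norm h powr \<gamma>" by simp
      finally show "L2_norm (maximal_op m E\<^sub>1 E\<^sub>2 (\<lambda>x. f x - translate h f x) g)
          + L2_norm (maximal_op m E\<^sub>1 E\<^sub>2 f (\<lambda>x. g x - translate h g x))
          \<le> ennreal (8 * pi * c * norm h powr \<gamma>) * L2_norm_fun f * L2_norm_fun g"
        by (simp add: mult.assoc)
    qed
    show "\<exists>\<gamma>\<^sub>1>0. \<exists>\<gamma>\<^sub>2>0. \<exists>C>0. \<forall>f g :: real ^ 'd \<Rightarrow> complex. \<forall>h\<^sub>1 h\<^sub>2 :: real ^ 'd.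
        test_function f \<longrightarrow> test_function g \<longrightarrow> norm h\<^sub>1 < 1 \<longrightarrow> norm h\<^sub>2 < 1 \<longrightarrow>
        L2_norm (maximal_op m E\<^sub>1 E\<^sub>2 (\<lambda>x. f x - translate h\<^sub>1 f x) (\<lambda>x. g x - translate h\<^sub>2 g x))
        \<le> ennreal (C * norm h\<^sub>1 powr \<gamma>\<^sub>1 * norm h\<^sub>2 powr \<gamma>\<^sub>2) * L2_norm_fun f * L2_norm_fun g"
    proof (intro exI conjI allI impI)
      show "\<gamma> > 0" by (rule \<gamma>)
      show "\<gamma> > 0" by (rule \<gamma>)
      \<comment> \<open>Both arguments are differences, each contributing a factor 4 pi and its own
        power of the shift.\<close>
      show "16 * pi\<^sup>2 * c > 0" using c by simp
      fix f g :: "real ^ 'd \<Rightarrow> complex" and h\<^sub>1 h\<^sub>2 :: "real ^ 'd"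
      assume fg: "test_function f" "test_function g"
      have eq: "c * ((4 * pi * norm h\<^sub>1 powr \<gamma>) * (4 * pi * norm h\<^sub>2 powr \<gamma>)) = 16 * pi\<^sup>2 * c * norm h\<^sub>1 powr \<gamma> * norm h\<^sub>2 powr \<gamma>"
        by (simp add: power2_eq_square)
      show "L2_norm (maximal_op m E\<^sub>1 E\<^sub>2 (\<lambda>x. f x - translate h\<^sub>1 f x) (\<lambda>x. g x - translate h\<^sub>2 g x))
        \<le> ennreal (16 * pi\<^sup>2 * c * norm h\<^sub>1 powr \<gamma> * norm h\<^sub>2 powr \<gamma>) * L2_norm_fun f * L2_norm_fun g"
        using L2[OF fg diff[OF fg(1)] diff[OF fg(2)], of h\<^sub>1 h\<^sub>2] unfolding eq .
    qed
  qed
qed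

end
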